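(* Consider the discretized problem $\dot U=DU+g(t)$, $t\in[0,t^*]$, in the setting described in the context. Assume that there is a constant $C$ (independent of the spatial grid) such that $$\|U^{(j)}(t)\|_\infty\le C,\quad \|g^{(i)}(t)\|_\infty\le C,\qquad i=0,\ldots,3,\ j=0,\ldots,4,\ t\in[0,t^*],$$ that $\dot g_j(t)=0$ for $j=2,\ldots,m$, and that, with $\varphi_j(t):=D_jU(t)+g_j(t)$, for all indices $i_1<i_2<\cdots<i_r<j$ (with $r\ge 1$) one has $$D_{i_1}D_{i_2}\cdots D_{i_r}\dot\varphi_j(t)=\beta_{i_1}\cdots\beta_{i_r}\beta_j\,\frac{\partial^{2r+2}\,\dot u(t,\vec{x}_G)}{\partial x_{i_1}^2\cdots\partial x_{i_r}^2\,\partial x_j^2}+\mathcal{O}\big((\Delta x_{i_1})^2+\cdots+(\Delta x_{i_r})^2+(\Delta x_j)^2\big),$$ $$D_{i_1}D_{i_2}\cdots D_{i_r}\ddot\varphi_j(t)=\beta_{i_1}\cdots\beta_{i_r}\beta_j\,\frac{\partial^{2r+2}\,\ddot u(t,\vec{x}_G)}{\partial x_{i_1}^2\cdots\partial x_{i_r}^2\,\partial x_j^2}+\mathcal{O}\big((\Delta x_{i_1})^2+\cdots+(\Delta x_{i_r})^2+(\Delta x_j)^2\big).$$ Let $U_n$ be the numerical solution at $t_n=n\tau$ given by the Douglas method with $\theta=1/2$: $$v_0=U_n+\tau(DU_n+g(t_n)),$$ $$v_i=v_{i-1}+\theta\tau\big((D_iv_i+g_i(t_{n+1}))-(D_iU_n+g_i(t_n))\big)\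 (i=1,\ldots,m),\qquad U_{n+1}=v_m.$$ If the global errors $E_n:=U_n-U(t_n)$ satisfy $DE_0=\mathcal{O}(\tau^2)$ in the maximum norm, then $$\|E_n\|_\infty\le C'\tau^2,\qquad n=1,\ldots,n^*=t^*/\tau,$$ where the constant $C'$ depends only on $m$ and $C$ (the fixed data listed in the context being regarded as given); in particular $C'$ is independent of $n$, of $\tau>0$ and of the spatial resolution $N_1,\ldots,N_m$.
   Context: PDE: $m\geq 1$ is an integer, $\beta_1,\ldots,\beta_m>0$ are constants, and $u(t,\vec{x})$ is the solution of $\partial_t u=\sum_{j=1}^m\beta_j\partial_{x_jx_j}u+c(t,\vec{x})$ for $t\in[0,t^*]$, $\vec{x}\in(0,1)^m$, with an initial condition $u(0,\vec{x})=u_0(\vec{x})$ and Dirichlet boundary conditions, which are assumed time-independent. $u$ is assumed to be a smooth function (with as many bounded derivatives as required) on $[0,t^*]\times[0,1]^m$. Spatial discretization: for positive integers $N_1,\ldots,N_m$ let $\Delta x_j=1/(N_j+1)$, let $I_j$ be the identity of dimension $N_j$, $L_j=\frac{1}{\Delta x_j^2}\mathrm{tridiag}(1,-2,1)$ of dimension $N_j$, $D_j=\beta_j(I_m\otimes\cdots\otimes I_{j+1}\otimes L_j\otimes I_{j-1}\otimes\cdots\otimes I_1)$ and $D=\sum_{j=1}^mD_j$ (second-order central differences on the uniform grid $G$ of interior points $\vec{x}_G$). The semidiscrete system is $\dot U=DU+g(t)$, $g(t)=\sum_{j=1}^mg_j(t)$, where the discretization of $c$ is included entirely in $g_1$, and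 $g_j$ for $j\ge 2$ consists only of contributions from the boundary conditions in the $j$-direction. Spatial truncation errors are disregarded: $U(t)=u(t,\vec{x}_G)$ is assumed to be at the same time the exact solution of the ODE system and the restriction of the PDE solution to the grid. The vectors $\varphi_i(t)=D_iU(t)+g_i(t)$ satisfy $\sum_{i=1}^m\varphi_i(t)=\dot U(t)$ and are smooth, i.e. they have first and second time derivatives bounded in the maximum norm independently of the spatial resolution. Conventions: dots and superscripts in parentheses on $U,g,g_j,\varphi_j,u$ denote time derivatives; $\|\cdot\|_\infty$ is the maximum norm; all $\mathcal{O}$-constants are independent of $\tau$, $t$ and the spatial resolution; $\tau>0$ is the time step with $t^*/\tau$ an integer. The data $t^*$, $\beta_1,\ldots,\beta_m$, $u$, and the constants implied by the $\mathcal{O}$-terms and smoothness assumptions are regarded as fixed. *)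

theory Defs
  imports "HOL-Analysis.Analysis"
begin

text \<open>Directions are numbered by \<open>1, \<dots>, m\<close>. Points of the closed unit cube are extensional
  functions on \<open>{1..m}\<close>, so that this set is compact in the product topology on
  \<^typ>\<open>nat \<Rightarrow> real\<close>.\<close>

type_synonym point = "nat \<Rightarrow> real"
type_synonym gridfun = "(nat \<Rightarrow> nat) \<Rightarrow> real"

definition cube :: "nat \<Rightarrow> point set" where
  "cube m = {1..m} \<rightarrow>\<^sub>E {0..1}"

definition open_cube :: "nat \<Rightarrow> point set" where
  "open_cube m = {1..m} \<rightarrow>\<^sub>E {0<..<1}"

text \<open>Derivatives are taken relative to \<open>[0,T]\<close> in time and \<open>[0,1]\<close> in space, hence one-sided
  at the end points. \<open>ddt\<close> is used both for functions of space and for grid functions.\<close>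

definition ddt :: "real \<Rightarrow> (real \<Rightarrow> 'a \<Rightarrow> real) \<Rightarrow> real \<Rightarrow> 'a \<Rightarrow> real" where
  "ddt T f = (\<lambda>t x. vector_derivative (\<lambda>s. f s x) (at t within {0..T}))"

definition ddx :: "nat \<Rightarrow> (real \<Rightarrow> point \<Rightarrow> real) \<Rightarrow> real \<Rightarrow> point \<Rightarrow> real" where
  "ddx j f = (\<lambda>t x. vector_derivative (\<lambda>s. f t (x(j := s))) (at (x j) within {0..1}))"

definition ddx2 :: "nat \<Rightarrow> (real \<Rightarrow> point \<Rightarrow> real) \<Rightarrow> real \<Rightarrow> point \<Rightarrow> real" where
  "ddx2 j f = ddx j (ddx j f)"

definition bounded_cont :: "real \<Rightarrow> nat \<Rightarrow> (real \<Rightarrow> point \<Rightarrow> real) \<Rightarrow> bool" where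
  "bounded_cont T m f \<longleftrightarrow>
     continuous_on ({0..T} \<times> cube m) (\<lambda>(t, x). f t x) \<and>
     bounded ((\<lambda>(t, x). f t x) ` ({0..T} \<times> cube m))"

text \<open>All partial derivatives in \<open>t, x\<^sub>1, \<dots>, x\<^sub>m\<close> of order at most \<open>k\<close>, taken in any sequence,
  exist and are continuous and bounded on \<open>[0,T] \<times> [0,1]\<^sup>m\<close>.\<close>

primrec smooth_upto :: "nat \<Rightarrow> real \<Rightarrow> nat \<Rightarrow> (real \<Rightarrow> point \<Rightarrow> real) \<Rightarrow> bool" where
  "smooth_upto 0 T m f \<longleftrightarrow> bounded_cont T m f"
| "smooth_upto (Suc k) T m f \<longleftrightarrow> bounded_cont T m f \<and>
     (\<forall>t\<in>{0..T}. \<forall>x\<in>cube m. (\<lambda>s. f s x) differentiable (at t within {0..T})) \<and>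
     (\<forall>t\<in>{0..T}. \<forall>x\<in>cube m. \<forall>j\<in>{1..m}.
        (\<lambda>s. f t (x(j := s))) differentiable (at (x j) within {0..1})) \<and>
     smooth_upto k T m (ddt T f) \<and>
     (\<forall>j\<in>{1..m}. smooth_upto k T m (ddx j f))"

text \<open>\<open>N j\<close> is the number of interior grid points in direction \<open>j\<close>; grid points and components of
  grid vectors are labelled by multi-indices.\<close>

definition dx :: "(nat \<Rightarrow> nat) \<Rightarrow> nat \<Rightarrow> real" where
  "dx N j = 1 / real (N j + 1)"

definition grid :: "nat \<Rightarrow> (nat \<Rightarrow> nat) \<Rightarrow> (nat \<Rightarrow> nat) set" where
  "grid m N = (\<Pi>\<^sub>E j\<in>{1..m}. {1..N j})"

definition gridpt :: "nat \<Rightarrow> (nat \<Rightarrow> nat) \<Rightarrow> (nat \<Rightarrow> nat) \<Rightarrow> point" where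
  "gridpt m N k = (\<lambda>j\<in>{1..m}. real (k j) * dx N j)"

definition on_grid :: "nat \<Rightarrow> (nat \<Rightarrow> nat) \<Rightarrow> (real \<Rightarrow> point \<Rightarrow> real) \<Rightarrow> real \<Rightarrow> gridfun" where
  "on_grid m N f = (\<lambda>t k. f t (gridpt m N k))"

definition maxnorm :: "nat \<Rightarrow> (nat \<Rightarrow> nat) \<Rightarrow> gridfun \<Rightarrow> real" where
  "maxnorm m N V = Max ((\<lambda>k. \<bar>V k\<bar>) ` grid m N)"

definition id_entry :: "nat \<Rightarrow> nat \<Rightarrow> real" where
  "id_entry p q = (if p = q then 1 else 0)"

definition L_entry :: "(nat \<Rightarrow> nat) \<Rightarrow> nat \<Rightarrow> nat \<Rightarrow> nat \<Rightarrow> real" where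
  "L_entry N j p q = (1 / (dx N j)\<^sup>2) *
     (if p = q then - 2 else if p = q + 1 \<or> q = p + 1 then 1 else 0)"

text \<open>Entry \<open>(k, l)\<close> of the Kronecker product of matrices \<open>A m, \<dots>, A 1\<close>, rows and columns being
  labelled by multi-indices.\<close>

definition kron :: "nat \<Rightarrow> (nat \<Rightarrow> nat \<Rightarrow> nat \<Rightarrow> real) \<Rightarrow> (nat \<Rightarrow> nat) \<Rightarrow> (nat \<Rightarrow> nat) \<Rightarrow> real" where
  "kron m A k l = (\<Prod>i\<in>{1..m}. A i (k i) (l i))"

definition D_entry ::
  "nat \<Rightarrow> (nat \<Rightarrow> real) \<Rightarrow> (nat \<Rightarrow> nat) \<Rightarrow> nat \<Rightarrow> (nat \<Rightarrow> nat) \<Rightarrow> (nat \<Rightarrow> nat) \<Rightarrow> real" where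
  "D_entry m \<beta> N j k l = \<beta> j * kron m (\<lambda>i. if i = j then L_entry N i else id_entry) k l"

definition Dj :: "nat \<Rightarrow> (nat \<Rightarrow> real) \<Rightarrow> (nat \<Rightarrow> nat) \<Rightarrow> nat \<Rightarrow> gridfun \<Rightarrow> gridfun" where
  "Dj m \<beta> N j V = (\<lambda>k. \<Sum>l\<in>grid m N. D_entry m \<beta> N j k l * V l)"

definition Dsum :: "nat \<Rightarrow> (nat \<Rightarrow> real) \<Rightarrow> (nat \<Rightarrow> nat) \<Rightarrow> gridfun \<Rightarrow> gridfun" where
  "Dsum m \<beta> N V = (\<lambda>k. \<Sum>j\<in>{1..m}. Dj m \<beta> N j V k)"

text \<open>What the central differences in direction \<open>j\<close> pick up from the Dirichlet data \<open>b\<close>.\<close>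

definition bnd :: "nat \<Rightarrow> (nat \<Rightarrow> real) \<Rightarrow> (nat \<Rightarrow> nat) \<Rightarrow> (point \<Rightarrow> real) \<Rightarrow> nat \<Rightarrow> gridfun" where
  "bnd m \<beta> N b j = (\<lambda>k. \<beta> j / (dx N j)\<^sup>2 *
     ((if k j = 1 then b ((gridpt m N k)(j := 0)) else 0) +
      (if k j = N j then b ((gridpt m N k)(j := 1)) else 0)))"

definition gsum :: "nat \<Rightarrow> (nat \<Rightarrow> real \<Rightarrow> gridfun) \<Rightarrow> real \<Rightarrow> gridfun" where
  "gsum m g = (\<lambda>t k. \<Sum>j\<in>{1..m}. g j t k)"

definition phi ::
  "nat \<Rightarrow> (nat \<Rightarrow> real) \<Rightarrow> (nat \<Rightarrow> nat) \<Rightarrow> (real \<Rightarrow> gridfun) \<Rightarrow> (nat \<Rightarrow> real \<Rightarrow> gridfun) \<Rightarrow>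
   nat \<Rightarrow> real \<Rightarrow> gridfun" where
  "phi m \<beta> N U g j = (\<lambda>t k. Dj m \<beta> N j (U t) k + g j t k)"

text \<open>The next predicate says that \<open>D\<^bsub>i\<^sub>1\<^esub> \<dots> D\<^bsub>i\<^sub>r\<^esub> \<psi>\<close> equals, up to
  \<open>K (\<Delta>x\<^bsub>i\<^sub>1\<^esub>\<^sup>2 + \<dots> + \<Delta>x\<^bsub>i\<^sub>r\<^esub>\<^sup>2 + \<Delta>x\<^sub>j\<^sup>2)\<close> in the maximum norm, the grid restriction of
  \<open>\<beta>\<^bsub>i\<^sub>1\<^esub> \<dots> \<beta>\<^bsub>i\<^sub>r\<^esub> \<beta>\<^sub>j\<close> times the corresponding derivative of \<open>w\<close>, where \<open>is = [i\<^sub>1, \<dots>, i\<^sub>r]\<close>.\<close>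

definition mixed_consistent ::
  "nat \<Rightarrow> (nat \<Rightarrow> real) \<Rightarrow> (nat \<Rightarrow> nat) \<Rightarrow> real \<Rightarrow> nat list \<Rightarrow> nat \<Rightarrow> gridfun \<Rightarrow>
   (real \<Rightarrow> point \<Rightarrow> real) \<Rightarrow> real \<Rightarrow> bool" where
  "mixed_consistent m \<beta> N K is j \<psi> w t \<longleftrightarrow>
     maxnorm m N (\<lambda>k. foldr (Dj m \<beta> N) is \<psi> k -
        prod_list (map \<beta> is) * \<beta> j * on_grid m N (foldr ddx2 is (ddx2 j w)) t k)
     \<le> K * ((\<Sum>i\<leftarrow>is. (dx N i)\<^sup>2) + (dx N j)\<^sup>2)"

definition douglas_step ::
  "nat \<Rightarrow> (nat \<Rightarrow> real) \<Rightarrow> (nat \<Rightarrow> nat) \<Rightarrow> (nat \<Rightarrow> real \<Rightarrow> gridfun) \<Rightarrow> real \<Rightarrow> real \<Rightarrow>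
   real \<Rightarrow> real \<Rightarrow> gridfun \<Rightarrow> gridfun \<Rightarrow> bool" where
  "douglas_step m \<beta> N g \<theta> \<tau> t t' V V' \<longleftrightarrow>
     (\<exists>v :: nat \<Rightarrow> gridfun.
        (\<forall>k\<in>grid m N. v 0 k = V k + \<tau> * (Dsum m \<beta> N V k + gsum m g t k)) \<and>
        (\<forall>i\<in>{1..m}. \<forall>k\<in>grid m N. v i k = v (i - 1) k +
           \<theta> * \<tau> * ((Dj m \<beta> N i (v i) k + g i t' k) - (Dj m \<beta> N i V k + g i t k))) \<and>
        (\<forall>k\<in>grid m N. V' k = v m k))"

end

theory Submission
  imports Defs "HOL-Complex_Analysis.Complex_Analysis"
begin

text \<open>Write \<open>A\<^sub>j = \<tau> D\<^sub>j\<close>, \<open>P = (I - A\<^sub>1/2) \<cdots> (I - A\<^sub>m/2)\<close> and \<open>R = I + P\<^sup>-\<^sup>1 (A\<^sub>1 + \<cdots> + A\<^sub>m)\<close>.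
  The \<open>D\<^sub>j\<close> commute, and subtracting the exact solution from the stages of one Douglas step gives
  \<open>E (n + 1) = R (E n) + P\<^sup>-\<^sup>1 (\<eta> n)\<close> (lemma \<open>douglas_error_step\<close>). The defect \<open>\<eta> n\<close> is the error of
  the trapezoidal rule for \<open>U'\<close>, plus \<open>\<tau>/2\<close> times the sum over \<open>j\<close> of
  \<open>(I - A\<^sub>1/2) \<cdots> (I - A\<^sub>j\<^sub>-\<^sub>1/2) - I\<close> applied to the increment of \<open>\<phi>\<^sub>j\<close> over the step. The increment
  gives one factor \<open>\<tau>\<close>, every \<open>A\<^sub>i\<close> gives another one, and the mixed consistency assumption keeps
  \<open>D\<^sub>i \<cdots> \<phi>\<^sub>j'\<close> bounded on all grids. Hence \<open>\<eta> n = O(\<tau>\<^sup>3)\<close>, without any order reduction.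

  Since \<open>R - I = P\<^sup>-\<^sup>1 \<tau> D\<close>, the initial error acts like one more defect \<open>\<tau> D (E 0) = O(\<tau>\<^sup>3)\<close>, and
  \<open>E n = E 0 + (\<Sum>k<n. R\<^sup>k P\<^sup>-\<^sup>1 w)\<close> with sources \<open>w = O(\<tau>\<^sup>3)\<close> (lemma \<open>error_representation\<close>). The
  term \<open>E 0\<close> is controlled by \<open>D (E 0)\<close> through a discrete maximum principle. So power boundedness of
  \<open>R\<close> is avoided, and it is enough to bound \<open>R\<^sup>k P\<^sup>-\<^sup>1\<close> in the maximum norm by
  \<open>C ((k + 1) \<tau>)\<close> to the power \<open>-1/4\<close> (lemma \<open>douglas_stability\<close>): the sum over \<open>k\<close> then loses only
  one factor \<open>\<tau>\<close>, because \<open>n \<tau> \<le> T\<close>.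

  For this bound, \<open>R\<^sup>k P\<^sup>-\<^sup>1 = F(A\<^sub>1, \<dots>, A\<^sub>m)\<close> is a function of commuting operators that the discrete sine
  transform diagonalizes. Cauchy's formula is applied in one variable after the other, on the
  boundary of a thin triangle around the negative real axis (lemma \<open>multiplier_cauchy_bound\<close>). Two facts
  enter. Resolvents of the one-dimensional second difference satisfy
  \<open>\<parallel>(z - A\<^sub>j)\<^sup>-\<^sup>1\<parallel> \<le> M / (\<bar>z\<bar> + \<tau>)\<close>, up to constants, on that triangle (lemma
  \<open>multiplier_resolvent_bound\<close>). And in a sufficiently thin sector the symbol \<open>R(z)\<close> stays in the
  unit disc with a quantitative gap, so that \<open>R(z)\<^sup>k/P(z)\<close> is at most a sum of two products of
  decaying functions of the single variables (lemma \<open>symbol_power_bound\<close>). What remains are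
  one-dimensional integrals that converge uniformly in the grid.\<close>

section \<open>The second difference along one direction\<close>

text \<open>The unscaled central difference in direction \<open>j\<close>; neighbours outside the grid count as \<open>0\<close>. It is
  needed for real and for complex grid functions.\<close>

definition second_diff :: "(nat \<Rightarrow> nat) \<Rightarrow> nat \<Rightarrow> ((nat \<Rightarrow> nat) \<Rightarrow> 'a) \<Rightarrow> (nat \<Rightarrow> nat) \<Rightarrow> 'a::comm_ring_1"
  where "second_diff N j V k = (if k j < N j then V (k(j := k j + 1)) else 0)
    + (if 1 < k j then V (k(j := k j - 1)) else 0) - 2 * V k"

lemma finite_grid [simp]: "finite (grid m N)"
  unfolding grid_def by (intro finite_PiE) auto

lemma grid_nonempty: "\<forall>j\<in>{1..m}. N j \<ge> 1 \<Longrightarrow> grid m N \<noteq> {}"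
  unfolding grid_def by (auto simp: PiE_eq_empty_iff)

lemma grid_range: "k \<in> grid m N \<Longrightarrow> j \<in> {1..m} \<Longrightarrow> k j \<in> {1..N j}"
  unfolding grid_def by (rule PiE_mem)

lemma grid_upd: "k \<in> grid m N \<Longrightarrow> j \<in> {1..m} \<Longrightarrow> i \<in> {1..N j} \<Longrightarrow> k(j := i) \<in> grid m N"
  unfolding grid_def by (auto simp: PiE_iff extensional_def)

lemma abs_le_maxnorm: "k \<in> grid m N \<Longrightarrow> \<bar>V k\<bar> \<le> maxnorm m N V"
  unfolding maxnorm_def by (intro Max_ge) auto

lemma maxnorm_leI: "grid m N \<noteq> {} \<Longrightarrow> (\<And>k. k \<in> grid m N \<Longrightarrow> \<bar>V k\<bar> \<le> B) \<Longrightarrow> maxnorm m N V \<le> B"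
  unfolding maxnorm_def by (subst Max_le_iff) auto

lemma second_diff_cong:
  assumes "k \<in> grid m N" "j \<in> {1..m}" "\<And>l. l \<in> grid m N \<Longrightarrow> V l = W l"
  shows "second_diff N j V k = second_diff N j W k"
proof -
  have kj: "k j \<in> {1..N j}" by (rule grid_range[OF assms(1,2)])
  have "V (k(j := k j + 1)) = W (k(j := k j + 1))" if "k j < N j"
    using that kj by (intro assms(3) grid_upd[OF assms(1,2)]) auto
  moreover have "V (k(j := k j - 1)) = W (k(j := k j - 1))" if "1 < k j"
    using that kj by (intro assms(3) grid_upd[OF assms(1,2)]) auto
  ultimately show ?thesis using assms(3)[OF assms(1)] unfolding second_diff_def by simp
qed

lemma Dj_cong:
  assumes "\<And>l. l \<in> grid m N \<Longrightarrow> V l = W l"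
  shows "Dj m \<beta> N j V = Dj m \<beta> N j W"
  unfolding Dj_def using assms by (auto intro!: sum.cong)

lemma second_diff_of_real:
  "second_diff N j (\<lambda>l. complex_of_real (V l)) k = complex_of_real (second_diff N j V k)"
  unfolding second_diff_def by auto

lemma second_diff_sum:
  "second_diff N j (\<lambda>k. \<Sum>p\<in>S. f p k) k = (\<Sum>p\<in>S. second_diff N j (f p) k)"
  unfolding second_diff_def by (auto simp: sum.distrib sum_subtractf sum_distrib_left)

lemma second_diff_scale:
  "second_diff N j (\<lambda>k. c * V k) k = c * second_diff N j V k"
  unfolding second_diff_def by (auto simp: algebra_simps)

text \<open>All entries of the Kronecker product vanish except those on the grid line through \<open>k\<close> in direction
  \<open>j\<close>, where the tridiagonal matrix remains.\<close>

lemma Dj_eq_second_diff: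
  assumes k: "k \<in> grid m N" and j: "j \<in> {1..m}"
  shows "Dj m \<beta> N j V k = \<beta> j / (dx N j)\<^sup>2 * second_diff N j V k"
proof -
  have kext: "k x = undefined" if "x \<notin> {1..m}" for x
    using k that unfolding grid_def by auto
  have kj: "k j \<in> {1..N j}" by (rule grid_range[OF k j])
  have ent: "D_entry m \<beta> N j k l = (if \<forall>i\<in>{1..m} - {j}. k i = l i then \<beta> j * L_entry N j (k j) (l j) else 0)" for l
  proof -
    have "kron m (\<lambda>i. if i = j then L_entry N i else id_entry) k l
      = L_entry N j (k j) (l j) * (\<Prod>i\<in>{1..m} - {j}. id_entry (k i) (l i))"
      unfolding kron_def using j by (subst prod.remove[of _ j]) (auto intro!: prod.cong)
    also have "(\<Prod>i\<in>{1..m} - {j}. id_entry (k i) (l i)) = (if \<forall>i\<in>{1..m} - {j}. k i = l i then 1 else 0)"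
      unfolding id_entry_def by (auto intro!: prod_zero)
    finally show ?thesis unfolding D_entry_def by simp
  qed
  define line where "line = (\<lambda>i. k(j := i)) ` {1..N j}"
  have sub: "line \<subseteq> grid m N" unfolding line_def using grid_upd[OF k j] by auto
  have inj: "inj_on (\<lambda>i. k(j := i)) {1..N j}" by (auto simp: inj_on_def fun_eq_iff split: if_splits)
  have "l \<in> line" if l: "l \<in> grid m N" "\<forall>i\<in>{1..m} - {j}. k i = l i" for l
  proof -
    have "l = k(j := l j)"
    proof
      fix x show "l x = (k(j := l j)) x"
        using l kext[of x] unfolding grid_def by (cases "x \<in> {1..m}") auto
    qed
    thus ?thesis unfolding line_def using grid_range[OF l(1) j] by blast
  qed
  hence "Dj m \<beta> N j V k = (\<Sum>l\<in>line. D_entry m \<beta> N j k l * V l)"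
    unfolding Dj_def by (intro sum.mono_neutral_right) (use sub ent in auto)
  also have "\<dots> = (\<Sum>i\<in>{1..N j}. \<beta> j * L_entry N j (k j) i * V (k(j := i)))"
    unfolding line_def by (subst sum.reindex[OF inj]) (auto simp: ent intro!: sum.cong)
  also have "\<dots> = (\<Sum>i\<in>{1..N j}. \<beta> j / (dx N j)\<^sup>2 *
      ((if i = k j then - 2 * V k else 0) + (if i = k j + 1 then V (k(j := k j + 1)) else 0)
       + (if i = k j - 1 then V (k(j := k j - 1)) else 0)))"
    using kj by (intro sum.cong refl) (auto simp: L_entry_def fun_upd_idem)
  also have "\<dots> = \<beta> j / (dx N j)\<^sup>2 * ((\<Sum>i\<in>{1..N j}. (if i = k j then - 2 * V k else 0))
       + (\<Sum>i\<in>{1..N j}. (if i = k j + 1 then V (k(j := k j + 1)) else 0))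
       + (\<Sum>i\<in>{1..N j}. (if i = k j - 1 then V (k(j := k j - 1)) else 0)))"
    by (simp only: sum_distrib_left[symmetric] sum.distrib)
  also have "\<dots> = \<beta> j / (dx N j)\<^sup>2 * second_diff N j V k"
    using kj unfolding second_diff_def by (auto simp: sum.delta)
  finally show ?thesis .
qed


section \<open>The discrete sine transform and multipliers\<close>

definition sine1 :: "nat \<Rightarrow> nat \<Rightarrow> nat \<Rightarrow> real" where
  "sine1 n p i = sqrt (2 / real (n + 1)) * sin (pi * real p * real i / real (n + 1))"

text \<open>Eigenvalues of \<open>tridiag(1, -2, 1)\<close>.\<close>

definition eig1 :: "nat \<Rightarrow> nat \<Rightarrow> real" where
  "eig1 n p = 2 * cos (pi * real p / real (n + 1)) - 2"

definition sine :: "nat \<Rightarrow> (nat \<Rightarrow> nat) \<Rightarrow> (nat \<Rightarrow> nat) \<Rightarrow> (nat \<Rightarrow> nat) \<Rightarrow> real" where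
  "sine m N p k = (\<Prod>j\<in>{1..m}. sine1 (N j) (p j) (k j))"

lemma sine1_sym: "sine1 n p i = sine1 n i p"
  unfolding sine1_def by (simp add: mult_ac)

lemma sine_sym: "sine m N p k = sine m N k p"
  unfolding sine_def by (intro prod.cong) (auto simp: sine1_sym)

lemma sine1_0: "sine1 n p 0 = 0" unfolding sine1_def by simp

lemma sine1_end: "sine1 n p (n + 1) = 0"
proof -
  have "pi * real p * real (n + 1) / real (n + 1) = real p * pi" by (simp add: field_simps)
  thus ?thesis unfolding sine1_def by (simp only: sin_npi mult_zero_right)
qed

lemma sine1_stencil: 
  assumes "i \<ge> 1"
  shows "sine1 n p (i + 1) + sine1 n p (i - 1) - 2 * sine1 n p i = eig1 n p * sine1 n p i"
proof -
  let ?a = "pi * real p * real i / real (n + 1)" and ?b = "pi * real p / real (n + 1)"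
  have 1: "pi * real p * real (i + 1) / real (n + 1) = ?a + ?b"
    by (simp only: of_nat_add of_nat_1 add_divide_distrib[symmetric]) (simp add: algebra_simps)
  have 2: "pi * real p * real (i - 1) / real (n + 1) = ?a - ?b"
    using assms by (simp only: of_nat_diff of_nat_1 diff_divide_distrib[symmetric]) (simp add: algebra_simps)
  have "sin (?a + ?b) + sin (?a - ?b) = 2 * cos ?b * sin ?a"
    by (simp add: sin_add sin_diff)
  hence "sqrt (2 / real (n+1)) * (sin (?a + ?b) + sin (?a - ?b) - 2 * sin ?a) 
      = sqrt (2 / real (n+1)) * ((2 * cos ?b - 2) * sin ?a)" by (simp add: algebra_simps)
  thus ?thesis unfolding sine1_def eig1_def 1 2 by (simp add: algebra_simps)
qed

lemma eig1_bounds: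
  assumes "p \<in> {1..n}"
  shows "- 4 < eig1 n p" "eig1 n p < 0"
proof -
  let ?b = "pi * real p / real (n + 1)"
  have "pi * real p < pi * real (n + 1)" using assms by (intro mult_strict_left_mono) auto
  hence b: "0 < ?b" "?b < pi" using assms by (auto simp: divide_less_eq)
  have "cos ?b < cos 0" using b by (intro cos_monotone_0_pi) auto
  moreover have "cos pi < cos ?b" using b by (intro cos_monotone_0_pi) auto
  ultimately show "- 4 < eig1 n p" "eig1 n p < 0" unfolding eig1_def by auto
qed

text \<open>The Dirichlet kernel, cleared of its denominator.\<close>

lemma cos_sum_dirichlet:
  "2 * sin (x / 2) * (\<Sum>i\<le>n. cos (real i * x)) = sin ((real n + 1/2) * x) + sin (x / 2)"
proof (induction n)
  case (Suc n)
  have "sin ((real (Suc n) + 1/2) * x) - sin ((real n + 1/2) * x) = 2 * sin (x / 2) * cos (real (Suc n) * x)"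
  proof -
    have e: "(real (Suc n) + 1/2) * x = real (Suc n) * x + x/2" "(real n + 1/2) * x = real (Suc n) * x - x/2"
      by (simp_all add: algebra_simps)
    show ?thesis unfolding e by (simp only: sin_add sin_diff) (simp add: algebra_simps)
  qed
  thus ?case using Suc by (simp add: algebra_simps)
qed simp

lemma cos_sum_eval:
  assumes "0 < d" "d < 2 * (n + 1)"
  shows "2 * (\<Sum>i\<le>n. cos (real i * (pi * real d / real (n + 1)))) = 1 - (- 1) ^ d"
proof -
  let ?x = "pi * real d / real (n + 1)"
  have "real d < 2 * (real n + 1)" using assms(2) by (simp add: of_nat_less_iff[symmetric] del: of_nat_less_iff)
  hence "pi * real d < pi * (2 * (real n + 1))" by (intro mult_strict_left_mono) auto
  hence "0 < ?x / 2" "?x / 2 < pi" using assms by (auto simp: divide_less_eq algebra_simps)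
  hence s: "sin (?x / 2) > 0" by (rule sin_gt_zero)
  have e: "(real n + 1/2) * ?x = real d * pi - ?x / 2" by (simp add: field_simps)
  have "sin ((real n + 1/2) * ?x) = - ((-1) ^ d) * sin (?x / 2)"
    unfolding e by (simp only: sin_diff sin_npi cos_npi)
  hence "sin (?x / 2) * (2 * (\<Sum>i\<le>n. cos (real i * ?x))) = sin (?x / 2) * (1 - (-1)^d)"
    using cos_sum_dirichlet[of ?x n] by (simp add: algebra_simps)
  thus ?thesis using s by (metis less_irrefl mult_left_cancel)
qed

text \<open>The product of two sines is half the difference of cosines with frequencies \<open>p - q\<close> and \<open>p + q\<close>. These
  have the same parity, so by \<open>cos_sum_eval\<close> their sums cancel unless \<open>p = q\<close>. Since \<open>sine1\<close> is
  symmetric in frequency and position, this is completeness as well.\<close>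

lemma sine1_orthonormal:
  assumes p: "p \<in> {1..n}" and q: "q \<in> {1..n}"
  shows "(\<Sum>i\<in>{1..n}. sine1 n p i * sine1 n q i) = (if p = q then 1 else 0)"
proof -
  have *: "(\<Sum>i\<in>{1..n}. sine1 n p i * sine1 n q i) = (if p = q then 1 else 0)"
    if p: "p \<in> {1..n}" and q: "q \<in> {1..n}" and pq: "q \<le> p" for p q
  proof -
    let ?c = "\<lambda>d i. cos (real i * (pi * real d / real (n + 1)))"
    have pr: "sine1 n p i * sine1 n q i = (1 / real (n + 1)) * (?c (p - q) i - ?c (p + q) i)" for i
    proof -
      have e: "real i * (pi * real (p - q) / real (n + 1)) = pi * real p * real i / real (n + 1) - pi * real q * real i / real (n + 1)"
        "real i * (pi * real (p + q) / real (n + 1)) = pi * real p * real i / real (n + 1) + pi * real q * real i / real (n + 1)"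
        using pq by (simp_all only: of_nat_diff of_nat_add add_divide_distrib[symmetric] diff_divide_distrib[symmetric])
           (simp_all add: algebra_simps)
      have "sine1 n p i * sine1 n q i = (sqrt (2 / real (n+1)))\<^sup>2 * 
         (sin (pi * real p * real i / real (n + 1)) * sin (pi * real q * real i / real (n + 1)))"
        unfolding sine1_def power2_eq_square by (simp only: mult_ac)
      also have "(sqrt (2 / real (n+1)))\<^sup>2 = 2 / real (n + 1)" by simp
      finally show ?thesis unfolding e by (simp only: cos_diff cos_add) (simp add: field_simps)
    qed
    have "(\<Sum>i\<in>{1..n}. sine1 n p i * sine1 n q i) = (\<Sum>i\<le>n. sine1 n p i * sine1 n q i)"
      by (rule sum.mono_neutral_left) (auto simp: sine1_0 not_le)
    also have "\<dots> = (1 / real (n + 1)) * ((\<Sum>i\<le>n. ?c (p - q) i) - (\<Sum>i\<le>n. ?c (p + q) i))"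
      by (simp only: pr sum_distrib_left[symmetric] sum_subtractf)
    also have "\<dots> = (if p = q then 1 else 0)"
    proof (cases "p = q")
      case True
      have "2 * (\<Sum>i\<le>n. ?c (p + q) i) = 1 - (- 1) ^ (p + q)" using p q by (intro cos_sum_eval) auto
      thus ?thesis using True by (simp flip: mult_2)
    next
      case False
      have 1: "2 * (\<Sum>i\<le>n. ?c (p + q) i) = 1 - (- 1) ^ (p + q)" using p q by (intro cos_sum_eval) auto
      have 2: "2 * (\<Sum>i\<le>n. ?c (p - q) i) = 1 - (- 1) ^ (p - q)" using p q pq False by (intro cos_sum_eval) auto
      have "p + q = (p - q) + 2 * q" using pq by simp
      hence "(- 1 :: real) ^ (p + q) = (- 1) ^ (p - q)" by (simp only: power_add power_mult) simp
      hence "(\<Sum>i\<le>n. ?c (p + q) i) = (\<Sum>i\<le>n. ?c (p - q) i)" using 1 2 by linarith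
      thus ?thesis using False by simp
    qed
    finally show ?thesis .
  qed
  show ?thesis
  proof (cases "q \<le> p")
    case True thus ?thesis using *[OF p q] by simp
  next
    case False thus ?thesis using *[OF q p] by (simp add: mult.commute)
  qed
qed

lemma sine_orthonormal:
  assumes p: "p \<in> grid m N" and q: "q \<in> grid m N"
  shows "(\<Sum>l\<in>grid m N. sine m N p l * sine m N q l) = (if p = q then 1 else 0)"
proof -
  have "(\<Sum>l\<in>grid m N. sine m N p l * sine m N q l)
     = (\<Prod>j\<in>{1..m}. \<Sum>i\<in>{1..N j}. sine1 (N j) (p j) i * sine1 (N j) (q j) i)"
    unfolding sine_def grid_def prod.distrib[symmetric] by (subst prod_sum_PiE) auto
  also have "\<dots> = (\<Prod>j\<in>{1..m}. if p j = q j then 1 else 0)"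
    using grid_range[OF p] grid_range[OF q] by (intro prod.cong refl sine1_orthonormal) auto
  also have "\<dots> = (if p = q then 1 else 0)"
  proof (cases "p = q")
    case False
    have "\<exists>j\<in>{1..m}. p j \<noteq> q j"
      using False PiE_ext[of p "{1..m}" _ q] p q unfolding grid_def by blast
    thus ?thesis using False by (auto intro!: prod_zero)
  qed simp
  finally show ?thesis .
qed

text \<open>The function \<open>F\<close> of the difference operators: coefficients with respect to the orthonormal sine basis are
  multiplied by \<open>F p\<close>. Contour integrals of operators thereby reduce to scalar contour integrals.\<close>

definition multiplier :: "nat \<Rightarrow> (nat \<Rightarrow> nat) \<Rightarrow> ((nat \<Rightarrow> nat) \<Rightarrow> complex) \<Rightarrow> ((nat \<Rightarrow> nat) \<Rightarrow> complex) \<Rightarrow> (nat \<Rightarrow> nat) \<Rightarrow> complex" where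
  "multiplier m N F V = (\<lambda>k. \<Sum>p\<in>grid m N. F p * (of_real (sine m N p k) * (\<Sum>l\<in>grid m N. of_real (sine m N p l) * V l)))"

lemma multiplier_cong:
  assumes "\<And>p. p \<in> grid m N \<Longrightarrow> F p = G p" "\<And>k. k \<in> grid m N \<Longrightarrow> V k = W k"
  shows "multiplier m N F V = multiplier m N G W"
  unfolding multiplier_def using assms by (intro ext sum.cong refl arg_cong2[of _ _ _ _ times]) auto

lemma multiplier_one:
  assumes k: "k \<in> grid m N"
  shows "multiplier m N (\<lambda>_. 1) V k = V k"
proof -
  have "multiplier m N (\<lambda>_. 1) V k = (\<Sum>p\<in>grid m N. \<Sum>l\<in>grid m N. of_real (sine m N p k * sine m N p l) * V l)"
    unfolding multiplier_def by (simp add: sum_distrib_left mult_ac)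
  also have "\<dots> = (\<Sum>l\<in>grid m N. of_real (\<Sum>p\<in>grid m N. sine m N k p * sine m N l p) * V l)"
    by (subst sum.swap) (simp add: sum_distrib_right sine_sym[of m N k] sine_sym[of m N l for l] sine_sym)
  also have "\<dots> = (\<Sum>l\<in>grid m N. if k = l then V l else 0)"
    using k by (intro sum.cong refl) (auto simp: sine_orthonormal)
  finally show ?thesis using k by simp
qed

lemma multiplier_mult: "multiplier m N F (multiplier m N G V) = multiplier m N (\<lambda>p. F p * G p) V"
proof
  fix k
  have "(\<Sum>l\<in>grid m N. of_real (sine m N p l) * multiplier m N G V l)
     = G p * (\<Sum>l\<in>grid m N. of_real (sine m N p l) * V l)" if p: "p \<in> grid m N" for p
  proof -
    let ?c = "\<lambda>q. (\<Sum>l\<in>grid m N. of_real (sine m N q l) * V l)"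
    have "(\<Sum>l\<in>grid m N. of_real (sine m N p l) * multiplier m N G V l)
       = (\<Sum>l\<in>grid m N. \<Sum>q\<in>grid m N. G q * ?c q * of_real (sine m N p l * sine m N q l))"
      unfolding multiplier_def by (simp add: sum_distrib_left mult_ac)
    also have "\<dots> = (\<Sum>q\<in>grid m N. G q * ?c q * of_real (\<Sum>l\<in>grid m N. sine m N p l * sine m N q l))"
      by (subst sum.swap) (simp add: sum_distrib_left)
    also have "\<dots> = (\<Sum>q\<in>grid m N. if p = q then G q * ?c q else 0)"
      using p by (intro sum.cong refl) (auto simp: sine_orthonormal)
    finally show ?thesis using p by simp
  qed
  thus "multiplier m N F (multiplier m N G V) k = multiplier m N (\<lambda>p. F p * G p) V k"
    unfolding multiplier_def[of m N F] multiplier_def[of m N "\<lambda>p. F p * G p"] by (intro sum.cong refl) simp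
qed

lemma multiplier_add_fun: "multiplier m N (\<lambda>p. F p + G p) V k = multiplier m N F V k + multiplier m N G V k"
  unfolding multiplier_def by (simp add: sum.distrib algebra_simps)

lemma multiplier_diff_fun: "multiplier m N (\<lambda>p. F p - G p) V k = multiplier m N F V k - multiplier m N G V k"
  unfolding multiplier_def by (simp add: sum_subtractf algebra_simps)

lemma multiplier_scale_fun: "multiplier m N (\<lambda>p. c * F p) V k = c * multiplier m N F V k"
  unfolding multiplier_def by (simp add: sum_distrib_left algebra_simps)

lemma multiplier_sum_fun: "multiplier m N (\<lambda>p. \<Sum>j\<in>S. F j p) V k = (\<Sum>j\<in>S. multiplier m N (F j) V k)"
  unfolding multiplier_def by (simp add: sum_distrib_right sum.swap[of _ S])

lemma multiplier_add: "multiplier m N F (\<lambda>k. V k + W k) = (\<lambda>k. multiplier m N F V k + multiplier m N F W k)"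
  unfolding multiplier_def by (simp add: sum.distrib algebra_simps)

lemma multiplier_sum: "multiplier m N F (\<lambda>k. \<Sum>j\<in>S. V j k) k = (\<Sum>j\<in>S. multiplier m N F (V j) k)"
  unfolding multiplier_def
  by (simp add: sum_distrib_left sum.swap[of _ S])

lemma second_diff_sine:
  assumes k: "k \<in> grid m N" and j: "j \<in> {1..m}"
  shows "second_diff N j (sine m N p) k = eig1 (N j) (p j) * sine m N p k"
proof -
  define r where "r = (\<Prod>i\<in>{1..m} - {j}. sine1 (N i) (p i) (k i))"
  have s: "sine m N p (k(j := i)) = sine1 (N j) (p j) i * r" for i
    unfolding sine_def r_def using j by (subst prod.remove[of _ j]) (auto intro!: prod.cong)
  have kj: "k j \<in> {1..N j}" by (rule grid_range[OF k j])
  have up: "(if k j < N j then sine m N p (k(j := k j + 1)) else 0) = sine1 (N j) (p j) (k j + 1) * r"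
    using kj sine1_end[of "N j" "p j"] by (cases "k j = N j") (auto simp: s)
  have dn: "(if 1 < k j then sine m N p (k(j := k j - 1)) else 0) = sine1 (N j) (p j) (k j - 1) * r"
    using kj sine1_0 by (cases "k j = 1") (auto simp: s)
  have "sine m N p k = sine1 (N j) (p j) (k j) * r" using s[of "k j"] by simp
  hence "second_diff N j (sine m N p) k
     = (sine1 (N j) (p j) (k j + 1) + sine1 (N j) (p j) (k j - 1) - 2 * sine1 (N j) (p j) (k j)) * r"
    unfolding second_diff_def up dn by (simp add: algebra_simps)
  also have "\<dots> = eig1 (N j) (p j) * (sine1 (N j) (p j) (k j) * r)"
    using kj by (subst sine1_stencil) auto
  finally show ?thesis using s[of "k j"] by simp
qed

lemma second_diff_multiplier:
  assumes k: "k \<in> grid m N" and j: "j \<in> {1..m}"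
  shows "second_diff N j (multiplier m N F V) k = multiplier m N (\<lambda>p. of_real (eig1 (N j) (p j)) * F p) V k"
proof -
  have "second_diff N j (multiplier m N F V) k = (\<Sum>p\<in>grid m N. second_diff N j (\<lambda>k.
     (F p * (\<Sum>l\<in>grid m N. of_real (sine m N p l) * V l)) * of_real (sine m N p k)) k)"
    unfolding multiplier_def second_diff_sum[symmetric] by (simp add: mult_ac)
  also have "\<dots> = multiplier m N (\<lambda>p. of_real (eig1 (N j) (p j)) * F p) V k"
    unfolding multiplier_def second_diff_scale second_diff_of_real second_diff_sine[OF k j] 
    by (intro sum.cong refl) simp
  finally show ?thesis .
qed

lemma second_diff_eq_multiplier:
  assumes k: "k \<in> grid m N" and j: "j \<in> {1..m}"
  shows "second_diff N j V k = multiplier m N (\<lambda>p. of_real (eig1 (N j) (p j))) V k"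
proof -
  have "second_diff N j V k = second_diff N j (multiplier m N (\<lambda>_. 1) V) k"
    using multiplier_one by (intro second_diff_cong[OF k j]) (simp add: multiplier_one)
  thus ?thesis using second_diff_multiplier[OF k j, of "\<lambda>_. 1" V] by simp
qed

lemma Dj_eq_multiplier:
  assumes k: "k \<in> grid m N" and j: "j \<in> {1..m}"
  shows "complex_of_real (Dj m \<beta> N j V k)
    = multiplier m N (\<lambda>p. of_real (\<beta> j / (dx N j)\<^sup>2 * eig1 (N j) (p j))) (\<lambda>l. of_real (V l)) k"
proof -
  have "complex_of_real (Dj m \<beta> N j V k) = of_real (\<beta> j / (dx N j)\<^sup>2) * second_diff N j (\<lambda>l. of_real (V l)) k"
    unfolding Dj_eq_second_diff[OF k j] second_diff_of_real by simp
  thus ?thesis unfolding second_diff_eq_multiplier[OF k j] multiplier_scale_fun[symmetric] by simp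
qed

section \<open>Resolvents of the second difference in the maximum norm\<close>

text \<open>The points of modulus \<open>r\<close> are mapped by \<open>z + 1/z - 2\<close> to the ellipse with foci \<open>-4\<close> and \<open>0\<close> (the ends of
  the spectrum) and with sum of focal distances \<open>2 (r + 1/r)\<close>. So \<open>r/(1 - r)\<^sup>2\<close> can be read off from the two
  distances.\<close>

lemma joukowski_preimage:
  fixes s :: complex
  assumes S: "norm s + norm (s + 4) > 4"
  obtains z where "z \<noteq> 0" "norm z < 1" "s + 2 = z + 1 / z"
    "norm z / (1 - norm z)\<^sup>2 = 2 / (norm s + norm (s + 4) - 4)"
proof -
  have *: "norm z \<noteq> 1 \<and> norm z / (1 - norm z)\<^sup>2 = 2 / (norm s + norm (s + 4) - 4)"
    if z: "z \<noteq> 0" "s + 2 = z + 1 / z" for z :: complex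
  proof -
    let ?r = "norm z"
    have r: "?r > 0" using z by simp
    have "s = (1 - z)\<^sup>2 / z" "s + 4 = (1 + z)\<^sup>2 / z"
      using z by (simp_all add: field_simps power2_eq_square)
    hence "norm s + norm (s + 4) = ((norm (1 - z))\<^sup>2 + (norm (1 + z))\<^sup>2) / ?r"
      by (simp add: norm_divide norm_power add_divide_distrib)
    also have "(norm (1 - z))\<^sup>2 + (norm (1 + z))\<^sup>2 = 2 + 2 * ?r\<^sup>2"
      unfolding cmod_power2 by (simp add: power2_eq_square algebra_simps)
    finally have e: "norm s + norm (s + 4) - 4 = 2 * (1 - ?r)\<^sup>2 / ?r"
      using r by (simp add: field_simps power2_eq_square)
    have "?r \<noteq> 1" using e S by auto
    thus ?thesis unfolding e using r by (simp add: field_simps)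
  qed
  define d where "d = csqrt ((s + 2)\<^sup>2 - 4)"
  have d: "d\<^sup>2 = (s + 2)\<^sup>2 - 4" unfolding d_def by simp
  define z where "z = ((s + 2) + d) / 2"
  define z' where "z' = ((s + 2) - d) / 2"
  have zz: "z * z' = 1"
  proof -
    have "z * z' = ((s + 2)\<^sup>2 - d\<^sup>2) / 4"
      unfolding z_def z'_def power2_eq_square by (simp add: algebra_simps)
    thus ?thesis unfolding d by simp
  qed
  have sm: "s + 2 = z + z'" unfolding z_def z'_def by (simp add: field_simps)
  have nz: "z \<noteq> 0" "z' \<noteq> 0" using zz by auto
  have i: "z' = 1 / z" "z = 1 / z'" using zz nz by (auto simp: field_simps)
  show ?thesis
  proof (cases "norm z < 1")
    case True
    moreover have "s + 2 = z + 1 / z" using sm i(1) by simp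
    ultimately show ?thesis using that[of z] *[of z] nz(1) by blast
  next
    case False
    have 1: "norm z * norm z' = 1" using zz by (metis norm_mult norm_one)
    have "s + 2 = z + 1 / z" using sm i(1) by simp
    hence "norm z \<noteq> 1" using *[of z] nz(1) by blast
    hence "norm z > 1" using False by simp
    moreover have "norm z' = 1 / norm z" using 1 nz by (simp add: field_simps)
    ultimately have "norm z' < 1" using nz by (simp add: divide_less_eq)
    moreover have "s + 2 = z' + 1 / z'" using sm i(2) by simp
    ultimately show ?thesis using that[of z'] *[of z'] nz(2) by blast
  qed
qed

text \<open>With \<open>s + 2 = z + 1/z\<close> the second difference operator factors into two first-order recursions,
  one running forward and one running backward, each contracting by \<open>\<bar>z\<bar> < 1\<close>. The one-sided
  differences \<open>w\<close> and \<open>w'\<close> are treated together, because the boundary value of each is a multiple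
  of the other one: this replaces an odd periodic extension.\<close>

lemma line_resolvent_bound:
  fixes v :: "nat \<Rightarrow> complex"
  assumes S: "norm s + norm (s + 4) > 4" and F: "F \<ge> 0"
    and v0: "v 0 = 0" and vn: "v (n + 1) = 0"
    and eq: "\<And>i. i \<in> {1..n} \<Longrightarrow> norm ((s + 2) * v i - v (i - 1) - v (i + 1)) \<le> F"
    and i: "i \<in> {1..n}"
  shows "norm (v i) \<le> 2 * F / (norm s + norm (s + 4) - 4)"
proof -
  obtain z where z: "z \<noteq> 0" "norm z < 1" "s + 2 = z + 1 / z"
    and zS: "norm z / (1 - norm z)\<^sup>2 = 2 / (norm s + norm (s + 4) - 4)"
    using joukowski_preimage[OF S] by metis
  define f where "f i = (s + 2) * v i - v (i - 1) - v (i + 1)" for i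
  have fF: "norm (f i) \<le> F" if "i \<in> {1..n}" for i using eq[OF that] unfolding f_def .
  \<comment> \<open>one-sided differences that satisfy first-order recursions with factor \<open>z\<close>\<close>
  define w where "w i = v i - z * v (i - 1)" for i
  define w' where "w' i = v i - z * v (i + 1)" for i
  define Y where "Y = Max ((\<lambda>i. norm (w i)) ` {1..n+1} \<union> (\<lambda>i. norm (w' i)) ` {0..n})"
  have Yw: "norm (w i) \<le> Y" if "i \<in> {1..n+1}" for i
    unfolding Y_def by (rule Max_ge) (use that in auto)
  have Yw': "norm (w' i) \<le> Y" if "i \<in> {0..n}" for i
    unfolding Y_def by (rule Max_ge) (use that in auto)
  have Y0: "Y \<ge> 0" using order_trans[OF norm_ge_zero Yw'[of 0]] by simp
  have n: "n \<ge> 1" using i by auto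
  have step: "norm (z * (x + f i)) \<le> norm z * (Y + F)" if "norm x \<le> Y" "i \<in> {1..n}" for x i
    using that fF[OF that(2)] unfolding norm_mult
    by (intro mult_left_mono order_trans[OF norm_triangle_ineq] add_mono) auto
  have b1: "norm (w i) \<le> norm z * (Y + F)" if i: "i \<in> {1..n+1}" for i
  proof (cases "i = n + 1")
    case True
    have "w i = - (z * w' n)" using True v0 vn unfolding w_def w'_def by simp
    hence "norm (w i) = norm z * norm (w' n)" by (simp add: norm_mult)
    also have "\<dots> \<le> norm z * (Y + F)" using Yw'[of n] F by (intro mult_left_mono) auto
    finally show ?thesis .
  next
    case False
    hence "w i = z * (w (i + 1) + f i)" unfolding w_def f_def z(3) using z(1) by (simp add: field_simps)
    thus ?thesis using step[of "w (i + 1)" i] Yw[of "i + 1"] i False by auto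
  qed
  have b2: "norm (w' i) \<le> norm z * (Y + F)" if i: "i \<in> {0..n}" for i
  proof (cases "i = 0")
    case True
    have "w' i = - (z * w 1)" using True v0 vn unfolding w_def w'_def by simp
    hence "norm (w' i) = norm z * norm (w 1)" by (simp add: norm_mult)
    also have "\<dots> \<le> norm z * (Y + F)" using Yw[of 1] F by (intro mult_left_mono) auto
    finally show ?thesis .
  next
    case False
    hence "w' i = z * (w' (i - 1) + f i)" unfolding w'_def f_def z(3) using z(1) by (simp add: field_simps)
    thus ?thesis using step[of "w' (i - 1)" i] Yw'[of "i - 1"] i False by auto
  qed
  have "Y \<in> (\<lambda>i. norm (w i)) ` {1..n+1} \<union> (\<lambda>i. norm (w' i)) ` {0..n}"
    unfolding Y_def by (rule Max_in) auto
  hence "Y \<le> norm z * (Y + F)" using b1 b2 by auto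
  hence Yb: "Y * (1 - norm z) \<le> norm z * F" by (simp add: algebra_simps)
  define X where "X = Max ((\<lambda>i. norm (v i)) ` {0..n})"
  have Xv: "norm (v i) \<le> X" if "i \<in> {0..n}" for i
    unfolding X_def by (rule Max_ge) (use that in auto)
  have X0: "X \<ge> 0" using order_trans[OF norm_ge_zero Xv[of 0]] by simp
  have "norm (v i) \<le> norm z * X + Y" if i: "i \<in> {0..n}" for i
  proof (cases "i = 0")
    case True thus ?thesis using v0 X0 Y0 by simp
  next
    case False
    have "v i = z * v (i - 1) + w i" unfolding w_def by simp
    hence "norm (v i) \<le> norm z * norm (v (i - 1)) + norm (w i)" by (metis norm_mult norm_triangle_ineq)
    also have "\<dots> \<le> norm z * X + Y" using Xv[of "i - 1"] Yw[of i] i False by (intro add_mono mult_left_mono) auto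
    finally show ?thesis .
  qed
  moreover have "X \<in> (\<lambda>i. norm (v i)) ` {0..n}" unfolding X_def by (rule Max_in) auto
  ultimately have "X \<le> norm z * X + Y" by auto
  hence "X * (1 - norm z) * (1 - norm z) \<le> Y * (1 - norm z)"
    using z(2) by (intro mult_right_mono) (auto simp: algebra_simps)
  hence "X * (1 - norm z)\<^sup>2 \<le> norm z * F" using Yb by (simp add: power2_eq_square mult.assoc)
  hence "X \<le> norm z * F / (1 - norm z)\<^sup>2" using z(2) by (simp add: pos_le_divide_eq)
  also have "\<dots> = (norm z / (1 - norm z)\<^sup>2) * F" by simp
  also have "\<dots> = 2 * F / (norm s + norm (s + 4) - 4)" unfolding zS by simp
  finally show ?thesis using Xv[of i] i by simp
qed

text \<open>Discrete maximum principle: a parabola in direction \<open>j0\<close>, scaled slightly too large, has its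
  weighted sum of negative second differences above \<open>G\<close>, so \<open>w\<close> minus the parabola has no
  nonnegative maximum. Only one direction needs a positive coefficient, so this serves both a single
  \<open>D\<^sub>j\<close> and the full operator.\<close>

lemma barrier_bound:
  fixes w :: "(nat \<Rightarrow> nat) \<Rightarrow> real"
  assumes ne: "grid m N \<noteq> {}" and \<gamma>: "\<And>j. j \<in> {1..m} \<Longrightarrow> \<gamma> j \<ge> 0"
    and j0: "j0 \<in> {1..m}" "\<gamma> j0 > 0"
    and G: "\<And>k. k \<in> grid m N \<Longrightarrow> (\<Sum>j\<in>{1..m}. \<gamma> j * (- second_diff N j w k)) \<le> G" "G \<ge> 0"
    and k: "k \<in> grid m N"
  shows "w k \<le> G * (real (N j0) + 1)\<^sup>2 / (8 * \<gamma> j0)"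
proof -
  \<comment> \<open>a parabola with second difference \<open>-2\<close> that vanishes outside the grid\<close>
  define b where "b i = real i * (real (N j0) + 1 - real i)" for i
  have key: "w k \<le> c * b (k j0)" if c: "c > G / (2 * \<gamma> j0)" for c
  proof -
    have "G / (2 * \<gamma> j0) \<ge> 0" using G(2) j0(2) by simp
    hence c0: "c > 0" using c by linarith
    define y where "y l = w l - c * b (l j0)" for l
    obtain q where q: "q \<in> grid m N" "\<And>l. l \<in> grid m N \<Longrightarrow> y l \<le> y q"
    proof -
      have "Max (y ` grid m N) \<in> y ` grid m N" by (intro Max_in finite_imageI finite_grid) (simp add: ne)
      then obtain q where q: "q \<in> grid m N" "Max (y ` grid m N) = y q" by (rule imageE) 
      have le: "y l \<le> y q" if "l \<in> grid m N" for l
        unfolding q(2)[symmetric] by (intro Max_ge finite_imageI finite_grid imageI that)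
      show ?thesis by (rule that[OF q(1) le])
    qed
    have bpos: "b (l j0) \<ge> 0" if "l \<in> grid m N" for l
      using grid_range[OF that j0(1)] unfolding b_def by (intro mult_nonneg_nonneg) auto
    have yq: "y q < 0"
    proof (rule ccontr)
      assume "\<not> y q < 0"
      hence yq: "y q \<ge> 0" by simp
      have A: "- second_diff N j w q \<ge> (if j = j0 then 2 * c else 0)" if j: "j \<in> {1..m}" for j
      proof -
        have qj: "q j \<in> {1..N j}" by (rule grid_range[OF q(1) j])
        have up: "y (q(j := q j + 1)) \<le> y q" if "q j < N j"
          using that qj by (intro q(2) grid_upd[OF q(1) j]) auto
        have dn: "y (q(j := q j - 1)) \<le> y q" if "1 < q j"
          using that qj by (intro q(2) grid_upd[OF q(1) j]) auto
        have u: "(if q j < N j then w (q(j := q j + 1)) else 0) \<le> w q - c * b (q j0) + c * b ((q(j := q j + 1)) j0)" 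
        proof (cases "q j < N j")
          case True thus ?thesis using up[OF True] unfolding y_def by simp
        next
          case False
          have "b ((q(j := q j + 1)) j0) \<ge> 0"
          proof (cases "j = j0")
            case True
            have "q j = N j" using False qj by simp
            thus ?thesis using True unfolding b_def by simp
          qed (use bpos[OF q(1)] in simp)
          thus ?thesis using False yq c0 unfolding y_def by simp
        qed
        have d: "(if 1 < q j then w (q(j := q j - 1)) else 0) \<le> w q - c * b (q j0) + c * b ((q(j := q j - 1)) j0)" 
        proof (cases "1 < q j")
          case True thus ?thesis using dn[OF True] unfolding y_def by simp
        next
          case False
          have "b ((q(j := q j - 1)) j0) \<ge> 0"
          proof (cases "j = j0")
            case True
            have "q j = 1" using False qj by simp
            thus ?thesis using True unfolding b_def by simp
          qed (use bpos[OF q(1)] in simp)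
          thus ?thesis using False yq c0 unfolding y_def by simp
        qed
        have bb: "b ((q(j := q j + 1)) j0) + b ((q(j := q j - 1)) j0) - 2 * b (q j0) = (if j = j0 then - 2 else 0)"
        proof (cases "j = j0")
          case True
          have "real (q j - 1) = real (q j) - 1" "real (q j + 1) = real (q j) + 1" using qj by auto
          thus ?thesis using True unfolding b_def by (simp add: algebra_simps)
        qed simp
        have "second_diff N j w q \<le> c * (b ((q(j := q j + 1)) j0) + b ((q(j := q j - 1)) j0) - 2 * b (q j0))"
          using u d unfolding second_diff_def by (simp add: algebra_simps)
        thus ?thesis unfolding bb by (cases "j = j0") auto
      qed
      have "(\<Sum>j\<in>{1..m}. \<gamma> j * (if j = j0 then 2 * c else 0)) \<le> (\<Sum>j\<in>{1..m}. \<gamma> j * (- second_diff N j w q))"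
        by (intro sum_mono mult_left_mono A \<gamma>)
      also have "\<dots> \<le> G" by (rule G(1)[OF q(1)])
      finally have "(\<Sum>j\<in>{1..m}. \<gamma> j * (if j = j0 then 2 * c else 0)) \<le> G" .
      moreover have "(\<Sum>j\<in>{1..m}. \<gamma> j * (if j = j0 then 2 * c else 0)) = (\<Sum>j\<in>{1..m}. if j = j0 then \<gamma> j0 * (2 * c) else 0)"
        by (intro sum.cong) auto
      ultimately have "2 * \<gamma> j0 * c \<le> G" using j0(1) by simp
      thus False using c j0(2) by (simp add: divide_less_eq mult.commute)
    qed
    show ?thesis using q(2)[OF k] yq unfolding y_def by simp
  qed
  have bpos: "b (k j0) > 0" using grid_range[OF k j0(1)] unfolding b_def by (intro mult_pos_pos) auto
  have "w k / b (k j0) \<le> G / (2 * \<gamma> j0)"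
  proof (rule dense_ge)
    fix c assume "G / (2 * \<gamma> j0) < c"
    from key[OF this] show "w k / b (k j0) \<le> c" using bpos by (simp add: pos_divide_le_eq)
  qed
  hence "w k \<le> G / (2 * \<gamma> j0) * b (k j0)" using bpos by (simp add: pos_divide_le_eq)
  also have "b (k j0) \<le> (real (N j0) + 1)\<^sup>2 / 4"
  proof -
    have "0 \<le> (real (N j0) + 1 - 2 * real (k j0))\<^sup>2" by simp
    thus ?thesis unfolding b_def by (simp add: power2_eq_square algebra_simps)
  qed
  hence "G / (2 * \<gamma> j0) * b (k j0) \<le> G / (2 * \<gamma> j0) * ((real (N j0) + 1)\<^sup>2 / 4)"
    using G(2) j0(2) by (intro mult_left_mono) auto
  finally show ?thesis by simp
qed


lemma multiplier_resolvent_eq: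
  fixes V :: "(nat \<Rightarrow> nat) \<Rightarrow> complex"
  assumes k: "k \<in> grid m N" and j: "j \<in> {1..m}"
    and ne: "\<And>p. p \<in> grid m N \<Longrightarrow> z \<noteq> of_real (a * eig1 (N j) (p j))"
  defines "W \<equiv> multiplier m N (\<lambda>p. 1 / (z - of_real (a * eig1 (N j) (p j)))) V"
  shows "z * W k - of_real a * second_diff N j W k = V k"
proof -
  let ?e = "\<lambda>p. of_real (eig1 (N j) (p j)) :: complex"
  let ?r = "\<lambda>p. 1 / (z - of_real (a * eig1 (N j) (p j)))"
  have "z * W k - of_real a * second_diff N j W k
     = multiplier m N (\<lambda>p. z * ?r p) V k - multiplier m N (\<lambda>p. of_real a * (?e p * ?r p)) V k"
    unfolding W_def second_diff_multiplier[OF k j] multiplier_scale_fun ..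
  also have "\<dots> = multiplier m N (\<lambda>p. z * ?r p - of_real a * (?e p * ?r p)) V k"
    by (rule multiplier_diff_fun[symmetric])
  also have "\<dots> = multiplier m N (\<lambda>_. 1) V k"
  proof (rule fun_cong[OF multiplier_cong])
    fix p assume "p \<in> grid m N"
    hence "z - of_real (a * eig1 (N j) (p j)) \<noteq> 0" using ne by simp
    moreover have "z * ?r p - of_real a * (?e p * ?r p) = (z - of_real (a * eig1 (N j) (p j))) * ?r p"
      by (simp only: left_diff_distrib of_real_mult mult.assoc)
    ultimately show "z * ?r p - of_real a * (?e p * ?r p) = 1" by simp
  qed simp
  finally show ?thesis using multiplier_one[OF k] by simp
qed

lemma multiplier_resolvent_bound_ellipse:
  assumes k: "k \<in> grid m N" and j: "j \<in> {1..m}" and a: "a > 0"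
    and S: "norm z + norm (z + 4 * of_real a) > 4 * a"
    and ne: "\<And>p. p \<in> grid m N \<Longrightarrow> z \<noteq> of_real (a * eig1 (N j) (p j))"
    and V: "\<And>l. l \<in> grid m N \<Longrightarrow> norm (V l) \<le> B"
  shows "norm (multiplier m N (\<lambda>p. 1 / (z - of_real (a * eig1 (N j) (p j)))) V k)
    \<le> 2 * B / (norm z + norm (z + 4 * of_real a) - 4 * a)"
proof -
  define W where "W = multiplier m N (\<lambda>p. 1 / (z - of_real (a * eig1 (N j) (p j)))) V"
  define s where "s = z / of_real a"
  define v where "v i = (if i \<in> {1..N j} then W (k(j := i)) else 0)" for i
  have kj: "k j \<in> {1..N j}" by (rule grid_range[OF k j])
  have B: "B \<ge> 0" using V[OF k] norm_ge_zero[of "V k"] by linarith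
  have ns: "norm s = norm z / a" "norm (s + 4) = norm (z + 4 * of_real a) / a"
  proof -
    have "s + 4 = (z + 4 * of_real a) / of_real a" unfolding s_def using a by (simp add: field_simps)
    thus "norm (s + 4) = norm (z + 4 * of_real a) / a" using a by (simp only: norm_divide) simp
  qed (use a in \<open>simp add: s_def norm_divide\<close>)
  have sum: "norm s + norm (s + 4) - 4 = (norm z + norm (z + 4 * of_real a) - 4 * a) / a"
    unfolding ns using a by (simp add: field_simps)
  have "norm s + norm (s + 4) - 4 > 0" unfolding sum using S a by simp
  hence S': "norm s + norm (s + 4) > 4" by simp
  have "norm (v (k j)) \<le> 2 * (B / a) / (norm s + norm (s + 4) - 4)"
  proof (rule line_resolvent_bound[OF S', of _ _ "N j"])
    fix i assume i: "i \<in> {1..N j}"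
    have g: "k(j := i) \<in> grid m N" by (rule grid_upd[OF k j i])
    have "z * W (k(j := i)) - of_real a * second_diff N j W (k(j := i)) = V (k(j := i))"
      unfolding W_def by (rule multiplier_resolvent_eq[OF g j]) (rule ne)
    moreover have "second_diff N j W (k(j := i)) = v (i + 1) + v (i - 1) - 2 * v i"
      using i unfolding second_diff_def v_def by auto
    moreover have "v i = W (k(j := i))" using i unfolding v_def by simp
    ultimately have "(s + 2) * v i - v (i - 1) - v (i + 1) = V (k(j := i)) / of_real a"
      unfolding s_def using a by (simp add: field_simps)
    thus "norm ((s + 2) * v i - v (i - 1) - v (i + 1)) \<le> B / a"
      using V[OF g] a by (simp add: norm_divide divide_right_mono)
  qed (use B a kj in \<open>auto simp: v_def\<close>)
  also have "\<dots> = 2 * B / (norm z + norm (z + 4 * of_real a) - 4 * a)"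
    unfolding sum using a by simp
  finally show ?thesis using kj unfolding v_def W_def by simp
qed

text \<open>Near \<open>0\<close> the bound \<open>1/\<bar>z\<bar>\<close> is useless. There the term \<open>z W\<close> is moved to the right-hand side, and the
  maximum principle is applied to \<open>\<bar>W\<bar>\<close>; the restriction on \<open>z\<close> makes the moved term absorbable.\<close>

lemma multiplier_resolvent_bound_small:
  assumes k: "k \<in> grid m N" and j: "j \<in> {1..m}" and a: "a > 0"
    and z: "norm z \<le> 4 * a / (real (N j) + 1)\<^sup>2"
    and ne: "\<And>p. p \<in> grid m N \<Longrightarrow> z \<noteq> of_real (a * eig1 (N j) (p j))"
    and V: "\<And>l. l \<in> grid m N \<Longrightarrow> norm (V l) \<le> B"
  shows "norm (multiplier m N (\<lambda>p. 1 / (z - of_real (a * eig1 (N j) (p j)))) V k)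
    \<le> B * (real (N j) + 1)\<^sup>2 / (4 * a)"
proof -
  define W where "W = multiplier m N (\<lambda>p. 1 / (z - of_real (a * eig1 (N j) (p j)))) V"
  define X where "X = Max ((\<lambda>l. norm (W l)) ` grid m N)"
  have ng: "grid m N \<noteq> {}" using k by auto
  have WX: "norm (W l) \<le> X" if "l \<in> grid m N" for l
    unfolding X_def by (rule Max_ge) (use that in auto)
  have B: "B \<ge> 0" using V[OF k] norm_ge_zero[of "V k"] by linarith
  have X0: "X \<ge> 0" using WX[OF k] norm_ge_zero[of "W k"] by linarith
  define h where "h = (real (N j) + 1)\<^sup>2"
  have h: "h > 0" unfolding h_def by simp
  have "norm (W l) \<le> (B + norm z * X) * (real (N j) + 1)\<^sup>2 / (8 * (if j = j then a else 0))" if l: "l \<in> grid m N" for l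
  proof (rule barrier_bound[OF ng _ j _ _ _ l, where \<gamma> = "\<lambda>i. if i = j then a else 0"])
    fix q assume q: "q \<in> grid m N"
    have "- second_diff N j (\<lambda>l. norm (W l)) q \<le> norm (second_diff N j W q)"
    proof -
      let ?u = "(if q j < N j then W (q(j := q j + 1)) else 0)" and ?d = "(if 1 < q j then W (q(j := q j - 1)) else 0)"
      have "2 * norm (W q) = norm (?u + ?d - second_diff N j W q)"
        unfolding second_diff_def by (simp add: norm_mult)
      also have "\<dots> \<le> norm ?u + norm ?d + norm (second_diff N j W q)"
        by (meson add_mono norm_triangle_ineq norm_triangle_ineq4 order_refl order_trans)
      finally show ?thesis unfolding second_diff_def[of N j "\<lambda>l. norm (W l)"] by (auto split: if_splits)
    qed
    hence "a * (- second_diff N j (\<lambda>l. norm (W l)) q) \<le> a * norm (second_diff N j W q)"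
      using a by (intro mult_left_mono) auto
    also have "\<dots> = norm (of_real a * second_diff N j W q)" using a by (simp add: norm_mult)
    also have "of_real a * second_diff N j W q = z * W q - V q"
      using multiplier_resolvent_eq[OF q j, of z a V] ne unfolding W_def by (simp add: algebra_simps)
    also have "norm \<dots> \<le> norm z * norm (W q) + norm (V q)" by (metis norm_mult norm_triangle_ineq4)
    also have "\<dots> \<le> norm z * X + B" by (intro add_mono mult_left_mono WX V q) auto
    finally have "a * (- second_diff N j (\<lambda>l. norm (W l)) q) \<le> B + norm z * X" by simp
    moreover have "(\<Sum>i = 1..m. (if i = j then a else 0) * - second_diff N i (\<lambda>l. norm (W l)) q)
      = (\<Sum>i = 1..m. (if i = j then a * - second_diff N j (\<lambda>l. norm (W l)) q else 0))"
      by (intro sum.cong) auto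
    ultimately show "(\<Sum>i = 1..m. (if i = j then a else 0) * - second_diff N i (\<lambda>l. norm (W l)) q) \<le> B + norm z * X"
      using j by simp
  qed (use a B X0 in auto)
  hence b: "norm (W l) \<le> (B + norm z * X) * h / (8 * a)" if "l \<in> grid m N" for l
    using that unfolding h_def by simp
  have "X \<in> (\<lambda>l. norm (W l)) ` grid m N" unfolding X_def using ng by (intro Max_in) auto
  hence "X \<le> (B + norm z * X) * h / (8 * a)" using b by auto
  hence "X * (8 * a) \<le> B * h + norm z * h * X" using a by (simp add: pos_le_divide_eq algebra_simps)
  also have "norm z * h * X \<le> 4 * a * X"
    using z h X0 unfolding h_def[symmetric] by (intro mult_right_mono) (auto simp: pos_le_divide_eq)
  finally have "X * (4 * a) \<le> B * h" by simp
  hence "X \<le> B * h / (4 * a)" using a by (simp add: pos_le_divide_eq)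
  thus ?thesis using WX[OF k] unfolding W_def h_def by linarith
qed

section \<open>The symbol of the Douglas method in a thin sector\<close>

text \<open>The symbol of \<open>P\<^sup>-\<^sup>1\<close>. As a product of inverses it is holomorphic in each variable separately, whatever
  the values of the other variables are.\<close>

definition douglas_inv :: "nat set \<Rightarrow> (nat \<Rightarrow> complex) \<Rightarrow> complex" where
  "douglas_inv J z = (\<Prod>j\<in>J. inverse (1 - z j / 2))"

definition douglas_symbol :: "nat set \<Rightarrow> (nat \<Rightarrow> complex) \<Rightarrow> complex" where
  "douglas_symbol J z = 1 + (\<Sum>j\<in>J. z j) * douglas_inv J z"

lemma sector_polar:
  assumes \<alpha>: "0 < \<alpha>" "\<alpha> < pi / 2" and v: "\<bar>Im v\<bar> \<le> tan \<alpha> * Re v"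
  shows "\<exists>\<phi>. \<bar>\<phi>\<bar> \<le> \<alpha> \<and> v = of_real (norm v) * cis \<phi>"
proof (cases "v = 0")
  case True thus ?thesis using \<alpha> by (intro exI[of _ 0]) auto
next
  case False
  have t: "tan \<alpha> > 0" using \<alpha> by (intro tan_gt_zero) auto
  have R0: "Re v \<ge> 0"
  proof (rule ccontr)
    assume "\<not> Re v \<ge> 0"
    hence "tan \<alpha> * Re v < 0" using t by (intro mult_pos_neg) auto
    thus False using v by linarith
  qed
  have R: "Re v > 0"
  proof (rule ccontr)
    assume "\<not> Re v > 0"
    hence "Re v = 0" using R0 by simp
    hence "Im v = 0" using v by simp
    thus False using \<open>Re v = 0\<close> False by (simp add: complex_eq_iff)
  qed
  have "\<bar>Im v / Re v\<bar> \<le> tan \<alpha>" using v R by (simp add: abs_divide pos_divide_le_eq)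
  hence "arctan \<bar>Im v / Re v\<bar> \<le> arctan (tan \<alpha>)" by (simp add: arctan_le_iff)
  also have "arctan (tan \<alpha>) = \<alpha>" using \<alpha> by (intro arctan_tan) auto
  finally have "\<bar>Arg v\<bar> \<le> \<alpha>" using arg_conv_arctan[OF R] by (simp add: abs_arctan)
  moreover have "v = of_real (norm v) * cis (Arg v)" using rcis_cmod_Arg[of v] by (simp add: rcis_def)
  ultimately show ?thesis by blast
qed

lemma prod_polar:
  "finite X \<Longrightarrow> (\<Prod>j\<in>X. of_real (r j) * cis (\<phi> j)) = of_real (\<Prod>j\<in>X. r j) * cis (\<Sum>j\<in>X. \<phi> j)"
  by (induction X rule: finite_induct) (simp_all add: cis_mult[symmetric] mult_ac)

lemma one_plus_sum_le_prod:
  fixes r :: "'a \<Rightarrow> real"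
  assumes "finite J" "\<And>j. j \<in> J \<Longrightarrow> r j \<ge> 0"
  shows "1 + (\<Sum>j\<in>J. r j) \<le> (\<Prod>j\<in>J. 1 + r j)"
  using assms
proof (induction J rule: finite_induct)
  case (insert x F)
  have "(1 + r x) * (1 + (\<Sum>j\<in>F. r j)) \<le> (1 + r x) * (\<Prod>j\<in>F. 1 + r j)"
    using insert by (intro mult_left_mono) auto
  moreover have "r x * (\<Sum>j\<in>F. r j) \<ge> 0" using insert by (intro mult_nonneg_nonneg sum_nonneg) auto
  ultimately show ?case using insert by (simp add: algebra_simps)
qed simp

text \<open>Expanding both products gives sums of terms \<open>r cis \<phi>\<close> with \<open>\<bar>\<phi>\<bar> \<le> \<pi>/3\<close>, and such a term has
  real part at least \<open>r/2\<close>. This is where the sector has to be thin, depending on the number of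
  directions.\<close>

lemma prod_minus_sum_in_cone:
  fixes J :: "nat set"
  assumes J: "finite J" and \<alpha>: "real (card J + 1) * \<alpha> \<le> pi / 3"
    and r: "\<And>j. j \<in> J \<Longrightarrow> r j \<ge> 0" and \<phi>: "\<And>j. j \<in> J \<Longrightarrow> \<bar>\<phi> j\<bar> \<le> \<alpha>"
    and v: "\<And>j. j \<in> J \<Longrightarrow> v j = of_real (r j) * cis (\<phi> j)" and ne: "J \<noteq> {}"
  shows "Re (((\<Prod>j\<in>J. 1 + v j) - (\<Sum>j\<in>J. v j)) * cnj (\<Sum>j\<in>J. v j))
    \<ge> ((\<Prod>j\<in>J. 1 + r j) - (\<Sum>j\<in>J. r j)) * (\<Sum>j\<in>J. r j) / 2"
proof -
  have a0: "\<alpha> \<ge> 0" using ne \<phi> by (meson abs_ge_zero equals0I order_trans)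
  \<comment> \<open>subtracting the sum from the expanded product removes exactly the singletons\<close>
  define S where "S = Pow J - (\<lambda>j. {j}) ` J"
  have fS: "finite S" unfolding S_def using J by auto
  have split: "(\<Prod>j\<in>J. 1 + f j) - (\<Sum>j\<in>J. f j) = (\<Sum>X\<in>S. \<Prod>j\<in>X. f j)" for f :: "nat \<Rightarrow> 'b::comm_ring_1"
  proof -
    have "(\<Prod>j\<in>J. 1 + f j) = (\<Prod>j\<in>J. f j + 1)" by (simp add: add.commute)
    also have "\<dots> = (\<Sum>X\<in>Pow J. \<Prod>j\<in>X. f j)" by (subst prod_add[OF J]) simp
    also have "\<dots> = (\<Sum>X\<in>S. \<Prod>j\<in>X. f j) + (\<Sum>X\<in>(\<lambda>j. {j}) ` J. \<Prod>j\<in>X. f j)"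
      unfolding S_def using J by (intro sum.subset_diff) auto
    also have "(\<Sum>X\<in>(\<lambda>j. {j}) ` J. \<Prod>j\<in>X. f j) = (\<Sum>j\<in>J. f j)"
      by (subst sum.reindex) (auto simp: inj_on_def)
    finally show ?thesis by simp
  qed
  have pair: "Re ((\<Prod>i\<in>X. v i) * cnj (v j)) \<ge> (\<Prod>i\<in>X. r i) * r j / 2" if X: "X \<in> S" and j: "j \<in> J" for X j
  proof -
    have XJ: "X \<subseteq> J" using X unfolding S_def by auto
    have fX: "finite X" using XJ J finite_subset by blast
    have "(\<Prod>i\<in>X. v i) = (\<Prod>i\<in>X. of_real (r i) * cis (\<phi> i))" using XJ v by (intro prod.cong) auto
    also have "\<dots> = of_real (\<Prod>i\<in>X. r i) * cis (\<Sum>i\<in>X. \<phi> i)" by (rule prod_polar[OF fX])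
    finally have e: "(\<Prod>i\<in>X. v i) * cnj (v j) = of_real ((\<Prod>i\<in>X. r i) * r j) * cis ((\<Sum>i\<in>X. \<phi> i) + - \<phi> j)"
      unfolding v[OF j] by (simp only: cis_mult[symmetric] complex_cnj_mult cis_cnj complex_cnj_complex_of_real of_real_mult) (simp add: mult_ac)
    have "\<bar>(\<Sum>i\<in>X. \<phi> i) + - \<phi> j\<bar> \<le> \<bar>\<Sum>i\<in>X. \<phi> i\<bar> + \<bar>\<phi> j\<bar>" by linarith
    also have "\<bar>\<Sum>i\<in>X. \<phi> i\<bar> \<le> (\<Sum>i\<in>X. \<bar>\<phi> i\<bar>)" by (rule sum_abs)
    also have "\<dots> \<le> (\<Sum>i\<in>X. \<alpha>)" using XJ \<phi> by (intro sum_mono) auto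
    also have "\<dots> \<le> real (card J) * \<alpha>" using a0 card_mono[OF J XJ] by (simp add: mult_right_mono)
    finally have ang: "\<bar>(\<Sum>i\<in>X. \<phi> i) + - \<phi> j\<bar> \<le> pi / 3" using \<phi>[OF j] \<alpha> by (simp add: algebra_simps)
    have "cos (pi / 3) \<le> cos \<bar>(\<Sum>i\<in>X. \<phi> i) + - \<phi> j\<bar>"
      using ang by (intro cos_monotone_0_pi_le) auto
    hence c: "1 / 2 \<le> cos ((\<Sum>i\<in>X. \<phi> i) + - \<phi> j)" by (simp only: cos_60 cos_abs_real)
    have "(\<Prod>i\<in>X. r i) * r j \<ge> 0" using XJ r j by (intro mult_nonneg_nonneg prod_nonneg) auto
    hence "(\<Prod>i\<in>X. r i) * r j * (1 / 2) \<le> (\<Prod>i\<in>X. r i) * r j * cos ((\<Sum>i\<in>X. \<phi> i) + - \<phi> j)"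
      using c by (intro mult_left_mono) auto
    also have "\<dots> = Re ((\<Prod>i\<in>X. v i) * cnj (v j))" unfolding e by (simp del: of_real_prod)
    finally show ?thesis by simp
  qed
  have "((\<Prod>j\<in>J. 1 + r j) - (\<Sum>j\<in>J. r j)) * (\<Sum>j\<in>J. r j) / 2
      = (\<Sum>X\<in>S. \<Sum>j\<in>J. (\<Prod>i\<in>X. r i) * r j / 2)"
    unfolding split sum_product sum_divide_distrib ..
  also have "\<dots> \<le> (\<Sum>X\<in>S. \<Sum>j\<in>J. Re ((\<Prod>i\<in>X. v i) * cnj (v j)))"
    by (intro sum_mono pair)
  also have "\<dots> = Re (((\<Prod>j\<in>J. 1 + v j) - (\<Sum>j\<in>J. v j)) * cnj (\<Sum>j\<in>J. v j))"
    unfolding split cnj_sum sum_product Re_sum ..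
  finally show ?thesis .
qed

text \<open>With \<open>v = -z/2\<close>, \<open>W = \<Sum>v\<close> and \<open>P = \<Prod>(1 + v)\<close> the symbol is \<open>(P - 2 W)/P\<close>, and
  \<open>\<bar>P - 2 W\<bar>\<^sup>2 = \<bar>P\<bar>\<^sup>2 - 4 Re((P - W) cnj W)\<close>, where the last term is controlled by
  \<open>prod_minus_sum_in_cone\<close>. The gap closes as \<open>z\<close> tends to \<open>0\<close> and also as \<open>z\<close> tends to
  infinity; in the latter case the decay of \<open>P\<^sup>-\<^sup>1\<close> helps.\<close>

lemma symbol_bounds:
  fixes J :: "nat set" and z :: "nat \<Rightarrow> complex"
  assumes J: "finite J" "J \<noteq> {}" and \<alpha>: "0 < \<alpha>" "real (card J + 1) * \<alpha> \<le> pi / 3"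
    and z: "\<And>j. j \<in> J \<Longrightarrow> \<bar>Im (z j)\<bar> \<le> tan \<alpha> * - Re (z j)"
  defines "r \<equiv> \<lambda>j. norm (z j) / 2"
  defines "p \<equiv> (\<Prod>j\<in>J. 1 + r j)" and "\<sigma> \<equiv> (\<Sum>j\<in>J. r j)"
  shows "norm (douglas_inv J z) \<le> 2 ^ card J / p"
    and "norm (douglas_symbol J z) \<le> exp (- ((p - \<sigma>) * \<sigma> / p\<^sup>2))"
proof -
  have cJ: "card J \<ge> 1" using J by (simp add: Suc_leI card_gt_0_iff)
  have "2 * \<alpha> \<le> real (card J + 1) * \<alpha>" using cJ \<alpha>(1) by (intro mult_right_mono) auto
  hence \<alpha>6: "\<alpha> \<le> pi / 6" using \<alpha>(2) by simp
  hence \<alpha>2: "\<alpha> < pi / 2" using pi_gt_zero by linarith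
  define v where "v j = - z j / 2" for j
  have vs: "\<bar>Im (v j)\<bar> \<le> tan \<alpha> * Re (v j)" if "j \<in> J" for j
    using z[OF that] unfolding v_def by simp
  have rv: "norm (v j) = r j" for j unfolding v_def r_def by (simp add: norm_divide)
  have "\<forall>j\<in>J. \<exists>\<phi>. \<bar>\<phi>\<bar> \<le> \<alpha> \<and> v j = of_real (r j) * cis \<phi>"
    using sector_polar[OF \<alpha>(1) \<alpha>2 vs] rv by metis
  then obtain \<phi> where \<phi>: "\<And>j. j \<in> J \<Longrightarrow> \<bar>\<phi> j\<bar> \<le> \<alpha>" "\<And>j. j \<in> J \<Longrightarrow> v j = of_real (r j) * cis (\<phi> j)"
    by metis
  have r0: "r j \<ge> 0" for j unfolding r_def by simp
  define P where "P = (\<Prod>j\<in>J. 1 + v j)"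
  define W where "W = (\<Sum>j\<in>J. v j)"
  have lower: "(1 + r j) / 2 \<le> norm (1 + v j)" if j: "j \<in> J" for j
  proof -
    have "cos (pi / 3) \<le> cos \<bar>\<phi> j\<bar>" using \<phi>(1)[OF j] \<alpha>6 pi_gt_zero by (intro cos_monotone_0_pi_le) linarith+
    hence "1 / 2 \<le> cos (\<phi> j)" by (simp only: cos_60 cos_abs_real)
    hence "r j * (1 / 2) \<le> r j * cos (\<phi> j)" using r0 by (intro mult_left_mono) auto
    hence "(1 + r j) / 2 \<le> Re (1 + v j)" unfolding \<phi>(2)[OF j] by simp
    also have "\<dots> \<le> norm (1 + v j)" by (rule complex_Re_le_cmod)
    finally show ?thesis .
  qed
  have vne: "1 + v j \<noteq> 0" if "j \<in> J" for j using lower[OF that] r0[of j] by auto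
  have P0: "P \<noteq> 0" unfolding P_def using vne J by auto
  have inv: "douglas_inv J z = inverse P"
    unfolding douglas_inv_def P_def v_def prod_inversef[symmetric] by simp
  have p0: "p > 0" unfolding p_def using r0 by (intro prod_pos) (simp add: add_pos_nonneg)
  have "(\<Prod>j\<in>J. (1 + r j) / 2) \<le> (\<Prod>j\<in>J. norm (1 + v j))"
    using lower r0 by (intro prod_mono) (auto simp: add_nonneg_nonneg)
  hence "p / 2 ^ card J \<le> norm P"
    unfolding p_def P_def prod_norm[symmetric] by (simp add: prod_dividef)
  hence "inverse (norm P) \<le> inverse (p / 2 ^ card J)" using p0 by (intro le_imp_inverse_le) auto
  thus "norm (douglas_inv J z) \<le> 2 ^ card J / p" unfolding inv norm_inverse by simp
  have Pp: "norm P \<le> p"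
    unfolding P_def p_def prod_norm[symmetric] using norm_triangle_ineq[of 1 "v j" for j]
    by (intro prod_mono) (auto simp flip: rv)
  have cone: "(p - \<sigma>) * \<sigma> / 2 \<le> Re ((P - W) * cnj W)"
    unfolding p_def \<sigma>_def P_def W_def
    by (rule prod_minus_sum_in_cone[OF J(1) \<alpha>(2) r0 \<phi>(1) \<phi>(2) J(2)]) auto
  have p\<sigma>: "1 + \<sigma> \<le> p" unfolding p_def \<sigma>_def using J(1) r0 by (intro one_plus_sum_le_prod) auto
  have \<sigma>0: "\<sigma> \<ge> 0" unfolding \<sigma>_def using r0 by (intro sum_nonneg) auto
  have "(\<Sum>j\<in>J. z j) = - 2 * W" unfolding W_def v_def by (simp add: sum_negf sum_divide_distrib[symmetric])
  hence R: "douglas_symbol J z = (P - 2 * W) / P"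
    unfolding douglas_symbol_def inv using P0 by (simp add: field_simps)
  have "(norm (P - 2 * W))\<^sup>2 = (norm P)\<^sup>2 - 4 * Re ((P - W) * cnj W)"
    unfolding cmod_power2 by (simp add: power2_eq_square algebra_simps)
  also have "\<dots> \<le> (norm P)\<^sup>2 - 2 * ((p - \<sigma>) * \<sigma>)" using cone by simp
  finally have "(norm (P - 2 * W))\<^sup>2 / (norm P)\<^sup>2 \<le> ((norm P)\<^sup>2 - 2 * ((p - \<sigma>) * \<sigma>)) / (norm P)\<^sup>2"
    by (intro divide_right_mono) auto
  also have "\<dots> = 1 - 2 * ((p - \<sigma>) * \<sigma>) / (norm P)\<^sup>2" using P0 by (simp add: diff_divide_distrib)
  also have "\<dots> \<le> 1 - 2 * ((p - \<sigma>) * \<sigma>) / p\<^sup>2"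
  proof -
    have "2 * ((p - \<sigma>) * \<sigma>) / p\<^sup>2 \<le> 2 * ((p - \<sigma>) * \<sigma>) / (norm P)\<^sup>2"
      using p\<sigma> \<sigma>0 Pp P0 by (intro divide_left_mono mult_nonneg_nonneg power_mono) auto
    thus ?thesis by simp
  qed
  also have "\<dots> \<le> exp (- (2 * ((p - \<sigma>) * \<sigma>) / p\<^sup>2))"
    using exp_ge_add_one_self[of "- (2 * ((p - \<sigma>) * \<sigma>) / p\<^sup>2)"] by simp
  also have "\<dots> = (exp (- ((p - \<sigma>) * \<sigma> / p\<^sup>2)))\<^sup>2" by (simp add: power2_eq_square flip: exp_add)
  finally have "(norm (douglas_symbol J z))\<^sup>2 \<le> (exp (- ((p - \<sigma>) * \<sigma> / p\<^sup>2)))\<^sup>2"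
    unfolding R norm_divide power_divide .
  thus "norm (douglas_symbol J z) \<le> exp (- ((p - \<sigma>) * \<sigma> / p\<^sup>2))"
    by (rule power2_le_imp_le) simp
qed

lemma one_plus_powr_square_le:
  fixes y e a :: real
  assumes "y \<ge> 0" "e > 0" "2 * e \<le> a"
  shows "(1 + y powr e)\<^sup>2 \<le> 4 * (1 + y) powr a"
proof -
  have "y powr e \<le> (1 + y) powr e" using assms by (intro powr_mono2) auto
  moreover have "1 \<le> (1 + y) powr e" using assms by (intro ge_one_powr_ge_zero) auto
  ultimately have "1 + y powr e \<le> 2 * (1 + y) powr e" by simp
  hence "(1 + y powr e)\<^sup>2 \<le> (2 * (1 + y) powr e)\<^sup>2" by (intro power_mono) auto
  also have "\<dots> = 4 * (1 + y) powr (2 * e)" by (simp add: power2_eq_square flip: powr_add)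
  also have "\<dots> \<le> 4 * (1 + y) powr a" using assms by (intro mult_left_mono powr_mono) auto
  finally show ?thesis .
qed

text \<open>Let \<open>p\<close> be the product of the \<open>1 + \<bar>z\<^sub>j\<bar>/2\<close>. If all \<open>\<bar>z\<^sub>j\<bar> \<le> 2\<close>, the gap is at least a multiple of \<open>\<Sum>\<bar>z\<^sub>j\<bar>\<close>, so \<open>R\<^sup>k\<close> decays like a product of
  functions of \<open>k \<bar>z\<^sub>j\<bar>\<close>. Otherwise the gap is at least \<open>1/(2p)\<close>, and a quarter power of \<open>p\<close> is sacrificed
  from \<open>P\<^sup>-\<^sup>1\<close> in exchange for decay in \<open>k\<close>. In both cases the bound is a product over the
  directions, which is what one-variable contour integration requires. The shape
  \<open>1/(1 + x powr e)\<^sup>2\<close> is chosen since, times \<open>x powr (e - 1)\<close>, it has an elementary antiderivative.\<close>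

lemma symbol_power_bound:
  fixes J :: "nat set" and z :: "nat \<Rightarrow> complex" and k :: nat and e :: real
  assumes J: "finite J" "J \<noteq> {}" and \<alpha>: "0 < \<alpha>" "real (card J + 1) * \<alpha> \<le> pi / 3"
    and z: "\<And>j. j \<in> J \<Longrightarrow> \<bar>Im (z j)\<bar> \<le> tan \<alpha> * - Re (z j)"
    and e: "0 < e" "e \<le> 1/4"
  shows "norm (douglas_symbol J z ^ k * douglas_inv J z)
    \<le> 2 ^ card J * (12 * 4 ^ card J) ^ card J * (\<Prod>j\<in>J. 1 / (1 + ((real k + 1) / 2 * norm (z j)) powr e)\<^sup>2)
      + 6 * 8 ^ card J * (real k + 1) powr (- (1/4)) * (\<Prod>j\<in>J. 1 / (1 + (1 / 2 * norm (z j)) powr e)\<^sup>2)"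
proof -
  define r where "r j = norm (z j) / 2" for j
  define p where "p = (\<Prod>j\<in>J. 1 + r j)"
  define \<sigma> where "\<sigma> = (\<Sum>j\<in>J. r j)"
  define x where "x = real k + 1"
  let ?m = "card J"
  have r0: "r j \<ge> 0" for j unfolding r_def by simp
  have p\<sigma>: "1 + \<sigma> \<le> p" unfolding p_def \<sigma>_def using J(1) r0 by (intro one_plus_sum_le_prod) auto
  have \<sigma>0: "\<sigma> \<ge> 0" unfolding \<sigma>_def using r0 by (intro sum_nonneg) auto
  have p1: "p \<ge> 1" using p\<sigma> \<sigma>0 by simp
  have x1: "x \<ge> 1" unfolding x_def by simp
  define E where "E = real k * ((p - \<sigma>) * \<sigma> / p\<^sup>2)"
  have "norm (douglas_symbol J z ^ k * douglas_inv J z) \<le> exp (- ((p - \<sigma>) * \<sigma> / p\<^sup>2)) ^ k * (2 ^ ?m / p)"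
    unfolding norm_mult norm_power using symbol_bounds[OF J \<alpha> z] p1
    unfolding p_def \<sigma>_def r_def by (intro mult_mono power_mono) auto
  also have "exp (- ((p - \<sigma>) * \<sigma> / p\<^sup>2)) ^ k = exp (- E)" unfolding E_def by (simp flip: exp_of_nat_mult)
  finally have main: "norm (douglas_symbol J z ^ k * douglas_inv J z) \<le> exp (- E) * (2 ^ ?m / p)" .
  let ?A = "\<Prod>j\<in>J. 1 / (1 + (x / 2 * norm (z j)) powr e)\<^sup>2"
  let ?B = "\<Prod>j\<in>J. 1 / (1 + (1 / 2 * norm (z j)) powr e)\<^sup>2"
  have AB0: "?A \<ge> 0" "?B \<ge> 0" by (auto intro!: prod_nonneg)
  have "exp (- E) * (2 ^ ?m / p) \<le> 2 ^ ?m * (12 * 4 ^ ?m) ^ ?m * ?A + 6 * 8 ^ ?m * x powr (- (1/4)) * ?B"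
  proof (cases "\<forall>j\<in>J. r j \<le> 1")
    case True
    \<comment> \<open>here \<open>p \<le> 2\<^sup>m\<close>, which gives the exponent \<open>c k \<sigma>\<close>\<close>
    define c :: real where "c = 1 / 4 ^ ?m"
    have c: "0 < c" "c \<le> 1" unfolding c_def by auto
    have "p \<le> (\<Prod>j\<in>J. 2)" unfolding p_def using True r0 by (intro prod_mono) (auto simp: add_nonneg_nonneg)
    hence "p\<^sup>2 \<le> (2 ^ ?m)\<^sup>2" using p1 by (intro power_mono) auto
    also have "(2 ^ ?m)\<^sup>2 = (4::real) ^ ?m" by (simp add: power2_eq_square flip: power_mult_distrib)
    finally have p4: "p\<^sup>2 \<le> 4 ^ ?m" .
    have "c * \<sigma> = 1 * \<sigma> / 4 ^ ?m" unfolding c_def by simp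
    also have "\<dots> \<le> (p - \<sigma>) * \<sigma> / p\<^sup>2"
      using p\<sigma> \<sigma>0 p1 p4 by (intro frac_le mult_right_mono mult_nonneg_nonneg) auto
    finally have "real k * (c * \<sigma>) \<le> E" unfolding E_def by (intro mult_left_mono) auto
    hence "exp (- E) \<le> exp (- (real k * (c * \<sigma>)))" by simp
    also have "- (real k * (c * \<sigma>)) = (\<Sum>j\<in>J. - (real k * c * r j))"
      unfolding \<sigma>_def by (simp add: sum_distrib_left sum_negf mult.assoc)
    also have "exp \<dots> = (\<Prod>j\<in>J. exp (- (real k * c * r j)))" by (rule exp_sum[OF J(1)])
    also have "\<dots> \<le> (\<Prod>j\<in>J. 12 * 4 ^ ?m * (1 / (1 + (x / 2 * norm (z j)) powr e)\<^sup>2))"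
    proof (intro prod_mono conjI)
      fix j assume j: "j \<in> J"
      define y where "y = x * r j"
      have y0: "y \<ge> 0" unfolding y_def using x1 r0 by auto
      have "c * r j \<le> 1 * 1" using True j c r0 by (intro mult_mono) auto
      hence "- (real k * c * r j) \<le> 1 + - (c * y)" unfolding y_def x_def by (simp add: algebra_simps)
      hence "exp (- (real k * c * r j)) \<le> exp (1 + - (c * y))" by simp
      also have "\<dots> = exp 1 * exp (- (c * y))" by (rule exp_add)
      also have "\<dots> \<le> 3 * ((1 / c) / (1 + y))"
      proof (intro mult_mono)
        have "1 + c * y \<le> exp (c * y)" by (rule exp_ge_add_one_self)
        moreover have "c * (1 + y) \<le> 1 + c * y" using c by (simp add: algebra_simps)
        ultimately have "c * (1 + y) \<le> exp (c * y)" by linarith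
        hence "inverse (exp (c * y)) \<le> inverse (c * (1 + y))" using c y0 by (intro le_imp_inverse_le) auto
        thus "exp (- (c * y)) \<le> (1 / c) / (1 + y)" by (simp add: exp_minus field_simps)
      qed (use exp_le in auto)
      also have "\<dots> \<le> 3 * ((1 / c) / ((1 + y powr e)\<^sup>2 / 4))"
      proof -
        have "(1 + y powr e)\<^sup>2 \<le> 4 * (1 + y) powr 1" using y0 e by (intro one_plus_powr_square_le) auto
        hence "(1 + y powr e)\<^sup>2 / 4 \<le> 1 + y" using y0 by simp
        moreover have "(1 + y powr e)\<^sup>2 > 0" by (smt (verit) powr_ge_zero zero_less_power)
        ultimately show ?thesis using c y0 by (intro mult_left_mono divide_left_mono) auto
      qed
      also have "\<dots> = 12 * 4 ^ ?m * (1 / (1 + (x / 2 * norm (z j)) powr e)\<^sup>2)"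
        unfolding c_def y_def r_def by simp
      finally show "exp (- (real k * c * r j)) \<le> 12 * 4 ^ ?m * (1 / (1 + (x / 2 * norm (z j)) powr e)\<^sup>2)" .
    qed auto
    also have "\<dots> = (12 * 4 ^ ?m) ^ ?m * ?A" by (simp only: prod.distrib prod_constant power_mult_distrib)
    finally have "exp (- E) * (2 ^ ?m / p) \<le> (12 * 4 ^ ?m) ^ ?m * ?A * (2 ^ ?m / 1)"
      using p1 AB0 by (intro mult_mono divide_left_mono mult_nonneg_nonneg) auto
    moreover have "6 * 8 ^ ?m * x powr (- (1/4)) * ?B \<ge> 0" using AB0 by (intro mult_nonneg_nonneg) auto
    ultimately show ?thesis by (simp add: mult_ac)
  next
    case False
    then obtain j where j: "j \<in> J" "r j > 1" by auto
    have "r j \<le> \<sigma>" unfolding \<sigma>_def using j r0 J by (intro member_le_sum) auto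
    hence \<sigma>1: "\<sigma> \<ge> 1" using j by simp
    define b where "b = p - \<sigma>"
    have b1: "b \<ge> 1" unfolding b_def using p\<sigma> by simp
    \<comment> \<open>for \<open>b, \<sigma> \<ge> 1\<close> the product dominates half of the sum \<open>p = b + \<sigma>\<close>\<close>
    have "0 \<le> (b - 1) * (\<sigma> - 1)" using b1 \<sigma>1 by simp
    hence "p / 2 \<le> b * \<sigma>" using b1 \<sigma>1 unfolding b_def by (simp add: algebra_simps)
    hence "p / 2 / p\<^sup>2 \<le> b * \<sigma> / p\<^sup>2" by (intro divide_right_mono) auto
    moreover have "p / 2 / p\<^sup>2 = 1 / (2 * p)" using p1 by (simp add: power2_eq_square)
    ultimately have "real k * (1 / (2 * p)) \<le> E" unfolding E_def b_def by (intro mult_left_mono) auto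
    hence "exp (- E) \<le> exp (1 + - (x / (2 * p)))"
    proof -
      have "1 / (2 * p) \<le> 1" using p1 by simp
      moreover have "x / (2 * p) = real k * (1 / (2 * p)) + 1 / (2 * p)"
        unfolding x_def by (simp add: add_divide_distrib)
      ultimately have "- E \<le> 1 + - (x / (2 * p))" using \<open>real k * (1 / (2 * p)) \<le> E\<close> by linarith
      thus ?thesis by simp
    qed
    also have "\<dots> = exp 1 * exp (- (x / (2 * p)))" by (rule exp_add)
    also have "\<dots> \<le> 3 * (2 * (p powr (1/4) * x powr (- (1/4))))"
    proof (intro mult_mono)
      define y where "y = x / (2 * p)"
      have y0: "y > 0" unfolding y_def using x1 p1 by simp
      have "y powr (1/4) \<le> (1 + y) powr (1/4)" using y0 by (intro powr_mono2) auto
      also have "\<dots> \<le> (1 + y) powr 1" using y0 by (intro powr_mono) auto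
      also have "\<dots> \<le> exp y" using y0 exp_ge_add_one_self[of y] by simp
      finally have "exp (- y) \<le> inverse (y powr (1/4))" using y0 by (simp add: exp_minus le_imp_inverse_le)
      also have "\<dots> = (2 * p) powr (1/4) * x powr (- (1/4))"
        unfolding y_def using x1 p1 by (simp add: powr_divide powr_minus field_simps)
      also have "(2 * p) powr (1/4) = 2 powr (1/4) * p powr (1/4)" by (rule powr_mult)
      also have "2 powr (1/4) \<le> 2 powr (1::real)" by (intro powr_mono) auto
      finally show "exp (- (x / (2 * p))) \<le> 2 * (p powr (1/4) * x powr (- (1/4)))"
        unfolding y_def by (simp add: mult_right_mono mult_ac)
    qed (use exp_le in auto)
    finally have "exp (- E) * (2 ^ ?m / p) \<le> 3 * (2 * (p powr (1/4) * x powr (- (1/4)))) * (2 ^ ?m / p)"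
      using p1 by (intro mult_right_mono) auto
    also have "\<dots> = 6 * 2 ^ ?m * x powr (- (1/4)) * p powr (- (3/4))"
    proof -
      have "p powr (1/4) / p = p powr (1/4 - 1)" using p1 by (simp only: powr_diff) simp
      hence "p powr (- (3/4)) = p powr (1/4) / p" by simp
      thus ?thesis by simp
    qed
    also have "p powr (- (3/4)) = (\<Prod>j\<in>J. (1 + r j) powr (- (3/4)))"
      unfolding p_def by (rule prod_powr_distrib)
    also have "6 * 2 ^ ?m * x powr (- (1/4)) * \<dots> \<le> 6 * 2 ^ ?m * x powr (- (1/4)) * (\<Prod>j\<in>J. 4 * (1 / (1 + (1 / 2 * norm (z j)) powr e)\<^sup>2))"
    proof (intro mult_left_mono prod_mono conjI)
      fix j assume j: "j \<in> J"
      have "(1 + r j powr e)\<^sup>2 \<le> 4 * (1 + r j) powr (3/4)" using r0 e by (intro one_plus_powr_square_le) auto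
      moreover have "(1 + r j powr e)\<^sup>2 > 0" by (smt (verit) powr_ge_zero zero_less_power)
      ultimately have "inverse ((1 + r j) powr (3/4)) \<le> inverse ((1 + r j powr e)\<^sup>2 / 4)"
        by (intro le_imp_inverse_le) auto
      thus "(1 + r j) powr (- (3/4)) \<le> 4 * (1 / (1 + (1 / 2 * norm (z j)) powr e)\<^sup>2)"
        unfolding powr_minus r_def by simp
    qed auto
    also have "(\<Prod>j\<in>J. 4 * (1 / (1 + (1 / 2 * norm (z j)) powr e)\<^sup>2)) = 4 ^ ?m * ?B"
      by (simp only: prod.distrib prod_constant)
    also have "6 * 2 ^ ?m * x powr (- (1/4)) * (4 ^ ?m * ?B) = 6 * 8 ^ ?m * x powr (- (1/4)) * ?B"
      by (simp flip: power_mult_distrib)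
    finally have "exp (- E) * (2 ^ ?m / p) \<le> 6 * 8 ^ ?m * x powr (- (1/4)) * ?B" .
    moreover have "2 ^ ?m * (12 * 4 ^ ?m) ^ ?m * ?A \<ge> 0" using AB0 by (intro mult_nonneg_nonneg) auto
    ultimately show ?thesis by linarith
  qed
  thus ?thesis using main unfolding x_def by linarith
qed

section \<open>Cauchy integrals over a thin triangle\<close>

text \<open>Boundary of the triangle with vertex \<open>0\<close> and a vertical side at real part \<open>-L\<close>, positively oriented; \<open>t\<close>
  is the tangent of half the angle at \<open>0\<close>. A bounded contour around the whole spectrum avoids limits at
  infinity, and the bounds below do not depend on \<open>L\<close>.\<close>

definition triangle_path :: "real \<Rightarrow> real \<Rightarrow> real \<Rightarrow> complex" where
  "triangle_path t L = linepath 0 (Complex (- L) (L * t)) +++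
     linepath (Complex (- L) (L * t)) (Complex (- L) (- (L * t))) +++
     linepath (Complex (- L) (- (L * t))) 0"

lemma valid_path_triangle_path: "valid_path (triangle_path t L)"
  unfolding triangle_path_def by (intro valid_path_join) auto

lemma path_image_triangle_path_cases:
  assumes s: "s \<in> path_image (triangle_path t L)" "s \<noteq> 0" and L: "L > 0" and t: "t > 0"
  obtains (ray) "\<bar>Im s\<bar> = t * - Re s" "- L \<le> Re s" "Re s < 0"
  | (far) "Re s = - L" "\<bar>Im s\<bar> \<le> L * t"
proof -
  have *: "\<bar>Im s\<bar> = t * - Re s \<and> - L \<le> Re s \<and> Re s < 0"
    if s: "s = of_real x * Complex (- L) (c * (L * t))" and x: "0 \<le> x" "x \<le> 1" and c: "\<bar>c\<bar> = 1" and ne: "s \<noteq> 0" for x c s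
  proof -
    have x0: "x > 0" using ne s x by (cases "x = 0") auto
    have R: "Re s = - (x * L)" "Im s = c * (x * (L * t))" unfolding s by simp_all
    have "\<bar>Im s\<bar> = x * (L * t)" unfolding R abs_mult c using x L t by simp
    moreover have "x * L \<le> 1 * L" using x L by (intro mult_right_mono) auto
    ultimately show ?thesis using R x0 L by simp
  qed
  have "s \<in> closed_segment 0 (Complex (- L) (L * t)) \<or> s \<in> closed_segment (Complex (- L) (L * t)) (Complex (- L) (- (L * t)))
     \<or> s \<in> closed_segment (Complex (- L) (- (L * t))) 0"
    using s unfolding triangle_path_def by (auto simp: path_image_join)
  then consider "s \<in> closed_segment 0 (Complex (- L) (L * t))" 
    | "s \<in> closed_segment (Complex (- L) (L * t)) (Complex (- L) (- (L * t)))"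
    | "s \<in> closed_segment 0 (Complex (- L) (- (L * t)))" by (auto simp: closed_segment_commute)
  thus ?thesis
  proof cases
    case 1
    then obtain x where "0 \<le> x" "x \<le> 1" "s = of_real x * Complex (- L) (1 * (L * t))"
      by (auto simp: closed_segment_def scaleR_conv_of_real)
    from *[OF this(3,1,2) _ s(2)] have "\<bar>Im s\<bar> = t * - Re s \<and> - L \<le> Re s \<and> Re s < 0" by simp
    thus ?thesis by (intro ray) simp_all
  next
    case 3
    then obtain x where "0 \<le> x" "x \<le> 1" "s = of_real x * Complex (- L) (- 1 * (L * t))"
      by (auto simp: closed_segment_def scaleR_conv_of_real)
    from *[OF this(3,1,2) _ s(2)] have "\<bar>Im s\<bar> = t * - Re s \<and> - L \<le> Re s \<and> Re s < 0" by simp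
    thus ?thesis by (intro ray) simp_all
  next
    case 2
    then obtain x where x: "0 \<le> x" "x \<le> 1"
      "s = (1 - x) *\<^sub>R Complex (- L) (L * t) + x *\<^sub>R Complex (- L) (- (L * t))"
      by (auto simp: closed_segment_def)
    have "Re s = - L" unfolding x by (simp add: algebra_simps)
    moreover have "Im s = (1 - 2 * x) * (L * t)" unfolding x by (simp add: algebra_simps)
    hence "\<bar>Im s\<bar> = \<bar>1 - 2 * x\<bar> * (L * t)" using L t by (simp add: abs_mult)
    moreover have "\<bar>1 - 2 * x\<bar> * (L * t) \<le> 1 * (L * t)" using x L t by (intro mult_right_mono) auto
    ultimately show ?thesis by (intro far) simp_all
  qed
qed

lemma triangle_path_sector:
  assumes s: "s \<in> path_image (triangle_path t L)" "s \<noteq> 0" and L: "L > 0" and t: "t > 0"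
  shows "\<bar>Im s\<bar> \<le> t * - Re s" "Re s < 0"
  by (rule path_image_triangle_path_cases[OF s L t]; use L t in \<open>auto simp: mult.commute\<close>)+

lemma cauchy_formula_triangle_path:
  assumes L: "L > 0" and t: "t > 0" and x: "- L < x" "x < 0"
    and hol: "f holomorphic_on {s. Re s < 1}"
  shows "((\<lambda>s. f s / (s - of_real x)) has_contour_integral (2 * pi * \<i> * f (of_real x))) (triangle_path t L)"
proof -
  let ?b = "Complex (- L) (L * t)" and ?c = "Complex (- L) (- (L * t))"
  let ?x = "complex_of_real x"
  have notin: "?x \<notin> path_image (triangle_path t L)"
  proof
    assume "?x \<in> path_image (triangle_path t L)"
    moreover have "?x \<noteq> 0" using x by simp
    ultimately show False
      by (rule path_image_triangle_path_cases[OF _ _ L t]) (use x t in auto)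
  qed
  have hull: "?x \<in> convex hull {0, ?b, ?c}"
  proof -
    have "?x = (1 + x / L) *\<^sub>R 0 + (- x / (2 * L)) *\<^sub>R ?b + (- x / (2 * L)) *\<^sub>R ?c"
      using L by (simp add: complex_eq_iff)
    moreover have "0 \<le> 1 + x / L" "0 \<le> - x / (2 * L)" "(1 + x / L) + (- x / (2 * L)) + (- x / (2 * L)) = 1"
      using L x by (auto simp: field_simps)
    ultimately show ?thesis unfolding convex_hull_3 by blast
  qed
  have int: "?x \<in> interior (convex hull {0, ?b, ?c})"
    using hull notin by (subst interior_of_triangle) (auto simp: triangle_path_def path_image_join)
  have w: "winding_number (triangle_path t L) ?x = 1"
  proof -
    have "Im ((?b - 0) * cnj (?b - ?x)) = - x * (L * t)" by (simp add: algebra_simps)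
    also have "\<dots> > 0" using x L t by (intro mult_pos_pos) auto
    finally show ?thesis using winding_number_triangle[OF int] unfolding triangle_path_def by simp
  qed
  have conv: "convex {s :: complex. Re s < 1}" by (rule convex_halfspace_Re_lt)
  have op: "open {s :: complex. Re s < 1}" by (rule open_halfspace_Re_lt)
  have "((\<lambda>s. f s / (s - ?x)) has_contour_integral (2*pi * \<i> * winding_number (triangle_path t L) ?x * f ?x)) (triangle_path t L)"
  proof (rule Cauchy_integral_formula_convex_simple[OF conv hol _ valid_path_triangle_path])
    show "?x \<in> interior {s. Re s < 1}" using x by (simp add: interior_open[OF op])
    show "path_image (triangle_path t L) \<subseteq> {s. Re s < 1} - {?x}"
    proof
      fix s assume s: "s \<in> path_image (triangle_path t L)"
      have "Re s < 1" using triangle_path_sector(2)[OF s _ L t] by (cases "s = 0") auto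
      thus "s \<in> {s. Re s < 1} - {?x}" using s notin by auto
    qed
    show "pathfinish (triangle_path t L) = pathstart (triangle_path t L)" unfolding triangle_path_def by simp
  qed
  thus ?thesis unfolding w by simp
qed

definition decay_weight :: "real \<Rightarrow> real \<Rightarrow> real \<Rightarrow> real" where
  "decay_weight e q r = 1 / (1 + (q * r) powr e)\<^sup>2"

lemma decay_weight_nonneg: "decay_weight e q r \<ge> 0"
  unfolding decay_weight_def by simp

text \<open>The antiderivative is \<open>-1/(1 + (q r) powr e)\<close> up to a factor, so the integral over the whole ray
  is finite, and scaling yields the power of \<open>q\<close>.\<close>

lemma powr_weight_integral:
  fixes e q n :: real
  assumes e: "0 < e" and q: "q > 0" and n: "n > 0"
  defines "D \<equiv> \<lambda>x. decay_weight e q (x * n) * (x * n) powr (e - 1) * n"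
  shows "D integrable_on {0..1}" and "integral {0..1} D \<le> q powr (- e) / e"
proof -
  define \<Psi> where "\<Psi> x = - (q powr (- e) / e) / (1 + (q * (x * n)) powr e)" for x
  have pos: "1 + (q * (x * n)) powr e > 0" for x by (simp add: add_pos_nonneg)
  have quot: "((\<lambda>x. - c / (1 + u x)) has_real_derivative c * u' / (1 + u x)\<^sup>2) (at x)"
    if "(u has_real_derivative u') (at x)" "1 + u x \<noteq> 0" for c u' x :: real and u :: "real \<Rightarrow> real"
    using that by (auto intro!: derivative_eq_intros simp: power2_eq_square)
  have "(D has_integral (\<Psi> 1 - \<Psi> 0)) {0..1}"
  proof (rule fundamental_theorem_of_calculus_interior)
    have "continuous_on {0..1} (\<lambda>x. (q * (x * n)) powr e)"
      using e q n by (intro continuous_on_powr' continuous_intros) auto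
    moreover have "1 + (q * (x * n)) powr e \<noteq> 0" for x using pos[of x] by linarith
    ultimately show "continuous_on {0..1} \<Psi>" unfolding \<Psi>_def
      by (intro continuous_on_divide continuous_on_add continuous_on_const) blast+
    fix x :: real assume x: "x \<in> {0<..<1}"
    have xn: "q * (x * n) > 0" using x q n by simp
    have "((\<lambda>x. (q * (x * n)) powr e) has_real_derivative e * (q * (x * n)) powr (e - 1) * (q * n)) (at x)"
      using xn by (auto intro!: derivative_eq_intros simp: powr_diff field_simps)
    hence "(\<Psi> has_real_derivative (q powr (- e) / e) * (e * (q * (x * n)) powr (e - 1) * (q * n)) / (1 + (q * (x * n)) powr e)\<^sup>2) (at x)"
      unfolding \<Psi>_def using pos[of x] by (intro quot) auto
    moreover have "(q powr (- e) / e) * (e * (q * (x * n)) powr (e - 1) * (q * n)) / (1 + (q * (x * n)) powr e)\<^sup>2 = D x"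
    proof -
      have "(q * (x * n)) powr (e - 1) = q powr (e - 1) * (x * n) powr (e - 1)" using q n x by (simp add: powr_mult)
      moreover have "q powr (- e) * (q powr (e - 1) * q) = 1" 
        using q by (simp add: powr_diff powr_minus)
      ultimately show ?thesis using e unfolding D_def decay_weight_def by (simp add: field_simps) 
    qed
    ultimately show "(\<Psi> has_vector_derivative D x) (at x)"
      by (simp add: has_real_derivative_iff_has_vector_derivative)
  qed simp
  moreover have "\<Psi> 1 - \<Psi> 0 \<le> q powr (- e) / e"
  proof -
    have "\<Psi> 1 \<le> 0" unfolding \<Psi>_def using pos[of 1] e q by (simp add: divide_nonneg_pos)
    moreover have "\<Psi> 0 = - (q powr (- e) / e)" unfolding \<Psi>_def by simp
    ultimately show ?thesis by linarith
  qed
  ultimately show "D integrable_on {0..1}" "integral {0..1} D \<le> q powr (- e) / e"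
    by (auto simp: integral_unique has_integral_integrable)
qed

text \<open>No bound is available at the end point \<open>0\<close>, so the integrand is set to \<open>0\<close> there before it is
  dominated.\<close>

lemma ray_integral_bound:
  assumes I: "(f has_contour_integral I) (linepath 0 c)" and c: "c \<noteq> 0" and e: "0 < e"
    and q: "q1 > 0" "q2 > 0" and A: "A1 \<ge> 0" "A2 \<ge> 0"
    and f: "\<And>s. s \<in> closed_segment 0 c \<Longrightarrow> s \<noteq> 0 \<Longrightarrow>
      norm (f s) \<le> (A1 * decay_weight e q1 (norm s) + A2 * decay_weight e q2 (norm s)) * norm s powr (e - 1)"
  shows "norm I \<le> (A1 * q1 powr (- e) + A2 * q2 powr (- e)) / e"
proof -
  define D where "D q = (\<lambda>x. decay_weight e q (x * norm c) * (x * norm c) powr (e - 1) * norm c)" for q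
  have D: "D q integrable_on {0..1}" "integral {0..1} (D q) \<le> q powr (- e) / e" if "q > 0" for q
    unfolding D_def using powr_weight_integral[OF e that, of "norm c"] c by auto
  define h where "h x = (if x = 0 then 0 else f (of_real x * c) * c)" for x :: real
  have "((\<lambda>x. f (linepath 0 c x) * (c - 0)) has_integral I) {0..1}"
    using I unfolding has_contour_integral_linepath .
  hence h: "(h has_integral I) {0..1}"
    by (rule has_integral_spike_finite[of "{0}", rotated 2])
      (auto simp: h_def linepath_def scaleR_conv_of_real)
  have g: "(\<lambda>x. A1 * D q1 x + A2 * D q2 x) integrable_on {0..1}"
    using D(1) q by (intro integrable_add integrable_on_mult_right) auto
  have "norm (integral {0..1} h) \<le> integral {0..1} (\<lambda>x. A1 * D q1 x + A2 * D q2 x)"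
  proof (rule integral_norm_bound_integral[OF has_integral_integrable[OF h] g])
    fix x :: real assume x: "x \<in> {0..1}"
    show "norm (h x) \<le> A1 * D q1 x + A2 * D q2 x"
    proof (cases "x = 0")
      case True thus ?thesis by (simp add: h_def D_def)
    next
      case False
      have "of_real x * c \<in> closed_segment 0 c"
        using x by (auto simp: closed_segment_def scaleR_conv_of_real)
      moreover have "norm (of_real x * c) = x * norm c" using x by (simp add: norm_mult)
      ultimately have "norm (f (of_real x * c)) * norm c \<le> (A1 * decay_weight e q1 (x * norm c) + A2 * decay_weight e q2 (x * norm c)) * (x * norm c) powr (e - 1) * norm c"
        using f[of "of_real x * c"] False c by (intro mult_right_mono) auto
      thus ?thesis using False by (simp add: h_def D_def norm_mult algebra_simps)
    qed
  qed
  also have "\<dots> = A1 * integral {0..1} (D q1) + A2 * integral {0..1} (D q2)"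
    using D(1) q by (simp add: integral_add integrable_on_mult_right)
  also have "\<dots> \<le> A1 * (q1 powr (- e) / e) + A2 * (q2 powr (- e) / e)"
    using D(2) q A by (intro add_mono mult_left_mono) auto
  finally show ?thesis using integral_unique[OF h] by (simp add: add_divide_distrib)
qed

lemma decay_weight_antimono:
  assumes "q > 0" "e > 0" "0 \<le> r" "r \<le> r'"
  shows "decay_weight e q r' \<le> decay_weight e q r"
  unfolding decay_weight_def using assms
  by (intro divide_left_mono power_mono add_left_mono powr_mono2 mult_left_mono) (auto intro!: mult_pos_pos zero_less_power add_pos_nonneg)

lemma decay_weight_peak:
  assumes "q > 0" "r > 0"
  shows "decay_weight e q r * r powr e \<le> q powr (- e)"
proof -
  define y where "y = (q * r) powr e"
  have y: "y > 0" unfolding y_def using assms by simp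
  have "r powr e = q powr (- e) * y" unfolding y_def using assms by (simp add: powr_mult powr_minus field_simps)
  moreover have "y / (1 + y)\<^sup>2 \<le> 1" 
  proof -
    have "y \<le> (1 + y)\<^sup>2" using y by (simp add: power2_eq_square algebra_simps)
    moreover have "(1 + y)\<^sup>2 > 0" using y by simp
    ultimately show ?thesis by (simp add: pos_divide_le_eq)
  qed
  hence "q powr (- e) * (y / (1 + y)\<^sup>2) \<le> q powr (- e) * 1" by (intro mult_left_mono) auto
  ultimately show ?thesis unfolding decay_weight_def y_def by (simp add: field_simps)
qed

text \<open>The two rays are covered by \<open>ray_integral_bound\<close>. On the vertical side the integrand is of size at
  most \<open>q powr (- e)/L\<close> and the length is \<open>2 t L\<close>.\<close>

lemma triangle_path_integral_bound:
  assumes I: "(f has_contour_integral I) (triangle_path t L)" and L: "L > 0" and t: "t > 0" and e: "0 < e" "e \<le> 1"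
    and q: "q1 > 0" "q2 > 0" and A: "A1 \<ge> 0" "A2 \<ge> 0"
    and f: "\<And>s. s \<in> path_image (triangle_path t L) \<Longrightarrow> s \<noteq> 0 \<Longrightarrow>
      norm (f s) \<le> (A1 * decay_weight e q1 (norm s) + A2 * decay_weight e q2 (norm s)) * norm s powr (e - 1)"
  shows "norm I \<le> (2 + 2 * t) / e * (A1 * q1 powr (- e) + A2 * q2 powr (- e))"
proof -
  let ?b = "Complex (- L) (L * t)" and ?c = "Complex (- L) (- (L * t))"
  have "f contour_integrable_on triangle_path t L" using I unfolding contour_integrable_on_def by blast
  hence int: "f contour_integrable_on linepath 0 ?b" "f contour_integrable_on linepath ?b ?c" "f contour_integrable_on linepath ?c 0"
    unfolding triangle_path_def by (auto simp: valid_path_join)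
  have Isum: "contour_integral (linepath 0 ?b) f + contour_integral (linepath ?b ?c) f + contour_integral (linepath ?c 0) f = I"
    by (rule has_chain_integral_chain_integral3) (use I in \<open>simp add: triangle_path_def\<close>)
  have pi: "closed_segment 0 ?b \<subseteq> path_image (triangle_path t L)" "closed_segment ?b ?c \<subseteq> path_image (triangle_path t L)" "closed_segment 0 ?c \<subseteq> path_image (triangle_path t L)"
    unfolding triangle_path_def by (auto simp: path_image_join closed_segment_commute)
  let ?K = "A1 * q1 powr (- e) + A2 * q2 powr (- e)"
  have K0: "?K \<ge> 0" using A by simp
  have bc: "?b \<noteq> 0" "?c \<noteq> 0" using L by (auto simp: complex_eq_iff)
  have 1: "norm (contour_integral (linepath 0 ?b) f) \<le> ?K / e"
    by (rule ray_integral_bound[OF has_contour_integral_integral[OF int(1)] bc(1) e(1) q A])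
      (use f pi in auto)
  have rev: "(f has_contour_integral - contour_integral (linepath ?c 0) f) (linepath 0 ?c)"
    by (rule has_contour_integral_reverse_linepath[OF has_contour_integral_integral[OF int(3)]])
  have "norm (- contour_integral (linepath ?c 0) f) \<le> ?K / e"
    by (rule ray_integral_bound[OF rev bc(2) e(1) q A]) (use f pi in auto)
  hence 3: "norm (contour_integral (linepath ?c 0) f) \<le> ?K / e" by simp
  let ?B = "(A1 * decay_weight e q1 L + A2 * decay_weight e q2 L) * L powr (e - 1)"
  have "norm (contour_integral (linepath ?b ?c) f) \<le> ?B * norm (?c - ?b)"
  proof (rule has_contour_integral_bound_linepath[OF has_contour_integral_integral[OF int(2)]])
    show "0 \<le> ?B" using A decay_weight_nonneg by (intro mult_nonneg_nonneg add_nonneg_nonneg) auto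
    fix s assume s: "s \<in> closed_segment ?b ?c"
    have "Re s = - L"
    proof -
      obtain x where x: "s = (1 - x) *\<^sub>R ?b + x *\<^sub>R ?c" using s unfolding closed_segment_def by blast
      show ?thesis unfolding x by (simp add: algebra_simps)
    qed
    hence sL: "L \<le> norm s" using abs_Re_le_cmod[of s] L by simp
    hence s0: "s \<noteq> 0" using L by auto
    have "norm (f s) \<le> (A1 * decay_weight e q1 (norm s) + A2 * decay_weight e q2 (norm s)) * norm s powr (e - 1)"
      using f[of s] s s0 pi by blast
    also have "\<dots> \<le> ?B"
    proof (intro mult_mono add_mono mult_left_mono decay_weight_antimono)
      show "norm s powr (e - 1) \<le> L powr (e - 1)" using sL L e by (intro powr_mono2') auto
    qed (use q e A L sL decay_weight_nonneg in \<open>auto intro!: add_nonneg_nonneg mult_nonneg_nonneg\<close>)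
    finally show "norm (f s) \<le> ?B" .
  qed
  also have "norm (?c - ?b) = 2 * t * L"
  proof -
    have "?c - ?b = \<i> * of_real (- (2 * t * L))" by (simp add: complex_eq_iff)
    hence "norm (?c - ?b) = \<bar>2 * t * L\<bar>" by (simp only: norm_mult norm_ii norm_of_real abs_minus_cancel mult_1)
    thus ?thesis using L t by simp
  qed
  also have "?B * (2 * t * L) = 2 * t * (A1 * (decay_weight e q1 L * L powr e) + A2 * (decay_weight e q2 L * L powr e))"
  proof -
    have "L powr e = L powr (e - 1) * L" using L by (simp add: powr_diff)
    thus ?thesis by (simp add: algebra_simps)
  qed
  also have "\<dots> \<le> 2 * t * ?K"
    using decay_weight_peak q L A t by (intro mult_left_mono add_mono) auto
  also have "\<dots> \<le> 2 * t * (?K / e)"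
  proof -
    have "?K * e \<le> ?K * 1" using K0 e by (intro mult_left_mono) auto
    hence "?K \<le> ?K / e" using e by (simp add: pos_le_divide_eq)
    thus ?thesis using t by (intro mult_left_mono) auto
  qed
  finally have 2: "norm (contour_integral (linepath ?b ?c) f) \<le> 2 * t * (?K / e)" .
  have "norm I \<le> ?K / e + 2 * t * (?K / e) + ?K / e"
    unfolding Isum[symmetric] using 1 2 3 by (intro order_trans[OF norm_triangle_ineq] add_mono) auto
  also have "x + 2 * t * x + x = (2 + 2 * t) * x" for x by (simp add: algebra_simps)
  finally show ?thesis by simp
qed

section \<open>Maximum-norm bounds for functions of the difference operators\<close>

text \<open>The tuple of eigenvalues of \<open>a\<^sub>1 L\<^sub>1, \<dots>, a\<^sub>m L\<^sub>m\<close>, \<open>L\<^sub>j\<close> the second difference, that belongs to the sine mode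
  \<open>p\<close>.\<close>

definition eigen_point :: "(nat \<Rightarrow> real) \<Rightarrow> (nat \<Rightarrow> nat) \<Rightarrow> (nat \<Rightarrow> nat) \<Rightarrow> nat \<Rightarrow> complex" where
  "eigen_point a N p = (\<lambda>j. of_real (a j * eig1 (N j) (p j)))"

lemma eigen_point_bounds:
  assumes "p \<in> grid m N" "j \<in> {1..m}" "a j > 0"
  shows "- (4 * a j) < a j * eig1 (N j) (p j)" "a j * eig1 (N j) (p j) < 0"
  using eig1_bounds[OF grid_range[OF assms(1,2)]] assms(3)
    mult_strict_left_mono[of "- 4" "eig1 (N j) (p j)" "a j"]
  by (auto simp: mult_pos_neg)

text \<open>The two bounds \<open>M/\<bar>s\<bar>\<close> and \<open>1/\<delta>\<close> are interpolated. The factor \<open>\<delta> powr (- e)\<close> is the price for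
  integrability at \<open>0\<close>; for \<open>\<delta>\<close> of the size of the time step it is harmless
  if \<open>e\<close> is small.\<close>

lemma multiplier_resolvent_bound:
  assumes j: "j \<in> {1..m}" and a: "a j > 0" and L: "L \<ge> 8 * a j"
    and \<alpha>: "0 < \<alpha>" "\<alpha> < pi / 2" and e: "0 < e" "e \<le> 1"
    and \<delta>: "0 < \<delta>" "\<delta> \<le> 4 * a j / (real (N j) + 1)\<^sup>2"
    and s: "s \<in> path_image (triangle_path (tan \<alpha>) L)" "s \<noteq> 0"
    and V: "\<And>l. l \<in> grid m N \<Longrightarrow> norm (V l) \<le> B" and k: "k \<in> grid m N"
  shows "norm (multiplier m N (\<lambda>p. 1 / (s - eigen_point a N p j)) V k)
    \<le> B * (2 / (1 - cos \<alpha>) * \<delta> powr (- e)) * norm s powr (e - 1)"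
proof -
  have L0: "L > 0" using L a by linarith
  have t: "tan \<alpha> > 0" using \<alpha> by (intro tan_gt_zero) auto
  have cos0: "cos \<alpha> > 0" using \<alpha> by (intro cos_gt_zero) auto
  have cos1: "cos \<alpha> < 1" using \<alpha> cos_monotone_0_pi[of 0 \<alpha>] by simp
  have B: "B \<ge> 0" using V[OF k] norm_ge_zero[of "V k"] by linarith
  have ns: "norm s > 0" using s by simp
  have ne: "s \<noteq> of_real (a j * eig1 (N j) (p j))" if p: "p \<in> grid m N" for p
  proof
    assume e: "s = of_real (a j * eig1 (N j) (p j))"
    have b: "- L < a j * eig1 (N j) (p j)" "a j * eig1 (N j) (p j) < 0"
      using eigen_point_bounds[of p m N j a, OF p j a] L a by auto
    show False
      by (rule path_image_triangle_path_cases[OF s L0 t]) (use b t in \<open>auto simp: e\<close>)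
  qed
  let ?lhs = "norm (multiplier m N (\<lambda>p. 1 / (s - of_real (a j * eig1 (N j) (p j)))) V k)"
  define \<delta>' where "\<delta>' = 4 * a j / (real (N j) + 1)\<^sup>2"
  have \<delta>': "\<delta> \<le> \<delta>'" using \<delta> unfolding \<delta>'_def by simp
  have M: "2 / (1 - cos \<alpha>) \<ge> 1" using cos0 cos1 by (simp add: pos_le_divide_eq)
  have gap: "norm s + norm (s + 4 * of_real (a j)) - 4 * a j \<ge> norm s * (1 - cos \<alpha>)"
  proof (rule path_image_triangle_path_cases[OF s L0 t])
    assume r: "\<bar>Im s\<bar> = tan \<alpha> * - Re s" "- L \<le> Re s" "Re s < 0"
    have "norm s = - Re s / cos \<alpha>"
    proof -
      have "(norm s)\<^sup>2 = (Re s)\<^sup>2 + \<bar>Im s\<bar>\<^sup>2" by (simp add: cmod_power2)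
      also have "\<dots> = (Re s)\<^sup>2 * (1 + (tan \<alpha>)\<^sup>2)" unfolding r(1) by (simp add: power_mult_distrib algebra_simps)
      also have "1 + (tan \<alpha>)\<^sup>2 = (inverse (cos \<alpha>))\<^sup>2" using cos0 by (intro tan_sec) simp
      also have "(Re s)\<^sup>2 * (inverse (cos \<alpha>))\<^sup>2 = (Re s * inverse (cos \<alpha>))\<^sup>2" by (simp only: power_mult_distrib)
      also have "\<dots> = (- Re s / cos \<alpha>)\<^sup>2" by (simp add: divide_inverse)
      finally have "(norm s)\<^sup>2 = (- Re s / cos \<alpha>)\<^sup>2" .
      moreover have "0 \<le> - Re s / cos \<alpha>" using r(3) cos0 by (intro divide_nonneg_pos) linarith+
      ultimately show ?thesis by (rule power2_eq_imp_eq[OF _ norm_ge_zero])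
    qed
    hence "norm s * cos \<alpha> = - Re s" using cos0 by simp
    hence "Re s = - (norm s * cos \<alpha>)" by linarith
    moreover have "Re (s + 4 * of_real (a j)) \<le> norm (s + 4 * of_real (a j))" by (rule complex_Re_le_cmod)
    ultimately show ?thesis by (simp add: algebra_simps)
  next
    assume "Re s = - L"
    hence "8 * a j \<le> norm s" using abs_Re_le_cmod[of s] L L0 by simp
    moreover have "norm s - 4 * a j \<le> norm (s + 4 * of_real (a j))"
      using norm_triangle_ineq2[of s "- (4 * of_real (a j))"] a by (simp add: norm_mult)
    moreover have "norm s * (1 - cos \<alpha>) \<le> norm s * 1" using cos0 by (intro mult_left_mono) auto
    ultimately show ?thesis by linarith
  qed
  have gap0: "norm s * (1 - cos \<alpha>) > 0" using ns cos1 by simp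
  have big: "?lhs \<le> B * (2 / (1 - cos \<alpha>)) / norm s"
  proof -
    have "?lhs \<le> 2 * B / (norm s + norm (s + 4 * of_real (a j)) - 4 * a j)"
      by (rule multiplier_resolvent_bound_ellipse[OF k j a]) (use gap gap0 ne V in auto)
    also have "\<dots> \<le> 2 * B / (norm s * (1 - cos \<alpha>))"
    proof (rule divide_left_mono[OF gap])
      show "0 < (norm s + norm (s + 4 * of_real (a j)) - 4 * a j) * (norm s * (1 - cos \<alpha>))"
        using less_le_trans[OF gap0 gap] gap0 by (rule mult_pos_pos)
    qed (use B in simp)
    finally show ?thesis by (simp add: field_simps)
  qed
  have small: "?lhs \<le> B / \<delta>'" if "norm s \<le> \<delta>'"
  proof -
    have "?lhs \<le> B * (real (N j) + 1)\<^sup>2 / (4 * a j)"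
      by (rule multiplier_resolvent_bound_small[OF k j a]) (use that ne V in \<open>auto simp: \<delta>'_def\<close>)
    thus ?thesis unfolding \<delta>'_def by simp
  qed
  have split: "1 / y = y powr (- e) * y powr (e - 1)" if "y > 0" for y :: real
    using that by (simp add: powr_add[symmetric] powr_neg_one)
  have "?lhs \<le> B * (2 / (1 - cos \<alpha>) * \<delta> powr (- e)) * norm s powr (e - 1)"
  proof (cases "norm s \<le> \<delta>'")
    case True
    have "?lhs \<le> B * (1 / \<delta>')" using small[OF True] by simp
    also have "1 / \<delta>' = \<delta>' powr (- e) * \<delta>' powr (e - 1)"
      using \<delta> \<delta>' by (intro split) linarith
    also have "B * \<dots> \<le> B * (\<delta> powr (- e) * norm s powr (e - 1))"
      using B \<delta> \<delta>' e ns True by (intro mult_left_mono mult_mono powr_mono2') auto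
    also have "\<dots> = B * (1 * \<delta> powr (- e)) * norm s powr (e - 1)" by simp
    also have "\<dots> \<le> B * (2 / (1 - cos \<alpha>) * \<delta> powr (- e)) * norm s powr (e - 1)"
      using B M by (intro mult_right_mono mult_left_mono) auto
    finally show ?thesis .
  next
    case False
    have "1 / norm s = norm s powr (- e) * norm s powr (e - 1)"
      by (rule split[OF ns])
    also have "\<dots> \<le> \<delta> powr (- e) * norm s powr (e - 1)"
      using \<delta> \<delta>' e False by (intro mult_right_mono powr_mono2') auto
    finally have "B * (2 / (1 - cos \<alpha>)) * (1 / norm s) \<le> B * (2 / (1 - cos \<alpha>)) * (\<delta> powr (- e) * norm s powr (e - 1))"
      using B M by (intro mult_left_mono mult_nonneg_nonneg) auto
    thus ?thesis using big by (simp add: mult_ac)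
  qed
  thus ?thesis unfolding eigen_point_def .
qed

text \<open>Induction on the set of variables: in one variable \<open>F\<close> is written as a Cauchy integral, which
  turns the operator in that direction into a resolvent. For each fixed \<open>s\<close> on the contour the
  remaining function of fewer variables satisfies the same hypotheses with the factors of the variable
  \<open>j\<close> absorbed in \<open>c1\<close> and \<open>c2\<close>.\<close>

lemma multiplier_cauchy_bound:
  fixes J :: "nat set"
  assumes J: "finite J" "J \<subseteq> {1..m}" and L: "L > 0" and t: "t > 0"
    and e: "0 < e" "e \<le> 1" and q: "q1 > 0" "q2 > 0" and c: "c1 \<ge> 0" "c2 \<ge> 0"
    and x: "\<And>j p. j \<in> J \<Longrightarrow> p \<in> grid m N \<Longrightarrow> - L < a j * eig1 (N j) (p j) \<and> a j * eig1 (N j) (p j) < 0"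
    and \<rho>: "\<rho> \<ge> 0" and res: "\<And>j s V B k. j \<in> J \<Longrightarrow> s \<in> path_image (triangle_path t L) \<Longrightarrow> s \<noteq> 0 \<Longrightarrow>
        (\<And>l. l \<in> grid m N \<Longrightarrow> norm (V l) \<le> B) \<Longrightarrow> k \<in> grid m N \<Longrightarrow>
        norm (multiplier m N (\<lambda>p. 1 / (s - eigen_point a N p j)) V k) \<le> B * \<rho> * norm s powr (e - 1)"
    and dep: "\<And>z z'. (\<And>j. j \<in> J \<Longrightarrow> z j = z' j) \<Longrightarrow> F z = F z'"
    and hol: "\<And>j z. j \<in> J \<Longrightarrow> (\<lambda>s. F (z(j := s))) holomorphic_on {s. Re s < 1}"
    and bnd: "\<And>z. (\<And>j. j \<in> J \<Longrightarrow> z j \<in> path_image (triangle_path t L) - {0}) \<Longrightarrow>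
        norm (F z) \<le> c1 * (\<Prod>j\<in>J. decay_weight e q1 (norm (z j))) + c2 * (\<Prod>j\<in>J. decay_weight e q2 (norm (z j)))"
    and V: "\<And>l. l \<in> grid m N \<Longrightarrow> norm (V l) \<le> B" and k: "k \<in> grid m N"
  defines "\<kappa> \<equiv> \<rho> * ((2 + 2 * t) / e / (2 * pi))"
  shows "norm (multiplier m N (\<lambda>p. F (eigen_point a N p)) V k)
    \<le> (c1 * (\<kappa> * q1 powr (- e)) ^ card J + c2 * (\<kappa> * q2 powr (- e)) ^ card J) * B"
  using J x res dep hol bnd V k c
proof (induction J arbitrary: F c1 c2 V B k rule: finite_induct)
  case empty
  have "F z = F (\<lambda>_. 0)" for z using empty by blast
  hence "multiplier m N (\<lambda>p. F (eigen_point a N p)) V k = multiplier m N (\<lambda>p. F (\<lambda>_. 0) * 1) V k"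
    by (intro fun_cong[OF multiplier_cong]) auto
  also have "\<dots> = F (\<lambda>_. 0) * V k" unfolding multiplier_scale_fun multiplier_one[OF empty(8)] ..
  finally have "norm (multiplier m N (\<lambda>p. F (eigen_point a N p)) V k) = norm (F (\<lambda>_. 0)) * norm (V k)"
    by (simp add: norm_mult)
  also have "\<dots> \<le> (c1 + c2) * B"
    using empty(6)[of "\<lambda>_. 0"] empty(7)[OF empty(8)] empty(9,10) by (intro mult_mono) auto
  finally show ?case by simp
next
  case (insert j J)
  note V = insert.prems(7) and k = insert.prems(8) and c = insert.prems(9,10)
  have B: "B \<ge> 0" using V[OF k] norm_ge_zero[of "V k"] by linarith
  have \<kappa>0: "\<kappa> \<ge> 0" unfolding \<kappa>_def using \<rho> t e by (intro mult_nonneg_nonneg divide_nonneg_nonneg) auto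
  define cc where "cc p = of_real (sine m N p k) * (\<Sum>l\<in>grid m N. of_real (sine m N p l) * V l)" for p
  define G where "G s = (\<Sum>p\<in>grid m N. (F ((eigen_point a N p)(j := s)) / (s - eigen_point a N p j)) * cc p)" for s
  define A where "A c' q' = c' * (\<kappa> * q' powr (- e)) ^ card J * (B * \<rho>)" for c' q'
  have G: "(G has_contour_integral (2 * pi * \<i> * multiplier m N (\<lambda>p. F (eigen_point a N p)) V k)) (triangle_path t L)"
  proof -
    have "(G has_contour_integral (\<Sum>p\<in>grid m N. 2 * pi * \<i> * F (eigen_point a N p) * cc p)) (triangle_path t L)"
      unfolding G_def
    proof (intro has_contour_integral_sum finite_grid has_contour_integral_rmul)
      fix p assume p: "p \<in> grid m N"
      let ?x = "a j * eig1 (N j) (p j)"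
      have "- L < ?x" "?x < 0" using insert.prems(2)[of j p] p by auto
      from cauchy_formula_triangle_path[OF L t this, of "\<lambda>s. F ((eigen_point a N p)(j := s))"]
      have "((\<lambda>s. F ((eigen_point a N p)(j := s)) / (s - of_real ?x)) has_contour_integral
         2 * pi * \<i> * F ((eigen_point a N p)(j := of_real ?x))) (triangle_path t L)" using insert.prems(5)[of j] by simp
      moreover have "(eigen_point a N p)(j := of_real ?x) = eigen_point a N p" unfolding eigen_point_def by auto
      ultimately show "((\<lambda>s. F ((eigen_point a N p)(j := s)) / (s - eigen_point a N p j)) has_contour_integral
         2 * pi * \<i> * F (eigen_point a N p)) (triangle_path t L)" by (simp add: eigen_point_def)
    qed
    also have "(\<Sum>p\<in>grid m N. 2 * pi * \<i> * F (eigen_point a N p) * cc p) = 2 * pi * \<i> * multiplier m N (\<lambda>p. F (eigen_point a N p)) V k"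
      unfolding multiplier_def cc_def sum_distrib_left by (simp add: mult.assoc)
    finally show ?thesis .
  qed
  have Gb: "norm (G s) \<le> (A c1 q1 * decay_weight e q1 (norm s) + A c2 q2 * decay_weight e q2 (norm s)) * norm s powr (e - 1)"
    if s: "s \<in> path_image (triangle_path t L)" "s \<noteq> 0" for s
  proof -
    define W where "W = multiplier m N (\<lambda>p. 1 / (s - eigen_point a N p j)) V"
    have "G s = multiplier m N (\<lambda>p. F ((eigen_point a N p)(j := s)) * (1 / (s - eigen_point a N p j))) V k"
      unfolding G_def multiplier_def cc_def by simp
    also have "\<dots> = multiplier m N (\<lambda>p. F ((eigen_point a N p)(j := s))) W k"
      unfolding W_def multiplier_mult ..
    finally have Gs: "G s = multiplier m N (\<lambda>p. (\<lambda>z. F (z(j := s))) (eigen_point a N p)) W k" .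
    have "norm (G s) \<le> (c1 * decay_weight e q1 (norm s) * (\<kappa> * q1 powr (- e)) ^ card J
        + c2 * decay_weight e q2 (norm s) * (\<kappa> * q2 powr (- e)) ^ card J) * (B * \<rho> * norm s powr (e - 1))"
      unfolding Gs
    proof (rule insert.IH)
      show "J \<subseteq> {1..m}" using insert.prems(1) by auto
      show "- L < a i * eig1 (N i) (p i) \<and> a i * eig1 (N i) (p i) < 0" if "i \<in> J" "p \<in> grid m N" for i p
        using insert.prems(2) that by auto
      show "norm (multiplier m N (\<lambda>p. 1 / (s' - eigen_point a N p i)) V' k') \<le> B' * \<rho> * norm s' powr (e - 1)"
        if "i \<in> J" "s' \<in> path_image (triangle_path t L)" "s' \<noteq> 0" "\<And>l. l \<in> grid m N \<Longrightarrow> norm (V' l) \<le> B'" "k' \<in> grid m N" for i s' V' B' k'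
        using that by (intro insert.prems(3)) auto
      show "F (z(j := s)) = F (z'(j := s))" if "\<And>i. i \<in> J \<Longrightarrow> z i = z' i" for z z'
        using that by (intro insert.prems(4)) auto
      show "(\<lambda>s'. F ((z(i := s'))(j := s))) holomorphic_on {s. Re s < 1}" if i: "i \<in> J" for i z
      proof -
        have "i \<noteq> j" using i insert.hyps by auto
        hence twist: "(z(i := s'))(j := s) = (z(j := s))(i := s')" for s' by (rule fun_upd_twist)
        show ?thesis unfolding twist
          by (intro insert.prems(5)) (use i in simp)
      qed
      show "norm (F (z(j := s))) \<le> c1 * decay_weight e q1 (norm s) * (\<Prod>i\<in>J. decay_weight e q1 (norm (z i)))
          + c2 * decay_weight e q2 (norm s) * (\<Prod>i\<in>J. decay_weight e q2 (norm (z i)))"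
        if z: "\<And>i. i \<in> J \<Longrightarrow> z i \<in> path_image (triangle_path t L) - {0}" for z
      proof -
        have "norm (F (z(j := s))) \<le> c1 * (\<Prod>i\<in>insert j J. decay_weight e q1 (norm ((z(j := s)) i)))
          + c2 * (\<Prod>i\<in>insert j J. decay_weight e q2 (norm ((z(j := s)) i)))"
          using z s by (intro insert.prems(6)) auto
        moreover have "(\<Prod>i\<in>insert j J. decay_weight e q' (norm ((z(j := s)) i))) = decay_weight e q' (norm s) * (\<Prod>i\<in>J. decay_weight e q' (norm (z i)))" for q'
          using insert.hyps by (auto intro!: prod.cong)
        ultimately show ?thesis by (simp add: mult.assoc)
      qed
      show "norm (W l) \<le> B * \<rho> * norm s powr (e - 1)" if "l \<in> grid m N" for l
        unfolding W_def using s V that by (intro insert.prems(3)) auto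
    qed (use k c decay_weight_nonneg in auto)
    thus ?thesis unfolding A_def by (simp add: algebra_simps)
  qed
  have A0: "A c' q' \<ge> 0" if "c' \<ge> 0" for c' q' unfolding A_def using that B \<rho> \<kappa>0 by auto
  have "norm (2 * pi * \<i> * multiplier m N (\<lambda>p. F (eigen_point a N p)) V k)
     \<le> (2 + 2 * t) / e * (A c1 q1 * q1 powr (- e) + A c2 q2 * q2 powr (- e))"
    using A0 c by (intro triangle_path_integral_bound[OF G L t e q _ _ Gb]) auto
  hence bound: "2 * pi * norm (multiplier m N (\<lambda>p. F (eigen_point a N p)) V k) 
     \<le> (2 + 2 * t) / e * (A c1 q1 * q1 powr (- e) + A c2 q2 * q2 powr (- e))" by (simp add: norm_mult)
  have "2 * pi * x \<le> y \<Longrightarrow> x \<le> y / (2 * pi)" for x y :: real by (simp add: pos_le_divide_eq mult.commute)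
  from this[OF bound] have "norm (multiplier m N (\<lambda>p. F (eigen_point a N p)) V k)
     \<le> (2 + 2 * t) / e * (A c1 q1 * q1 powr (- e) + A c2 q2 * q2 powr (- e)) / (2 * pi)" .
  also have "\<dots> = (c1 * (\<kappa> * q1 powr (- e)) ^ card J * (\<kappa> * q1 powr (- e)) + c2 * (\<kappa> * q2 powr (- e)) ^ card J * (\<kappa> * q2 powr (- e))) * B"
  proof -
    have "\<rho> * ((2 + 2 * t) / e) / (2 * pi) = \<kappa>" unfolding \<kappa>_def by simp
    hence "(2 + 2 * t) / e * (A c' q' * q' powr (- e)) / (2 * pi) = c' * (\<kappa> * q' powr (- e)) ^ card J * (\<kappa> * q' powr (- e)) * B" for c' q'
      unfolding A_def by (simp add: mult_ac flip: times_divide_eq_right times_divide_eq_left)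
    thus ?thesis unfolding distrib_left add_divide_distrib by (simp add: algebra_simps)
  qed
  finally show ?case using insert.hyps by (simp add: mult_ac)
qed

abbreviation mesh_coeff :: "real \<Rightarrow> (nat \<Rightarrow> real) \<Rightarrow> (nat \<Rightarrow> nat) \<Rightarrow> nat \<Rightarrow> real" where
  "mesh_coeff \<tau> \<beta> N \<equiv> (\<lambda>j. \<tau> * \<beta> j / (dx N j)\<^sup>2)"

lemma douglas_inv_upd:
  assumes "finite J" "j \<in> J"
  shows "douglas_inv J (z(j := s)) = inverse (1 - s / 2) * douglas_inv (J - {j}) z"
  unfolding douglas_inv_def using assms by (subst prod.remove[of _ j]) (auto intro!: prod.cong)

lemma douglas_power_holomorphic:
  assumes "finite J" "j \<in> J"
  shows "(\<lambda>s. douglas_symbol J (z(j := s)) ^ k * douglas_inv J (z(j := s))) holomorphic_on {s. Re s < 1}"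
proof -
  have sum: "(\<Sum>i\<in>J. (z(j := s)) i) = s + (\<Sum>i\<in>J - {j}. z i)" for s
    using assms by (subst sum.remove[of _ j]) (auto intro!: sum.cong)
  have ne: "1 - s / 2 \<noteq> 0" if "Re s < 1" for s :: complex
  proof
    assume "1 - s / 2 = 0"
    hence "s = 2" by (simp add: field_simps)
    thus False using that by simp
  qed
  show ?thesis unfolding douglas_symbol_def douglas_inv_upd[OF assms] sum
    using ne by (intro holomorphic_intros) auto
qed

lemma douglas_symbol_cong: "(\<And>j. j \<in> J \<Longrightarrow> z j = z' j) \<Longrightarrow> douglas_symbol J z = douglas_symbol J z'"
  unfolding douglas_symbol_def douglas_inv_def by simp

lemma douglas_inv_cong: "(\<And>j. j \<in> J \<Longrightarrow> z j = z' j) \<Longrightarrow> douglas_inv J z = douglas_inv J z'"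
  unfolding douglas_inv_def by simp

text \<open>The opening angle comes from \<open>symbol_power_bound\<close>. With \<open>e = 1/(4m)\<close> each of the \<open>m\<close> contour integrals
  contributes \<open>(\<tau> q) powr (- e)\<close>, so that all of them together contribute the power \<open>-1/4\<close>.\<close>

lemma douglas_stability:
  assumes m: "m \<ge> 1" and \<beta>: "\<forall>j\<in>{1..m}. \<beta> j > 0"
  shows "\<exists>C\<ge>0. \<forall>N \<tau> k V B l. \<tau> > 0 \<longrightarrow> (\<forall>l\<in>grid m N. norm (V l) \<le> B) \<longrightarrow> l \<in> grid m N \<longrightarrow>
    norm (multiplier m N (\<lambda>p. douglas_symbol {1..m} (eigen_point (mesh_coeff \<tau> \<beta> N) N p) ^ k
        * douglas_inv {1..m} (eigen_point (mesh_coeff \<tau> \<beta> N) N p)) V l)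
     \<le> C * ((real k + 1) * \<tau>) powr (- (1/4)) * B"
proof -
  \<comment> \<open>the largest angle that \<open>symbol_power_bound\<close> admits for \<open>m\<close> directions\<close>
  define \<alpha> where "\<alpha> = pi / (3 * (real m + 1))"
  define e where "e = 1 / (4 * real m)"
  define b where "b = Min (\<beta> ` {1..m})"
  define M where "M = 2 / (1 - cos \<alpha>)"
  define t where "t = tan \<alpha>"
  define K where "K = M * ((2 + 2 * t) / e / (2 * pi))"
  define c1 :: real where "c1 = 2 ^ m * (12 * 4 ^ m) ^ m"
  define c2 :: real where "c2 = 6 * 8 ^ m"
  have b: "b > 0" "\<And>j. j \<in> {1..m} \<Longrightarrow> b \<le> \<beta> j" unfolding b_def using \<beta> m by auto
  have e: "0 < e" "e \<le> 1/4" "e * real m = 1/4" unfolding e_def using m by (auto simp: field_simps)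
  have \<alpha>: "0 < \<alpha>" unfolding \<alpha>_def by simp
  have \<alpha>m: "real (card {1..m} + 1) * \<alpha> \<le> pi / 3" unfolding \<alpha>_def by (simp add: field_simps)
  have "\<alpha> \<le> pi / (3 * 2)" unfolding \<alpha>_def using m by (intro divide_left_mono mult_left_mono) auto
  hence \<alpha>2: "\<alpha> < pi / 2" using pi_gt_zero by linarith
  have t: "t > 0" unfolding t_def using \<alpha> \<alpha>2 by (intro tan_gt_zero) auto
  have "cos \<alpha> < 1" using \<alpha> \<alpha>2 cos_monotone_0_pi[of 0 \<alpha>] by simp
  hence M: "M > 0" unfolding M_def by simp
  have K: "K \<ge> 0" unfolding K_def using M t e by (intro mult_nonneg_nonneg divide_nonneg_nonneg) auto
  define C where "C = (c1 + c2) * K ^ m * (2 * b) powr (- (1/4))"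
  have C0: "C \<ge> 0" unfolding C_def c1_def c2_def using K by simp
  show ?thesis
  proof (intro exI[of _ C] conjI C0 allI impI)
    fix N and \<tau> :: real and k :: nat and V :: "(nat \<Rightarrow> nat) \<Rightarrow> complex" and B l
    assume \<tau>: "\<tau> > 0" and V: "\<forall>l\<in>grid m N. norm (V l) \<le> B" and l: "l \<in> grid m N"
    let ?a = "mesh_coeff \<tau> \<beta> N"
    let ?F = "\<lambda>z. douglas_symbol {1..m} z ^ k * douglas_inv {1..m} z"
    define \<rho> where "\<rho> = M * (4 * \<tau> * b) powr (- e)"
    \<comment> \<open>the spectrum in direction \<open>j\<close> lies in \<open>(-4 a\<^sub>j, 0)\<close>; the factor 8 keeps the vertical side away from it\<close>
    define L where "L = 8 * (\<Sum>j\<in>{1..m}. ?a j)"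
    define q1 where "q1 = (real k + 1) / 2"
    have B: "B \<ge> 0" using V l norm_ge_zero[of "V l"] by (meson order_trans)
    have dx0: "dx N j > 0" for j unfolding dx_def by simp
    have a: "?a j > 0" if "j \<in> {1..m}" for j using \<beta> \<tau> dx0[of j] that by simp
    have La: "8 * ?a j \<le> L" if "j \<in> {1..m}" for j
      unfolding L_def using that a less_imp_le[OF a] by (intro mult_left_mono member_le_sum) auto
    have L: "L > 0" using La[of 1] a[of 1] m by simp
    have \<rho>0: "\<rho> \<ge> 0" unfolding \<rho>_def using M by simp
    have \<delta>: "4 * \<tau> * b \<le> 4 * ?a j / (real (N j) + 1)\<^sup>2" if "j \<in> {1..m}" for j
    proof -
      have "4 * ?a j / (real (N j) + 1)\<^sup>2 = 4 * \<tau> * \<beta> j" unfolding dx_def by (simp add: field_simps)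
      thus ?thesis using b(2)[OF that] \<tau> by simp
    qed
    have "norm (multiplier m N (\<lambda>p. ?F (eigen_point ?a N p)) V l)
      \<le> (c1 * (\<rho> * ((2 + 2 * t) / e / (2 * pi)) * q1 powr (- e)) ^ card {1..m}
        + c2 * (real k + 1) powr (- (1/4)) * (\<rho> * ((2 + 2 * t) / e / (2 * pi)) * (1/2) powr (- e)) ^ card {1..m}) * B"
    proof (rule multiplier_cauchy_bound[where L = L])
      show "- L < ?a j * eig1 (N j) (p j) \<and> ?a j * eig1 (N j) (p j) < 0"
        if "j \<in> {1..m}" "p \<in> grid m N" for j p
        using eigen_point_bounds[of p m N j ?a, OF that(2,1) a[OF that(1)]] La[OF that(1)] a[OF that(1)] by linarith
      show "norm (multiplier m N (\<lambda>p. 1 / (s - eigen_point ?a N p j)) V' k') \<le> B' * \<rho> * norm s powr (e - 1)"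
        if "j \<in> {1..m}" "s \<in> path_image (triangle_path t L)" "s \<noteq> 0" "\<And>l. l \<in> grid m N \<Longrightarrow> norm (V' l) \<le> B'" "k' \<in> grid m N" for j s V' B' k'
        unfolding \<rho>_def M_def
        by (rule multiplier_resolvent_bound[where L = L and \<delta> = "4 * \<tau> * b"])
          (use that a La \<alpha> \<alpha>2 e \<tau> b \<delta> in \<open>auto simp: t_def\<close>)
      show "?F z = ?F z'" if "\<And>j. j \<in> {1..m} \<Longrightarrow> z j = z' j" for z z'
        by (intro arg_cong2[where f = times] arg_cong[where f = "\<lambda>x. x ^ k"] douglas_symbol_cong douglas_inv_cong that)
      show "(\<lambda>s. ?F (z(j := s))) holomorphic_on {s. Re s < 1}" if "j \<in> {1..m}" for j z
        by (rule douglas_power_holomorphic) (use that in auto)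
      show "norm (?F z) \<le> c1 * (\<Prod>j\<in>{1..m}. decay_weight e q1 (norm (z j)))
          + c2 * (real k + 1) powr (- (1/4)) * (\<Prod>j\<in>{1..m}. decay_weight e (1/2) (norm (z j)))"
        if z: "\<And>j. j \<in> {1..m} \<Longrightarrow> z j \<in> path_image (triangle_path t L) - {0}" for z
      proof -
        have "\<bar>Im (z j)\<bar> \<le> tan \<alpha> * - Re (z j)" if "j \<in> {1..m}" for j
          using triangle_path_sector(1)[of "z j" t L] z[OF that] L t unfolding t_def by auto
        from symbol_power_bound[OF _ _ \<alpha> \<alpha>m this e(1,2)] show ?thesis
          unfolding decay_weight_def q1_def c1_def c2_def using m by simp
      qed
    qed (use \<rho>0 L t e V l in \<open>auto simp: q1_def c1_def c2_def\<close>)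
    also have "\<dots> = C * ((real k + 1) * \<tau>) powr (- (1/4)) * B"
    proof -
      have pw: "(x powr (- e)) ^ m = x powr (- (1/4))" if "x > 0" for x
      proof -
        have "(x powr (- e)) ^ m = (x powr (- e)) powr real m" using that by (subst powr_realpow) auto
        also have "\<dots> = x powr (- e * real m)" by (rule powr_powr)
        also have "- e * real m = - (1/4)" using e(3) by simp
        finally show ?thesis .
      qed
      have main: "(\<rho> * ((2 + 2 * t) / e / (2 * pi)) * q powr (- e)) ^ m = K ^ m * (2 * b) powr (- (1/4)) * (2 * q * \<tau>) powr (- (1/4))"
        if q: "q > 0" for q
      proof -
        have "\<rho> * ((2 + 2 * t) / e / (2 * pi)) * q powr (- e) = K * (4 * \<tau> * b * q) powr (- e)"
          unfolding \<rho>_def K_def by (simp add: powr_mult)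
        also have "\<dots> ^ m = K ^ m * (4 * \<tau> * b * q) powr (- (1/4))"
          using q \<tau> b by (subst power_mult_distrib, subst pw) auto
        also have "4 * \<tau> * b * q = (2 * b) * (2 * q * \<tau>)" by simp
        also have "((2 * b) * (2 * q * \<tau>)) powr (- (1/4)) = (2 * b) powr (- (1/4)) * (2 * q * \<tau>) powr (- (1/4))"
          by (rule powr_mult)
        finally show ?thesis by (simp add: mult.assoc)
      qed
      have 1: "2 * q1 * \<tau> = (real k + 1) * \<tau>" unfolding q1_def by simp
      have 2: "((real k + 1) * \<tau>) powr (- (1/4)) = (real k + 1) powr (- (1/4)) * \<tau> powr (- (1/4))" by (rule powr_mult)
      have "q1 > 0" unfolding q1_def by simp
      from main[OF this] main[of "1/2"] show ?thesis
        unfolding C_def 1 2 by (simp add: algebra_simps)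
    qed
    finally show "norm (multiplier m N (\<lambda>p. ?F (eigen_point ?a N p)) V l) \<le> C * ((real k + 1) * \<tau>) powr (- (1/4)) * B" .
  qed
qed


section \<open>The error recursion\<close>

text \<open>The operator \<open>I - A\<^sub>j/2\<close> that is inverted in stage \<open>j\<close>.\<close>

definition stage_op :: "nat \<Rightarrow> (nat \<Rightarrow> real) \<Rightarrow> (nat \<Rightarrow> nat) \<Rightarrow> real \<Rightarrow> nat \<Rightarrow> gridfun \<Rightarrow> gridfun" where
  "stage_op m \<beta> N \<tau> j V = (\<lambda>k. V k - \<tau> / 2 * Dj m \<beta> N j V k)"

lemma Dj_lin: "Dj m \<beta> N j (\<lambda>k. a * V k + b * W k) = (\<lambda>k. a * Dj m \<beta> N j V k + b * Dj m \<beta> N j W k)"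
  unfolding Dj_def by (auto simp: sum.distrib sum_distrib_left algebra_simps)

lemma Dj_diff: "Dj m \<beta> N j (\<lambda>k. V k - W k) = (\<lambda>k. Dj m \<beta> N j V k - Dj m \<beta> N j W k)"
  using Dj_lin[of m \<beta> N j 1 V "-1" W] by simp

lemma Dsum_diff: "Dsum m \<beta> N (\<lambda>k. V k - W k) = (\<lambda>k. Dsum m \<beta> N V k - Dsum m \<beta> N W k)"
  unfolding Dsum_def Dj_diff by (simp add: sum_subtractf)

lemma stage_ops_lin:
  "foldr (stage_op m \<beta> N \<tau>) xs (\<lambda>k. a * V k + b * W k)
    = (\<lambda>k. a * foldr (stage_op m \<beta> N \<tau>) xs V k + b * foldr (stage_op m \<beta> N \<tau>) xs W k)"
proof (induction xs)
  case (Cons x xs)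
  show ?case unfolding foldr_Cons o_apply Cons.IH unfolding stage_op_def Dj_lin by (simp add: algebra_simps)
qed simp

lemma stage_ops_cong:
  assumes "\<And>l. l \<in> grid m N \<Longrightarrow> V l = W l" "k \<in> grid m N"
  shows "foldr (stage_op m \<beta> N \<tau>) xs V k = foldr (stage_op m \<beta> N \<tau>) xs W k"
  using assms(2)
proof (induction xs arbitrary: k)
  case (Cons x xs)
  have "Dj m \<beta> N x (foldr (stage_op m \<beta> N \<tau>) xs V) = Dj m \<beta> N x (foldr (stage_op m \<beta> N \<tau>) xs W)"
    using Cons.IH by (intro Dj_cong)
  thus ?case using Cons unfolding stage_op_def by simp
qed (use assms in simp)

lemma stage_op_multiplier:
  assumes k: "k \<in> grid m N" and j: "j \<in> {1..m}"
  shows "complex_of_real (stage_op m \<beta> N \<tau> j V k)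
    = multiplier m N (\<lambda>p. 1 - eigen_point (mesh_coeff \<tau> \<beta> N) N p j / 2) (\<lambda>l. of_real (V l)) k"
proof -
  have e: "of_real (\<tau> / 2) * of_real (\<beta> j / (dx N j)\<^sup>2 * eig1 (N j) (p j)) = eigen_point (mesh_coeff \<tau> \<beta> N) N p j / 2" for p
    unfolding eigen_point_def by (simp add: mult_ac)
  have "complex_of_real (stage_op m \<beta> N \<tau> j V k) = of_real (V k) - of_real (\<tau> / 2) * complex_of_real (Dj m \<beta> N j V k)"
    unfolding stage_op_def by simp
  also have "\<dots> = multiplier m N (\<lambda>_. 1) (\<lambda>l. of_real (V l)) k
      - multiplier m N (\<lambda>p. of_real (\<tau> / 2) * of_real (\<beta> j / (dx N j)\<^sup>2 * eig1 (N j) (p j))) (\<lambda>l. of_real (V l)) k"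
    unfolding Dj_eq_multiplier[OF k j] multiplier_one[OF k] multiplier_scale_fun ..
  also have "\<dots> = multiplier m N (\<lambda>p. 1 - of_real (\<tau> / 2) * of_real (\<beta> j / (dx N j)\<^sup>2 * eig1 (N j) (p j))) (\<lambda>l. of_real (V l)) k"
    by (rule multiplier_diff_fun[symmetric])
  finally show ?thesis unfolding e .
qed

lemma stage_ops_multiplier:
  assumes "k \<in> grid m N" "set xs \<subseteq> {1..m}"
  shows "complex_of_real (foldr (stage_op m \<beta> N \<tau>) xs V k)
    = multiplier m N (\<lambda>p. \<Prod>j\<leftarrow>xs. 1 - eigen_point (mesh_coeff \<tau> \<beta> N) N p j / 2) (\<lambda>l. of_real (V l)) k"
  using assms
proof (induction xs arbitrary: k)
  case Nil thus ?case by (simp add: multiplier_one)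
next
  case (Cons x xs)
  let ?z = "\<lambda>p j. 1 - eigen_point (mesh_coeff \<tau> \<beta> N) N p j / 2"
  have "complex_of_real (foldr (stage_op m \<beta> N \<tau>) (x # xs) V k)
     = multiplier m N (\<lambda>p. ?z p x) (\<lambda>l. of_real (foldr (stage_op m \<beta> N \<tau>) xs V l)) k"
    using Cons.prems by (simp add: stage_op_multiplier)
  also have "\<dots> = multiplier m N (\<lambda>p. ?z p x) (multiplier m N (\<lambda>p. \<Prod>j\<leftarrow>xs. ?z p j) (\<lambda>l. of_real (V l))) k"
    using Cons by (intro fun_cong[OF multiplier_cong]) auto
  finally show ?case unfolding multiplier_mult by simp
qed

text \<open>All eigenvalues are negative, so no factor \<open>1 - z\<^sub>j/2\<close> vanishes.\<close>

lemma multiplier_inv_stage_ops: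
  assumes k: "k \<in> grid m N" and \<beta>: "\<forall>j\<in>{1..m}. \<beta> j > 0" and \<tau>: "\<tau> > 0"
  shows "multiplier m N (\<lambda>p. douglas_inv {1..m} (eigen_point (mesh_coeff \<tau> \<beta> N) N p))
      (\<lambda>l. of_real (foldr (stage_op m \<beta> N \<tau>) [1..<Suc m] V l)) k = complex_of_real (V k)"
proof -
  let ?z = "\<lambda>p. eigen_point (mesh_coeff \<tau> \<beta> N) N p"
  have "multiplier m N (\<lambda>p. douglas_inv {1..m} (?z p)) (\<lambda>l. of_real (foldr (stage_op m \<beta> N \<tau>) [1..<Suc m] V l))
     = multiplier m N (\<lambda>p. douglas_inv {1..m} (?z p)) (multiplier m N (\<lambda>p. \<Prod>j\<leftarrow>[1..<Suc m]. 1 - ?z p j / 2) (\<lambda>l. of_real (V l)))"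
    by (intro multiplier_cong refl stage_ops_multiplier) auto
  also have "\<dots> = multiplier m N (\<lambda>_. 1) (\<lambda>l. of_real (V l))"
    unfolding multiplier_mult
  proof (rule multiplier_cong)
    fix p assume p: "p \<in> grid m N"
    have ne: "1 - ?z p j / 2 \<noteq> 0" if j: "j \<in> {1..m}" for j
    proof -
      have "mesh_coeff \<tau> \<beta> N j > 0" using \<beta> \<tau> j by (simp add: dx_def)
      hence "mesh_coeff \<tau> \<beta> N j * eig1 (N j) (p j) < 0" by (rule eigen_point_bounds(2)[of p m N j "mesh_coeff \<tau> \<beta> N", OF p j])
      moreover have "x < 0 \<Longrightarrow> 1 - x / 2 \<noteq> 0" for x :: real by simp
      ultimately have "1 - mesh_coeff \<tau> \<beta> N j * eig1 (N j) (p j) / 2 \<noteq> 0" by blast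
      moreover have "1 - ?z p j / 2 = of_real (1 - mesh_coeff \<tau> \<beta> N j * eig1 (N j) (p j) / 2)" unfolding eigen_point_def by simp
      ultimately show ?thesis by (metis of_real_eq_0_iff)
    qed
    have "(\<Prod>j\<leftarrow>[1..<Suc m]. 1 - ?z p j / 2) = (\<Prod>j\<in>set [1..<Suc m]. 1 - ?z p j / 2)"
      by (rule prod.distinct_set_conv_list[symmetric]) simp
    also have "set [1..<Suc m] = {1..m}" by auto
    finally have "douglas_inv {1..m} (?z p) * (\<Prod>j\<leftarrow>[1..<Suc m]. 1 - ?z p j / 2) = (\<Prod>j\<in>{1..m}. inverse (1 - ?z p j / 2) * (1 - ?z p j / 2))"
      unfolding douglas_inv_def prod.distrib by simp
    also have "\<dots> = (\<Prod>j\<in>{1..m}. 1)" using ne by (intro prod.cong) auto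
    finally show "douglas_inv {1..m} (?z p) * (\<Prod>j\<leftarrow>[1..<Suc m]. 1 - ?z p j / 2) = 1" by simp
  qed simp
  finally show ?thesis using multiplier_one[OF k] by simp
qed

text \<open>Stage \<open>i\<close> reads \<open>(I - A\<^sub>i/2) x\<^sub>i = x\<^sub>i\<^sub>-\<^sub>1 + \<tau>/2 d\<^sub>i\<close> for the difference \<open>x\<^sub>i\<close> of the stage error and the
  old error. Applying the earlier factors to it telescopes, and after the last stage all factors are inverted
  at once.\<close>

lemma douglas_error_step:
  assumes step: "douglas_step m \<beta> N g (1/2) \<tau> t t' V V'" and k: "k \<in> grid m N"
    and \<beta>: "\<forall>j\<in>{1..m}. \<beta> j > 0" and \<tau>: "\<tau> > 0"
    and d: "d = (\<lambda>j k. (Dj m \<beta> N j U' k + g j t' k) - (Dj m \<beta> N j U k + g j t k))"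
    and \<eta>: "\<eta> = (\<lambda>k. U k - U' k + \<tau> * (Dsum m \<beta> N U k + gsum m g t k)
        + \<tau> / 2 * (\<Sum>j\<in>{1..m}. foldr (stage_op m \<beta> N \<tau>) [1..<j] (d j) k))"
  shows "complex_of_real ((V' k - U' k) - (V k - U k))
    = multiplier m N (\<lambda>p. douglas_inv {1..m} (eigen_point (mesh_coeff \<tau> \<beta> N) N p))
        (\<lambda>k. of_real (\<tau> * Dsum m \<beta> N (\<lambda>k. V k - U k) k + \<eta> k)) k"
proof -
  let ?S = "foldr (stage_op m \<beta> N \<tau>)"
  obtain v where v0: "\<And>k. k \<in> grid m N \<Longrightarrow> v 0 k = V k + \<tau> * (Dsum m \<beta> N V k + gsum m g t k)"
    and vi: "\<And>i k. i \<in> {1..m} \<Longrightarrow> k \<in> grid m N \<Longrightarrow> v i k = v (i - 1) k +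
           1/2 * \<tau> * ((Dj m \<beta> N i (v i) k + g i t' k) - (Dj m \<beta> N i V k + g i t k))"
    and vm: "\<And>k. k \<in> grid m N \<Longrightarrow> V' k = v m k"
    using step unfolding douglas_step_def by blast
  define x where "x i k = (v i k - U' k) - (V k - U k)" for i k
  have x0: "x 0 k = \<tau> * Dsum m \<beta> N (\<lambda>k. V k - U k) k + (U k - U' k + \<tau> * (Dsum m \<beta> N U k + gsum m g t k))"
    if "k \<in> grid m N" for k
    unfolding x_def v0[OF that] Dsum_diff by (simp add: algebra_simps)
  have xi: "stage_op m \<beta> N \<tau> i (x i) k = 1 * x (i - 1) k + \<tau> / 2 * d i k" if i: "i \<in> {1..m}" and k: "k \<in> grid m N" for i k
  proof -
    have A: "Dj m \<beta> N i (x i) k = (Dj m \<beta> N i (v i) k - Dj m \<beta> N i U' k) - (Dj m \<beta> N i V k - Dj m \<beta> N i U k)"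
      unfolding x_def Dj_diff ..
    show ?thesis unfolding stage_op_def A d
      by (simp add: x_def[of i k] x_def[of "i - Suc 0" k] vi[OF i k] field_simps)
  qed
  have tele: "?S [1..<Suc i] (x i) k = x 0 k + \<tau> / 2 * (\<Sum>j\<in>{1..i}. ?S [1..<j] (d j) k)"
    if "i \<le> m" "k \<in> grid m N" for i k
    using that
  proof (induction i)
    case (Suc i)
    have "?S [1..<Suc (Suc i)] (x (Suc i)) k = ?S [1..<Suc i] (stage_op m \<beta> N \<tau> (Suc i) (x (Suc i))) k" by simp
    also have "\<dots> = ?S [1..<Suc i] (\<lambda>k. 1 * x i k + \<tau> / 2 * d (Suc i) k) k"
    proof (rule stage_ops_cong)
      fix l assume "l \<in> grid m N"
      thus "stage_op m \<beta> N \<tau> (Suc i) (x (Suc i)) l = 1 * x i l + \<tau> / 2 * d (Suc i) l"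
        using xi[of "Suc i" l] Suc.prems by simp
    qed (rule Suc.prems)
    also have "\<dots> = ?S [1..<Suc i] (x i) k + \<tau> / 2 * ?S [1..<Suc i] (d (Suc i)) k"
      unfolding stage_ops_lin by simp
    finally show ?case using Suc by (simp add: algebra_simps del: upt_Suc)
  qed simp
  have full: "?S [1..<Suc m] (x m) k = \<tau> * Dsum m \<beta> N (\<lambda>k. V k - U k) k + \<eta> k" if "k \<in> grid m N" for k
    using tele[OF order_refl that] x0[OF that] unfolding \<eta> by simp
  have "complex_of_real ((V' k - U' k) - (V k - U k)) = of_real (x m k)"
    unfolding x_def vm[OF k] ..
  also have "\<dots> = multiplier m N (\<lambda>p. douglas_inv {1..m} (eigen_point (mesh_coeff \<tau> \<beta> N) N p))
        (\<lambda>l. of_real (?S [1..<Suc m] (x m) l)) k"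
    by (rule multiplier_inv_stage_ops[OF k \<beta> \<tau>, symmetric])
  also have "\<dots> = multiplier m N (\<lambda>p. douglas_inv {1..m} (eigen_point (mesh_coeff \<tau> \<beta> N) N p))
        (\<lambda>k. of_real (\<tau> * Dsum m \<beta> N (\<lambda>k. V k - U k) k + \<eta> k)) k"
    using full by (intro fun_cong[OF multiplier_cong]) (simp_all del: upt_Suc)
  finally show ?thesis .
qed

lemma Dsum_multiplier:
  assumes k: "k \<in> grid m N"
  shows "complex_of_real (\<tau> * Dsum m \<beta> N W k)
    = multiplier m N (\<lambda>p. \<Sum>j\<in>{1..m}. eigen_point (mesh_coeff \<tau> \<beta> N) N p j) (\<lambda>l. of_real (W l)) k"
proof -
  have "complex_of_real (\<tau> * Dsum m \<beta> N W k) = (\<Sum>j\<in>{1..m}. of_real \<tau> * complex_of_real (Dj m \<beta> N j W k))"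
    unfolding Dsum_def by (simp add: sum_distrib_left)
  also have "\<dots> = (\<Sum>j\<in>{1..m}. multiplier m N (\<lambda>p. eigen_point (mesh_coeff \<tau> \<beta> N) N p j) (\<lambda>l. of_real (W l)) k)"
  proof (intro sum.cong refl)
    fix j assume j: "j \<in> {1..m}"
    have e: "of_real \<tau> * of_real (\<beta> j / (dx N j)\<^sup>2 * eig1 (N j) (p j)) = eigen_point (mesh_coeff \<tau> \<beta> N) N p j" for p
      unfolding eigen_point_def by (simp add: mult_ac)
    show "of_real \<tau> * complex_of_real (Dj m \<beta> N j W k) = multiplier m N (\<lambda>p. eigen_point (mesh_coeff \<tau> \<beta> N) N p j) (\<lambda>l. of_real (W l)) k"
      unfolding Dj_eq_multiplier[OF k j] multiplier_scale_fun[symmetric] e ..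
  qed
  finally show ?thesis unfolding multiplier_sum_fun .
qed

text \<open>The recursion is that of \<open>E n - E 0\<close>, which starts from \<open>0\<close>; the price is the additional source
  \<open>\<tau> D (E 0)\<close>.\<close>

lemma error_representation:
  assumes rec: "\<And>n k. n < M \<Longrightarrow> k \<in> grid m N \<Longrightarrow> complex_of_real (E (Suc n) k - E n k)
     = multiplier m N (\<lambda>p. douglas_inv {1..m} (eigen_point (mesh_coeff \<tau> \<beta> N) N p))
        (\<lambda>k. of_real (\<tau> * Dsum m \<beta> N (E n) k + \<eta> n k)) k"
    and n: "n \<le> M" and k: "k \<in> grid m N"
  shows "complex_of_real (E n k - E 0 k) = (\<Sum>i<n. multiplier m N
      (\<lambda>p. douglas_symbol {1..m} (eigen_point (mesh_coeff \<tau> \<beta> N) N p) ^ i * douglas_inv {1..m} (eigen_point (mesh_coeff \<tau> \<beta> N) N p))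
      (\<lambda>k. of_real (\<tau> * Dsum m \<beta> N (E 0) k + \<eta> (n - 1 - i) k)) k)"
  using n k
proof (induction n arbitrary: k)
  case (Suc n)
  let ?z = "eigen_point (mesh_coeff \<tau> \<beta> N) N"
  let ?R = "\<lambda>p. douglas_symbol {1..m} (?z p)" and ?Q = "\<lambda>p. douglas_inv {1..m} (?z p)"
  let ?w = "\<lambda>n k. complex_of_real (\<tau> * Dsum m \<beta> N (E 0) k + \<eta> n k)"
  define F where "F k = complex_of_real (E n k - E 0 k)" for k
  have F: "F k = (\<Sum>i<n. multiplier m N (\<lambda>p. ?R p ^ i * ?Q p) (?w (n - 1 - i)) k)" if "k \<in> grid m N" for k
    unfolding F_def using Suc that by simp
  have split: "complex_of_real (\<tau> * Dsum m \<beta> N (E n) l + \<eta> n l)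
      = multiplier m N (\<lambda>p. \<Sum>j\<in>{1..m}. ?z p j) F l + ?w n l" if "l \<in> grid m N" for l
  proof -
    have "multiplier m N (\<lambda>p. \<Sum>j\<in>{1..m}. ?z p j) F l = complex_of_real (\<tau> * Dsum m \<beta> N (\<lambda>k. E n k - E 0 k) l)"
      unfolding Dsum_multiplier[OF that] F_def ..
    thus ?thesis unfolding Dsum_diff by (simp add: algebra_simps)
  qed
  have "complex_of_real (E (Suc n) k - E 0 k) = F k + complex_of_real (E (Suc n) k - E n k)"
    unfolding F_def by simp
  also have "complex_of_real (E (Suc n) k - E n k)
     = multiplier m N ?Q (\<lambda>l. multiplier m N (\<lambda>p. \<Sum>j\<in>{1..m}. ?z p j) F l + ?w n l) k"
  proof -
    have "n < M" using Suc.prems(1) by simp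
    show ?thesis unfolding rec[OF \<open>n < M\<close> Suc.prems(2)]
      by (rule fun_cong[OF multiplier_cong[OF refl split]])
  qed
  also have "\<dots> = multiplier m N (\<lambda>p. ?Q p * (\<Sum>j\<in>{1..m}. ?z p j)) F k + multiplier m N ?Q (?w n) k"
    unfolding multiplier_add multiplier_mult ..
  also have "F k + (\<dots>) = multiplier m N ?R F k + multiplier m N ?Q (?w n) k"
  proof -
    have "multiplier m N ?R F k = multiplier m N (\<lambda>_. 1) F k + multiplier m N (\<lambda>p. ?Q p * (\<Sum>j\<in>{1..m}. ?z p j)) F k"
      unfolding multiplier_add_fun[symmetric] douglas_symbol_def by (simp add: mult.commute)
    thus ?thesis using multiplier_one[OF Suc.prems(2), of F] by simp
  qed
  also have "multiplier m N ?R F k = multiplier m N ?R (\<lambda>k. \<Sum>i<n. multiplier m N (\<lambda>p. ?R p ^ i * ?Q p) (?w (n - 1 - i)) k) k"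
    using F by (intro fun_cong[OF multiplier_cong]) auto
  also have "\<dots> = (\<Sum>i<n. multiplier m N (\<lambda>p. ?R p ^ Suc i * ?Q p) (?w (n - 1 - i)) k)"
    unfolding multiplier_sum multiplier_mult by (simp add: mult.assoc)
  also have "\<dots> + multiplier m N ?Q (?w n) k = (\<Sum>i<Suc n. multiplier m N (\<lambda>p. ?R p ^ i * ?Q p) (?w (Suc n - 1 - i)) k)"
    unfolding sum.lessThan_Suc_shift by simp
  finally show ?case .
qed simp

text \<open>The step is the weighted inequality of arithmetic and geometric means for \<open>n\<close> and \<open>n + 1\<close>.\<close>

lemma sum_inverse_fourth_root: "(\<Sum>i<n. (real i + 1) powr (- (1/4))) \<le> 2 * real n powr (3/4)"
proof (induction n)
  case (Suc n)
  let ?y = "real n + 1"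
  have "real n powr (3/4) * ?y powr (1/4) \<le> 3/4 * real n + 1/4 * ?y"
    using Youngs_inequality_0[of "3/4" "1/4" "real n" ?y] by (cases "n = 0") auto
  moreover have "Y \<le> 3/4 * real n + 1/4 * ?y \<Longrightarrow> 2 * Y + 1 \<le> 2 * ?y" for Y by (simp add: field_simps)
  ultimately have "2 * (real n powr (3/4) * ?y powr (1/4)) + 1 \<le> 2 * ?y" by blast
  hence "(2 * (real n powr (3/4) * ?y powr (1/4)) + 1) * ?y powr (- (1/4)) \<le> 2 * ?y * ?y powr (- (1/4))"
    by (intro mult_right_mono) auto
  moreover have "?y powr (1/4) * ?y powr (- (1/4)) = 1" by (simp flip: powr_add)
  moreover have "?y * ?y powr (- (1/4)) = ?y powr (3/4)" using powr_add[of ?y 1 "- (1/4)"] by simp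
  ultimately have "2 * real n powr (3/4) + ?y powr (- (1/4)) \<le> 2 * ?y powr (3/4)"
    by (simp add: algebra_simps)
  thus ?case using Suc by (simp add: add.commute)
qed simp

section \<open>The local error\<close>

lemma smooth_upto_bounded_cont: "smooth_upto k T m f \<Longrightarrow> bounded_cont T m f"
  by (cases k) auto

lemma smooth_upto_ddt_funpow: "smooth_upto (i + k) T m f \<Longrightarrow> smooth_upto k T m ((ddt T ^^ i) f)"
proof (induction i arbitrary: k)
  case (Suc i)
  have "smooth_upto (Suc k) T m ((ddt T ^^ i) f)" using Suc.prems by (intro Suc.IH) simp
  thus ?case by simp
qed simp

lemma smooth_upto_ddx2: "smooth_upto (k + 2) T m f \<Longrightarrow> j \<in> {1..m} \<Longrightarrow> smooth_upto k T m (ddx2 j f)"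
  unfolding ddx2_def by simp

lemma smooth_upto_foldr_ddx2:
  "set ys \<subseteq> {1..m} \<Longrightarrow> smooth_upto (2 * length ys + k) T m f \<Longrightarrow> smooth_upto k T m (foldr ddx2 ys f)"
proof (induction ys arbitrary: k)
  case (Cons y ys)
  have "smooth_upto (k + 2) T m (foldr ddx2 ys f)" using Cons.prems by (intro Cons.IH) simp_all
  thus ?case using smooth_upto_ddx2[of k T m _ y] Cons.prems(1) by simp
qed simp

lemma smooth_upto_has_ddt:
  assumes "smooth_upto (Suc k) T m f" "t \<in> {0..T}" "x \<in> cube m"
  shows "((\<lambda>s. f s x) has_real_derivative ddt T f t x) (at t within {0..T})"
  using assms unfolding has_real_derivative_iff_has_vector_derivative ddt_def
  by (simp add: vector_derivative_works[symmetric])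

lemma gridpt_in_cube: "k \<in> grid m N \<Longrightarrow> gridpt m N k \<in> cube m"
  unfolding gridpt_def cube_def
proof (intro PiE_I)
  fix j assume k: "k \<in> grid m N" and j: "j \<in> {1..m}"
  have "k j \<in> {1..N j}" by (rule grid_range[OF k j])
  hence "real (k j) * dx N j \<in> {0..1}" unfolding dx_def by (simp add: divide_le_eq)
  thus "(\<lambda>j\<in>{1..m}. real (k j) * dx N j) j \<in> {0..1}" using j by simp
qed auto

lemma ddt_on_grid: "(ddt T ^^ i) (on_grid m N f) = on_grid m N ((ddt T ^^ i) f)"
proof (induction i)
  case (Suc i)
  show ?case using Suc by (simp add: ddt_def on_grid_def)
qed simp

text \<open>Two applications of the mean value inequality; the constant is not optimal.\<close>

lemma trapezoid_error:
  fixes f0 f1 f2 f3 :: "real \<Rightarrow> real"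
  assumes ab: "a \<le> b"
    and f0: "\<And>s. s \<in> {a..b} \<Longrightarrow> (f0 has_real_derivative f1 s) (at s within {a..b})"
    and f1: "\<And>s. s \<in> {a..b} \<Longrightarrow> (f1 has_real_derivative f2 s) (at s within {a..b})"
    and f2: "\<And>s. s \<in> {a..b} \<Longrightarrow> (f2 has_real_derivative f3 s) (at s within {a..b})"
    and f3: "\<And>s. s \<in> {a..b} \<Longrightarrow> \<bar>f3 s\<bar> \<le> C"
  shows "\<bar>f0 a - f0 b + (b - a) * f1 a + (b - a) / 2 * (f1 b - f1 a)\<bar> \<le> C * (b - a) ^ 3"
proof -
  have C: "C \<ge> 0" using f3[of a] ab by auto
  define h where "h s = f1 s - f1 a - (s - a) * f2 s" for s
  define e where "e s = f0 s - f0 a - (s - a) / 2 * (f1 a + f1 s)" for s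
  have h: "\<bar>h s\<bar> \<le> C * (b - a)\<^sup>2" if s: "s \<in> {a..b}" for s
  proof -
    have "norm (h s - h a) \<le> (C * (b - a)) * norm (s - a)"
    proof (rule field_differentiable_bound[where S = "{a..b}" and f' = "\<lambda>s. - ((s - a) * f3 s)"])
      fix z assume z: "z \<in> {a..b}"
      show "(h has_real_derivative - ((z - a) * f3 z)) (at z within {a..b})"
        unfolding h_def using f1[OF z] f2[OF z] by (auto intro!: derivative_eq_intros)
      have "(z - a) * \<bar>f3 z\<bar> \<le> (b - a) * C" using f3[OF z] z by (intro mult_mono) auto
      thus "norm (- ((z - a) * f3 z)) \<le> C * (b - a)" using z by (simp add: abs_mult mult.commute)
    qed (use s ab in auto)
    also have "\<dots> \<le> (C * (b - a)) * (b - a)" using s C ab by (intro mult_left_mono) auto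
    finally show ?thesis unfolding h_def by (simp add: power2_eq_square)
  qed
  have "norm (e b - e a) \<le> (C * (b - a)\<^sup>2) * norm (b - a)"
  proof (rule field_differentiable_bound[where S = "{a..b}" and f' = "\<lambda>s. h s / 2"])
    fix z assume z: "z \<in> {a..b}"
    show "(e has_real_derivative h z / 2) (at z within {a..b})"
      unfolding e_def h_def using f0[OF z] f1[OF z] by (auto intro!: derivative_eq_intros simp: field_simps)
    show "norm (h z / 2) \<le> C * (b - a)\<^sup>2" using h[OF z] by simp
  qed (use ab in auto)
  moreover have "f0 a - f0 b + (b - a) * f1 a + (b - a) / 2 * (f1 b - f1 a) = - (e b - e a)"
    unfolding e_def by (simp add: field_simps)
  ultimately show ?thesis using ab by (simp only: abs_minus_cancel real_norm_def) (simp add: power2_eq_square power3_eq_cube mult.assoc)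
qed

lemma foldr_Dj_lin:
  "foldr (Dj m \<beta> N) ys (\<lambda>k. a * V k + b * W k) = (\<lambda>k. a * foldr (Dj m \<beta> N) ys V k + b * foldr (Dj m \<beta> N) ys W k)"
  by (induction ys) (simp_all add: Dj_lin)

lemma foldr_Dj_diff:
  "foldr (Dj m \<beta> N) ys (\<lambda>k. V k - W k) = (\<lambda>k. foldr (Dj m \<beta> N) ys V k - foldr (Dj m \<beta> N) ys W k)"
  using foldr_Dj_lin[of m \<beta> N ys 1 V "-1" W] by simp

lemma foldr_Dj_deriv:
  assumes "\<And>l. l \<in> grid m N \<Longrightarrow> ((\<lambda>s. \<Phi> s l) has_real_derivative \<Phi>' l) (at t within S)"
    and "k \<in> grid m N"
  shows "((\<lambda>s. foldr (Dj m \<beta> N) ys (\<Phi> s) k) has_real_derivative foldr (Dj m \<beta> N) ys \<Phi>' k) (at t within S)"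
  using assms(2)
proof (induction ys arbitrary: k)
  case (Cons y ys)
  have "((\<lambda>s. \<Sum>l\<in>grid m N. D_entry m \<beta> N y k l * foldr (Dj m \<beta> N) ys (\<Phi> s) l) has_real_derivative
     (\<Sum>l\<in>grid m N. D_entry m \<beta> N y k l * foldr (Dj m \<beta> N) ys \<Phi>' l)) (at t within S)"
    using Cons.IH by (intro DERIV_sum DERIV_cmult)
  thus ?case by (simp add: Dj_def[of m \<beta> N y])
qed (use assms in simp)

text \<open>Multiplying out the product gives terms \<open>(-\<tau>/2)\<^sup>r D\<^sub>y\<^sub>1 \<cdots> D\<^sub>y\<^sub>r W\<close> over the nonempty increasing
  sublists. The prefix \<open>zs\<close> collects the factors already chosen and makes the induction go through.\<close>

lemma stage_ops_minus_id:
  assumes "sorted_wrt (<) xs" and h: "\<tau> \<ge> 0"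
    and K: "\<And>ys k. ys \<noteq> [] \<Longrightarrow> sorted_wrt (<) ys \<Longrightarrow> set ys \<subseteq> set xs \<Longrightarrow> k \<in> grid m N \<Longrightarrow>
       \<bar>foldr (Dj m \<beta> N) (zs @ ys) W k\<bar> \<le> K"
    and k: "k \<in> grid m N"
  shows "\<bar>foldr (Dj m \<beta> N) zs (foldr (stage_op m \<beta> N \<tau>) xs W) k - foldr (Dj m \<beta> N) zs W k\<bar>
    \<le> ((1 + \<tau> / 2) ^ length xs - 1) * K"
  using assms(1) K k
proof (induction xs arbitrary: zs k)
  case (Cons x xs)
  define R where "R = foldr (stage_op m \<beta> N \<tau>) xs W"
  let ?D = "foldr (Dj m \<beta> N)" and ?q = "(1 + \<tau> / 2) ^ length xs"
  have a: "\<bar>?D zs R k - ?D zs W k\<bar> \<le> (?q - 1) * K"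
    unfolding R_def using Cons.prems by (intro Cons.IH) auto
  have b: "\<bar>?D (zs @ [x]) R k - ?D (zs @ [x]) W k\<bar> \<le> (?q - 1) * K"
    unfolding R_def
  proof (rule Cons.IH)
    show "\<bar>?D ((zs @ [x]) @ ys) W k\<bar> \<le> K"
      if "ys \<noteq> []" "sorted_wrt (<) ys" "set ys \<subseteq> set xs" "k \<in> grid m N" for ys k
      using Cons.prems(2)[of "x # ys" k] Cons.prems(1) that by auto
  qed (use Cons.prems in auto)
  have "\<bar>?D (zs @ [x]) W k\<bar> \<le> K" using Cons.prems(2)[of "[x]" k] Cons.prems(3) by simp
  hence c: "\<bar>?D (zs @ [x]) R k\<bar> \<le> ?q * K" using b by (simp add: algebra_simps)
  have "?D zs (stage_op m \<beta> N \<tau> x R) = (\<lambda>k. 1 * ?D zs R k + (- (\<tau> / 2)) * ?D (zs @ [x]) R k)"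
    using foldr_Dj_lin[of m \<beta> N zs 1 R "- (\<tau> / 2)" "Dj m \<beta> N x R"] unfolding stage_op_def by simp
  hence "\<bar>?D zs (stage_op m \<beta> N \<tau> x R) k - ?D zs W k\<bar>
     = \<bar>(?D zs R k - ?D zs W k) + (- (\<tau> / 2)) * ?D (zs @ [x]) R k\<bar>" by simp
  also have "\<dots> \<le> \<bar>?D zs R k - ?D zs W k\<bar> + \<tau> / 2 * \<bar>?D (zs @ [x]) R k\<bar>"
    using h by (intro order_trans[OF abs_triangle_ineq]) (simp add: abs_mult)
  also have "\<dots> \<le> (?q - 1) * K + \<tau> / 2 * (?q * K)"
    using a c h by (intro add_mono mult_left_mono) auto
  also have "\<dots> = ((1 + \<tau> / 2) ^ length (x # xs) - 1) * K" by (simp add: algebra_simps)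
  finally show ?case unfolding R_def by simp
qed simp

lemma power_minus_one_le:
  fixes h :: real
  assumes "h \<ge> 0"
  shows "(1 + h) ^ n - 1 \<le> real n * h * (1 + h) ^ n"
proof (induction n)
  case (Suc n)
  have "h * (1 + h) ^ n \<le> h * (1 + h) ^ Suc n" using assms by (intro mult_left_mono) auto
  moreover have "real n * h * (1 + h) ^ n \<le> real n * h * (1 + h) ^ Suc n" using assms by (intro mult_left_mono) auto
  ultimately show ?case using Suc by (simp add: algebra_simps)
qed simp

text \<open>An increasing list has at most \<open>m\<close> entries, so the derivatives have order at most \<open>2 m + 1\<close>, and
  there are finitely many of them.\<close>

lemma mixed_derivatives_bounded:
  assumes u: "smooth_upto (2 * m + 2) T m u"
  shows "\<exists>K\<ge>0. \<forall>is j. sorted_wrt (<) (is @ [j]) \<and> set (is @ [j]) \<subseteq> {1..m} \<longrightarrow> (\<forall>t\<in>{0..T}. \<forall>x\<in>cube m.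
    \<bar>prod_list (map \<beta> is) * \<beta> j * foldr ddx2 is (ddx2 j (ddt T u)) t x\<bar> \<le> K)"
proof -
  define S where "S = {xs. sorted_wrt (<) xs \<and> xs \<noteq> [] \<and> set xs \<subseteq> {1..m}}"
  have len: "length xs \<le> m" if "xs \<in> S" for xs
  proof -
    have "distinct xs" using that unfolding S_def by (simp add: strict_sorted_iff)
    hence "length xs = card (set xs)" by (simp add: distinct_card)
    also have "\<dots> \<le> card {1..m}" using that unfolding S_def by (intro card_mono) auto
    finally show ?thesis by simp
  qed
  have fin: "finite S"
    by (rule finite_subset[OF _ finite_lists_length_le[of "{1..m}" m]]) (use len in \<open>auto simp: S_def\<close>)
  define v where "v xs = (\<lambda>t x. prod_list (map \<beta> (butlast xs)) * \<beta> (last xs) *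
     foldr ddx2 (butlast xs) (ddx2 (last xs) (ddt T u)) t x)" for xs
  have "\<exists>B\<ge>0. \<forall>t\<in>{0..T}. \<forall>x\<in>cube m. \<bar>v xs t x\<bar> \<le> B" if xs: "xs \<in> S" for xs
  proof -
    obtain is' j where x: "xs = is' @ [j]" using xs unfolding S_def by (metis (mono_tags) mem_Collect_eq rev_exhaust)
    have r: "set is' \<subseteq> {1..m}" "j \<in> {1..m}" using xs unfolding S_def x by auto
    have "Suc (length is') \<le> m" using len[OF xs] unfolding x by simp
    then obtain d where "2 * m + 2 = Suc (2 * length is' + d + 2)"
      using nat_le_iff_add[of "2 * length is' + 3" "2 * m + 2"] by auto
    hence "smooth_upto (2 * length is' + d + 2) T m (ddt T u)" using u by simp
    hence "smooth_upto (2 * length is' + d) T m (ddx2 j (ddt T u))" using r(2) by (rule smooth_upto_ddx2)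
    hence "smooth_upto d T m (foldr ddx2 is' (ddx2 j (ddt T u)))" using r(1) by (intro smooth_upto_foldr_ddx2)
    hence "bounded ((\<lambda>(t, x). foldr ddx2 is' (ddx2 j (ddt T u)) t x) ` ({0..T} \<times> cube m))"
      using smooth_upto_bounded_cont unfolding bounded_cont_def by blast
    then obtain B where B: "\<And>t x. t \<in> {0..T} \<Longrightarrow> x \<in> cube m \<Longrightarrow> \<bar>foldr ddx2 is' (ddx2 j (ddt T u)) t x\<bar> \<le> B"
      unfolding bounded_iff by fastforce
    have "\<bar>v xs t x\<bar> \<le> \<bar>prod_list (map \<beta> is') * \<beta> j\<bar> * \<bar>B\<bar>" if "t \<in> {0..T}" "x \<in> cube m" for t x
      unfolding v_def x abs_mult[of "prod_list _ * _"] using B[OF that]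
      by (simp only: butlast_snoc last_snoc abs_mult) (intro mult_left_mono, auto)
    thus ?thesis by (intro exI[of _ "\<bar>prod_list (map \<beta> is') * \<beta> j\<bar> * \<bar>B\<bar>"]) auto
  qed
  then obtain B where B: "\<And>xs. xs \<in> S \<Longrightarrow> B xs \<ge> 0 \<and> (\<forall>t\<in>{0..T}. \<forall>x\<in>cube m. \<bar>v xs t x\<bar> \<le> B xs)" by metis
  show ?thesis
  proof (intro exI[of _ "\<Sum>xs\<in>S. B xs"] conjI allI impI ballI)
    show "0 \<le> sum B S" using B by (intro sum_nonneg) auto
    fix "is" j t x assume ij: "sorted_wrt (<) (is @ [j]) \<and> set (is @ [j]) \<subseteq> {1..m}" and tx: "t \<in> {0..T}" "x \<in> cube m"
    have S: "is @ [j] \<in> S" using ij unfolding S_def by simp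
    have "\<bar>v (is @ [j]) t x\<bar> \<le> B (is @ [j])" using B[OF S] tx by blast
    also have "\<dots> \<le> sum B S" using S B fin by (intro member_le_sum) auto
    finally show "\<bar>prod_list (map \<beta> is) * \<beta> j * foldr ddx2 is (ddx2 j (ddt T u)) t x\<bar> \<le> sum B S" unfolding v_def by simp
  qed
qed

text \<open>The maximum principle for \<open>E\<close> and \<open>- E\<close>, with barrier in direction \<open>1\<close>.\<close>

lemma Dsum_inverse_bound:
  assumes N: "\<forall>j\<in>{1..m}. N j \<ge> 1" and m: "m \<ge> 1" and \<beta>: "\<forall>j\<in>{1..m}. \<beta> j > 0"
    and E: "maxnorm m N (Dsum m \<beta> N E) \<le> B" and k: "k \<in> grid m N"
  shows "\<bar>E k\<bar> \<le> B / (8 * \<beta> 1)"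
proof -
  define \<gamma> where "\<gamma> j = \<beta> j / (dx N j)\<^sup>2" for j
  have dx0: "dx N j > 0" for j unfolding dx_def by simp
  have \<gamma>: "\<gamma> j > 0" if "j \<in> {1..m}" for j unfolding \<gamma>_def using \<beta> that dx0[of j] by simp
  have D: "\<bar>Dsum m \<beta> N E l\<bar> \<le> B" if "l \<in> grid m N" for l using abs_le_maxnorm[OF that] E by (rule order_trans)
  have B: "B \<ge> 0" using D[OF k] by linarith
  have b: "s * E k \<le> B * (real (N 1) + 1)\<^sup>2 / (8 * \<gamma> 1)" if s: "\<bar>s\<bar> = 1" for s
  proof (rule barrier_bound[where w = "\<lambda>l. s * E l" and \<gamma> = \<gamma>, OF _ _ _ _ _ B k])
    fix l assume l: "l \<in> grid m N"
    have "(\<Sum>j = 1..m. \<gamma> j * - second_diff N j (\<lambda>l. s * E l) l) = - s * Dsum m \<beta> N E l"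
      unfolding Dsum_def second_diff_scale sum_distrib_left
      by (intro sum.cong refl) (use Dj_eq_second_diff[OF l] in \<open>simp add: \<gamma>_def\<close>)
    also have "\<dots> \<le> \<bar>s\<bar> * \<bar>Dsum m \<beta> N E l\<bar>" by (metis abs_ge_self abs_minus_cancel abs_mult)
    also have "\<dots> \<le> B" using D[OF l] s by simp
    finally show "(\<Sum>j = 1..m. \<gamma> j * - second_diff N j (\<lambda>l. s * E l) l) \<le> B" .
  qed (use k m \<gamma> less_imp_le[OF \<gamma>] in auto)
  have "B * (real (N 1) + 1)\<^sup>2 / (8 * \<gamma> 1) = B / (8 * \<beta> 1)"
    unfolding \<gamma>_def dx_def by (simp add: field_simps)
  thus ?thesis using b[of 1] b[of "-1"] by (simp add: abs_le_iff)
qed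

section \<open>Convergence\<close>

theorem theorem3:
  fixes m :: nat and \<beta> :: "nat \<Rightarrow> real" and T :: real
    and u c :: "real \<Rightarrow> point \<Rightarrow> real" and u0 b :: "point \<Rightarrow> real"
    and C K\<^sub>\<phi> K\<^sub>D K\<^sub>0 :: real
  assumes "m \<ge> 1" and "\<forall>j\<in>{1..m}. \<beta> j > 0" and "T > 0"
    and "smooth_upto (2 * m + 2) T m u"
    and "\<forall>t\<in>{0..T}. \<forall>x\<in>open_cube m. ddt T u t x = (\<Sum>j\<in>{1..m}. \<beta> j * ddx2 j u t x) + c t x"
    and "\<forall>x\<in>cube m. u 0 x = u0 x"
    and "\<forall>t\<in>{0..T}. \<forall>x\<in>cube m - open_cube m. u t x = b x"
  shows "\<exists>C'. \<forall>(N :: nat \<Rightarrow> nat) (g :: nat \<Rightarrow> real \<Rightarrow> gridfun) (c\<^sub>h :: real \<Rightarrow> gridfun)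
      (U :: real \<Rightarrow> gridfun) (\<tau> :: real) (nstar :: nat) (V :: nat \<Rightarrow> gridfun).
    (\<forall>j\<in>{1..m}. N j \<ge> 1) \<longrightarrow>
    U = on_grid m N u \<longrightarrow>
    (\<forall>j\<in>{1..m}. \<forall>t\<in>{0..T}. \<forall>k\<in>grid m N.
       g j t k = bnd m \<beta> N b j k + (if j = 1 then c\<^sub>h t k else 0)) \<longrightarrow>
    (\<forall>t\<in>{0..T}. \<forall>k\<in>grid m N. ddt T U t k = Dsum m \<beta> N (U t) k + gsum m g t k) \<longrightarrow>
    (\<forall>j\<in>{1..m}. \<forall>i\<in>{1,2}. \<forall>t\<in>{0..T}.
       maxnorm m N ((ddt T ^^ i) (phi m \<beta> N U g j) t) \<le> K\<^sub>\<phi>) \<longrightarrow>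
    (\<forall>j\<in>{0..4}. \<forall>t\<in>{0..T}. maxnorm m N ((ddt T ^^ j) U t) \<le> C) \<longrightarrow>
    (\<forall>i\<in>{0..3}. \<forall>t\<in>{0..T}. maxnorm m N ((ddt T ^^ i) (gsum m g) t) \<le> C) \<longrightarrow>
    (\<forall>j\<in>{2..m}. \<forall>t\<in>{0..T}. \<forall>k\<in>grid m N.
       ((\<lambda>s. g j s k) has_vector_derivative 0) (at t within {0..T})) \<longrightarrow>
    (\<forall>is j. is \<noteq> [] \<and> sorted_wrt (<) (is @ [j]) \<and> set (is @ [j]) \<subseteq> {1..m} \<longrightarrow>
       (\<forall>t\<in>{0..T}. \<forall>i\<in>{1,2}.
          mixed_consistent m \<beta> N K\<^sub>D is j ((ddt T ^^ i) (phi m \<beta> N U g j) t) ((ddt T ^^ i) u) t)) \<longrightarrow>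
    \<tau> > 0 \<longrightarrow> real nstar * \<tau> = T \<longrightarrow>
    (\<forall>n<nstar. douglas_step m \<beta> N g (1/2) \<tau> (real n * \<tau>) (real (n + 1) * \<tau>) (V n) (V (n + 1))) \<longrightarrow>
    maxnorm m N (Dsum m \<beta> N (\<lambda>k. V 0 k - U 0 k)) \<le> K\<^sub>0 * \<tau>\<^sup>2 \<longrightarrow>
    (\<forall>n\<in>{1..nstar}. maxnorm m N (\<lambda>k. V n k - U (real n * \<tau>) k) \<le> C' * \<tau>\<^sup>2)"
proof -
  note m = assms(1) and \<beta> = assms(2) and T = assms(3) and u = assms(4)
  obtain Cs where Cs: "Cs \<ge> 0" and stab: "\<And>N \<tau> k V B l. \<tau> > 0 \<Longrightarrow> \<forall>l\<in>grid m N. norm (V l) \<le> B \<Longrightarrow> l \<in> grid m N \<Longrightarrow>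
    norm (multiplier m N (\<lambda>p. douglas_symbol {1..m} (eigen_point (mesh_coeff \<tau> \<beta> N) N p) ^ k
        * douglas_inv {1..m} (eigen_point (mesh_coeff \<tau> \<beta> N) N p)) V l)
     \<le> Cs * ((real k + 1) * \<tau>) powr (- (1/4)) * B"
    using douglas_stability[OF m \<beta>] by blast
  obtain Ku where Ku: "Ku \<ge> 0" and mixed: "\<And>is j t x. sorted_wrt (<) (is @ [j]) \<Longrightarrow> set (is @ [j]) \<subseteq> {1..m} \<Longrightarrow>
      t \<in> {0..T} \<Longrightarrow> x \<in> cube m \<Longrightarrow>
      \<bar>prod_list (map \<beta> is) * \<beta> j * foldr ddx2 is (ddx2 j (ddt T u)) t x\<bar> \<le> Ku"
    using mixed_derivatives_bounded[OF u, of \<beta>] by blast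
  define K1 where "K1 = \<bar>K\<^sub>D\<bar> * (real m + 1) + Ku"
  \<comment> \<open>bounds the defects divided by \<open>\<tau>\<^sup>3\<close>: the trapezoidal rule gives the first summand, the splitting the second one\<close>
  define C\<eta> where "C\<eta> = \<bar>C\<bar> + 1/2 * (real m * (real m * (1/2) * (1 + T / 2) ^ m * K1))"
  define C' where "C' = \<bar>K\<^sub>0\<bar> / (8 * \<beta> 1) + 2 * Cs * (\<bar>K\<^sub>0\<bar> + C\<eta>) * T powr (3/4)"
  have K1: "K1 \<ge> 0" unfolding K1_def using Ku by simp
  have C\<eta>: "C\<eta> \<ge> 0" unfolding C\<eta>_def using K1 T by simp
  show ?thesis
  proof (intro exI[of _ C'] allI impI ballI)
    fix N and g :: "nat \<Rightarrow> real \<Rightarrow> gridfun" and c\<^sub>h U and \<tau> :: real and nstar n :: nat and V :: "nat \<Rightarrow> gridfun"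
    assume N: "\<forall>j\<in>{1..m}. N j \<ge> 1" and U: "U = on_grid m N u"
      and ode: "\<forall>t\<in>{0..T}. \<forall>k\<in>grid m N. ddt T U t k = Dsum m \<beta> N (U t) k + gsum m g t k"
      and Ub: "\<forall>j\<in>{0..4}. \<forall>t\<in>{0..T}. maxnorm m N ((ddt T ^^ j) U t) \<le> C"
      and g0: "\<forall>j\<in>{2..m}. \<forall>t\<in>{0..T}. \<forall>k\<in>grid m N. ((\<lambda>s. g j s k) has_vector_derivative 0) (at t within {0..T})"
      and cons: "\<forall>is j. is \<noteq> [] \<and> sorted_wrt (<) (is @ [j]) \<and> set (is @ [j]) \<subseteq> {1..m} \<longrightarrow>
       (\<forall>t\<in>{0..T}. \<forall>i\<in>{1,2}.
          mixed_consistent m \<beta> N K\<^sub>D is j ((ddt T ^^ i) (phi m \<beta> N U g j) t) ((ddt T ^^ i) u) t)"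
      and \<tau>: "\<tau> > 0" and nT: "real nstar * \<tau> = T"
      and step: "\<forall>n<nstar. douglas_step m \<beta> N g (1/2) \<tau> (real n * \<tau>) (real (n + 1) * \<tau>) (V n) (V (n + 1))"
      and E0: "maxnorm m N (Dsum m \<beta> N (\<lambda>k. V 0 k - U 0 k)) \<le> K\<^sub>0 * \<tau>\<^sup>2"
      and n: "n \<in> {1..nstar}"
    have ne: "grid m N \<noteq> {}" by (rule grid_nonempty[OF N])
    have nstar: "nstar \<ge> 1" using n by simp
    have tn: "real i * \<tau> \<in> {0..T}" if "i \<le> nstar" for i
      using that \<tau> unfolding nT[symmetric] by (simp add: mult_right_mono)
    have \<tau>T: "\<tau> \<le> T" using tn[of 1] nstar by simp
    have Uder: "((\<lambda>s. (ddt T ^^ i) U s k) has_real_derivative (ddt T ^^ Suc i) U t k) (at t within {0..T})"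
      if "i \<le> 2" "t \<in> {0..T}" "k \<in> grid m N" for i t k
    proof -
      have "2 * m + 2 = i + Suc (2 * m + 1 - i)" using that(1) m by simp
      hence "smooth_upto (Suc (2 * m + 1 - i)) T m ((ddt T ^^ i) u)"
        using u by (intro smooth_upto_ddt_funpow) metis
      from smooth_upto_has_ddt[OF this that(2) gridpt_in_cube[OF that(3)]]
      show ?thesis unfolding U ddt_on_grid by (simp add: on_grid_def)
    qed
    define d where "d i = (\<lambda>j k. (Dj m \<beta> N j (U (real (Suc i) * \<tau>)) k + g j (real (Suc i) * \<tau>) k)
        - (Dj m \<beta> N j (U (real i * \<tau>)) k + g j (real i * \<tau>) k))" for i
    let ?S = "foldr (stage_op m \<beta> N \<tau>)"
    define \<eta> where "\<eta> i = (\<lambda>k. U (real i * \<tau>) k - U (real (Suc i) * \<tau>) k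
        + \<tau> * (Dsum m \<beta> N (U (real i * \<tau>)) k + gsum m g (real i * \<tau>) k)
        + \<tau> / 2 * (\<Sum>j\<in>{1..m}. ?S [1..<j] (d i j) k))" for i
    have d_phi: "d i j = (\<lambda>k. phi m \<beta> N U g j (real (Suc i) * \<tau>) k - phi m \<beta> N U g j (real i * \<tau>) k)" for i j
      unfolding d_def phi_def ..
    have Dd: "\<bar>foldr (Dj m \<beta> N) ys (d i j) k\<bar> \<le> K1 * \<tau>"
      if i: "i < nstar" and ys: "ys \<noteq> []" "sorted_wrt (<) (ys @ [j])" "set (ys @ [j]) \<subseteq> {1..m}" and k: "k \<in> grid m N" for i ys j k
    proof -
      \<comment> \<open>a nonempty list precedes \<open>j\<close>, so \<open>g\<^sub>j\<close> has no source term and is constant in time\<close>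
      have j2: "j \<in> {2..m}" using ys by (cases ys) auto
      let ?P = "phi m \<beta> N U g j"
      have P: "((\<lambda>s. ?P s l) has_real_derivative ddt T ?P t l) (at t within {0..T})" if t: "t \<in> {0..T}" and l: "l \<in> grid m N" for t l
      proof -
        have "((\<lambda>s. foldr (Dj m \<beta> N) [j] (U s) l) has_real_derivative foldr (Dj m \<beta> N) [j] (ddt T U t) l) (at t within {0..T})"
          using Uder[of 0 t] t l by (intro foldr_Dj_deriv) auto
        moreover have "((\<lambda>s. g j s l) has_real_derivative 0) (at t within {0..T})"
          using g0 j2 t l by (simp add: has_real_derivative_iff_has_vector_derivative)
        ultimately have "((\<lambda>s. ?P s l) has_real_derivative Dj m \<beta> N j (ddt T U t) l + 0) (at t within {0..T})"
          unfolding phi_def by (intro DERIV_add) simp_all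
        hence "(\<lambda>s. ?P s l) differentiable (at t within {0..T})"
          unfolding has_real_derivative_iff_has_vector_derivative by (rule differentiableI_vector)
        thus ?thesis unfolding ddt_def has_real_derivative_iff_has_vector_derivative
          by (simp add: vector_derivative_works[symmetric])
      qed
      have bnd: "\<bar>foldr (Dj m \<beta> N) ys (ddt T ?P t) k\<bar> \<le> K1" if t: "t \<in> {0..T}" for t
      proof -
        let ?w = "prod_list (map \<beta> ys) * \<beta> j * on_grid m N (foldr ddx2 ys (ddx2 j (ddt T u))) t k"
        have "mixed_consistent m \<beta> N K\<^sub>D ys j (ddt T ?P t) (ddt T u) t"
          using cons[rule_format, of ys j t 1] ys t by simp
        hence "\<bar>foldr (Dj m \<beta> N) ys (ddt T ?P t) k - ?w\<bar> \<le> K\<^sub>D * ((\<Sum>i\<leftarrow>ys. (dx N i)\<^sup>2) + (dx N j)\<^sup>2)"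
          unfolding mixed_consistent_def by (rule order_trans[OF abs_le_maxnorm[OF k]])
        also have "\<dots> \<le> \<bar>K\<^sub>D\<bar> * (real m + 1)"
        proof -
          have dx1: "(dx N i)\<^sup>2 \<le> 1" for i unfolding dx_def by (simp add: power_le_one divide_le_eq)
          have "(\<Sum>i\<leftarrow>ys. (dx N i)\<^sup>2) \<le> (\<Sum>i\<leftarrow>ys. 1)" by (intro sum_list_mono dx1)
          also have "\<dots> = real (length ys)" by (simp add: sum_list_triv)
          also have "\<dots> \<le> real m"
          proof -
            have "distinct ys" using ys(2) by (simp add: sorted_wrt_append strict_sorted_iff)
            hence "length ys = card (set ys)" by (simp add: distinct_card)
            also have "\<dots> \<le> card {1..m}" using ys(3) by (intro card_mono) auto
            finally show ?thesis by simp
          qed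
          finally have "(\<Sum>i\<leftarrow>ys. (dx N i)\<^sup>2) + (dx N j)\<^sup>2 \<le> real m + 1" using dx1[of j] by linarith
          moreover have "0 \<le> (\<Sum>i\<leftarrow>ys. (dx N i)\<^sup>2) + (dx N j)\<^sup>2"
            by (intro add_nonneg_nonneg sum_list_nonneg) auto
          ultimately show ?thesis by (intro mult_mono) auto
        qed
        finally have "\<bar>foldr (Dj m \<beta> N) ys (ddt T ?P t) k - ?w\<bar> \<le> \<bar>K\<^sub>D\<bar> * (real m + 1)" .
        moreover have "\<bar>?w\<bar> \<le> Ku"
          unfolding on_grid_def by (rule mixed[OF ys(2,3) t gridpt_in_cube[OF k]])
        ultimately show ?thesis unfolding K1_def by linarith
      qed
      have "norm (foldr (Dj m \<beta> N) ys (?P (real (Suc i) * \<tau>)) k - foldr (Dj m \<beta> N) ys (?P (real i * \<tau>)) k)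
          \<le> K1 * norm (real (Suc i) * \<tau> - real i * \<tau>)"
      proof (rule field_differentiable_bound[where S = "{0..T}" and f' = "\<lambda>t. foldr (Dj m \<beta> N) ys (ddt T ?P t) k"])
        show "((\<lambda>t. foldr (Dj m \<beta> N) ys (?P t) k) has_real_derivative foldr (Dj m \<beta> N) ys (ddt T ?P t) k) (at t within {0..T})"
          if "t \<in> {0..T}" for t
          by (rule foldr_Dj_deriv[OF _ k]) (rule P[OF that])
      qed (use bnd tn[of i] tn[of "Suc i"] i in auto)
      also have "real (Suc i) * \<tau> - real i * \<tau> = \<tau>" by (simp add: algebra_simps)
      finally show ?thesis unfolding d_phi foldr_Dj_diff using \<tau> by simp
    qed
    have \<eta>: "\<bar>\<eta> i k\<bar> \<le> C\<eta> * \<tau> ^ 3" if i: "i < nstar" and k: "k \<in> grid m N" for i k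
    proof -
      let ?a = "real i * \<tau>" and ?b = "real (Suc i) * \<tau>"
      have ab: "?a \<in> {0..T}" "?b \<in> {0..T}" using tn[of i] tn[of "Suc i"] i by auto
      have ba: "?b - ?a = \<tau>" by (simp add: algebra_simps)
      have le: "?a \<le> ?b" using ba \<tau> by linarith
      have sub: "{?a..?b} \<subseteq> {0..T}" using ab by auto
      have der: "((\<lambda>s. (ddt T ^^ r) U s k) has_real_derivative (ddt T ^^ Suc r) U s k) (at s within {?a..?b})"
        if "s \<in> {?a..?b}" "r \<le> 2" for r s
        using Uder[of r s k] that sub k by (blast intro: has_field_derivative_subset)
      have "\<bar>(ddt T ^^ 0) U ?a k - (ddt T ^^ 0) U ?b k + (?b - ?a) * (ddt T ^^ Suc 0) U ?a k
          + (?b - ?a) / 2 * ((ddt T ^^ Suc 0) U ?b k - (ddt T ^^ Suc 0) U ?a k)\<bar> \<le> C * (?b - ?a) ^ 3"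
      proof (rule trapezoid_error[OF le])
        fix s assume s: "s \<in> {?a..?b}"
        show "((\<lambda>s. (ddt T ^^ 0) U s k) has_real_derivative (ddt T ^^ Suc 0) U s k) (at s within {?a..?b})"
          "((\<lambda>s. (ddt T ^^ Suc 0) U s k) has_real_derivative (ddt T ^^ Suc (Suc 0)) U s k) (at s within {?a..?b})"
          "((\<lambda>s. (ddt T ^^ Suc (Suc 0)) U s k) has_real_derivative (ddt T ^^ Suc (Suc (Suc 0))) U s k) (at s within {?a..?b})"
          using der[OF s, of 0] der[OF s, of "Suc 0"] der[OF s, of "Suc (Suc 0)"] by simp_all
        have "maxnorm m N ((ddt T ^^ Suc (Suc (Suc 0))) U s) \<le> C" using Ub s sub by (intro bspec[OF bspec[OF Ub]]) auto
        thus "\<bar>(ddt T ^^ Suc (Suc (Suc 0))) U s k\<bar> \<le> C" by (rule order_trans[OF abs_le_maxnorm[OF k]])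
      qed
      hence trap: "\<bar>U ?a k - U ?b k + \<tau> * ddt T U ?a k + \<tau> / 2 * (ddt T U ?b k - ddt T U ?a k)\<bar> \<le> \<bar>C\<bar> * \<tau> ^ 3"
        unfolding ba using \<tau> by (simp add: order_trans[OF _ mult_right_mono[OF abs_ge_self]])
      have sumd: "(\<Sum>j\<in>{1..m}. d i j k) = ddt T U ?b k - ddt T U ?a k"
        using ode ab k unfolding d_def by (simp add: Dsum_def gsum_def sum.distrib sum_subtractf)
      have stage: "\<bar>?S [1..<j] (d i j) k - d i j k\<bar> \<le> real m * (\<tau> / 2) * (1 + T / 2) ^ m * (K1 * \<tau>)" if j: "j \<in> {1..m}" for j
      proof -
        have "\<bar>foldr (Dj m \<beta> N) [] (?S [1..<j] (d i j)) k - foldr (Dj m \<beta> N) [] (d i j) k\<bar>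
           \<le> ((1 + \<tau> / 2) ^ length [1..<j] - 1) * (K1 * \<tau>)"
        proof (rule stage_ops_minus_id[OF _ _ _ k])
          fix ys l assume ys: "ys \<noteq> []" "sorted_wrt (<) ys" "set ys \<subseteq> set [1..<j]" and l: "l \<in> grid m N"
          have "sorted_wrt (<) (ys @ [j])" "set (ys @ [j]) \<subseteq> {1..m}"
            using ys j by (auto simp: sorted_wrt_append)
          thus "\<bar>foldr (Dj m \<beta> N) ([] @ ys) (d i j) l\<bar> \<le> K1 * \<tau>" using Dd[OF i ys(1)] l by simp
        qed (use \<tau> in auto)
        also have "\<dots> \<le> (real (length [1..<j]) * (\<tau> / 2) * (1 + \<tau> / 2) ^ length [1..<j]) * (K1 * \<tau>)"
          using K1 \<tau> by (intro mult_right_mono power_minus_one_le) auto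
        also have "\<dots> \<le> (real m * (\<tau> / 2) * (1 + T / 2) ^ m) * (K1 * \<tau>)"
        proof (intro mult_right_mono mult_mono)
          have "(1 + \<tau> / 2) ^ length [1..<j] \<le> (1 + \<tau> / 2) ^ m" using j \<tau> by (intro power_increasing) auto
          also have "\<dots> \<le> (1 + T / 2) ^ m" using \<tau>T \<tau> by (intro power_mono) auto
          finally show "(1 + \<tau> / 2) ^ length [1..<j] \<le> (1 + T / 2) ^ m" .
        qed (use j \<tau> K1 in auto)
        finally show ?thesis by simp
      qed
      \<comment> \<open>the increments of the \<open>\<phi>\<^sub>j\<close> add up to that of \<open>U'\<close>, which completes the trapezoidal rule\<close>
      have decomp: "\<eta> i k = (U ?a k - U ?b k + \<tau> * ddt T U ?a k + \<tau> / 2 * (ddt T U ?b k - ddt T U ?a k))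
          + \<tau> / 2 * (\<Sum>j\<in>{1..m}. ?S [1..<j] (d i j) k - d i j k)"
        unfolding sum_subtractf sumd \<eta>_def using ode ab k by (simp add: algebra_simps)
      have "\<bar>\<eta> i k\<bar> \<le> \<bar>C\<bar> * \<tau> ^ 3 + \<tau> / 2 * (\<Sum>j\<in>{1..m}. real m * (\<tau> / 2) * (1 + T / 2) ^ m * (K1 * \<tau>))"
        unfolding decomp
      proof (rule order_trans[OF abs_triangle_ineq add_mono[OF trap]])
        have "\<bar>\<Sum>j\<in>{1..m}. ?S [1..<j] (d i j) k - d i j k\<bar> \<le> (\<Sum>j\<in>{1..m}. real m * (\<tau> / 2) * (1 + T / 2) ^ m * (K1 * \<tau>))"
          by (intro order_trans[OF sum_abs] sum_mono stage)
        thus "\<bar>\<tau> / 2 * (\<Sum>j\<in>{1..m}. ?S [1..<j] (d i j) k - d i j k)\<bar> \<le> \<tau> / 2 * (\<Sum>j\<in>{1..m}. real m * (\<tau> / 2) * (1 + T / 2) ^ m * (K1 * \<tau>))"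
          using \<tau> unfolding abs_mult by (intro mult_mono) auto
      qed
      also have "\<dots> = C\<eta> * \<tau> ^ 3"
      proof -
        have "\<tau> / 2 * (real m * (real m * (\<tau> / 2) * Q * (K1 * \<tau>)))
            = 1/2 * (real m * (real m * (1/2) * Q * K1)) * \<tau> ^ 3" for Q
          by (simp add: power3_eq_cube)
        thus ?thesis unfolding C\<eta>_def sum_constant card_atLeastAtMost
          by (simp only: distrib_right diff_Suc_1 One_nat_def diff_Suc_Suc diff_zero)
      qed
      finally show ?thesis .
    qed
    \<comment> \<open>from here on only the error recursion, the bounds on the defects and the stability estimate matter\<close>
    define E where "E i k = V i k - U (real i * \<tau>) k" for i k
    have E0': "maxnorm m N (Dsum m \<beta> N (E 0)) \<le> \<bar>K\<^sub>0\<bar> * \<tau>\<^sup>2"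
    proof -
      have "E 0 = (\<lambda>k. V 0 k - U 0 k)" unfolding E_def by simp
      hence "maxnorm m N (Dsum m \<beta> N (E 0)) \<le> K\<^sub>0 * \<tau>\<^sup>2" using E0 by simp
      also have "\<dots> \<le> \<bar>K\<^sub>0\<bar> * \<tau>\<^sup>2" by (intro mult_right_mono) auto
      finally show ?thesis .
    qed
    have rec: "complex_of_real (E (Suc i) k - E i k)
     = multiplier m N (\<lambda>p. douglas_inv {1..m} (eigen_point (mesh_coeff \<tau> \<beta> N) N p))
        (\<lambda>k. of_real (\<tau> * Dsum m \<beta> N (E i) k + \<eta> i k)) k" if "i < nstar" "k \<in> grid m N" for i k
    proof -
      have st: "douglas_step m \<beta> N g (1/2) \<tau> (real i * \<tau>) (real (Suc i) * \<tau>) (V i) (V (Suc i))"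
        using step that(1) by simp
      show ?thesis unfolding E_def
        by (rule douglas_error_step[OF st that(2) \<beta> \<tau> d_def \<eta>_def])
    qed
    have w: "\<forall>k\<in>grid m N. norm (complex_of_real (\<tau> * Dsum m \<beta> N (E 0) k + \<eta> i k)) \<le> (\<bar>K\<^sub>0\<bar> + C\<eta>) * \<tau> ^ 3"
      if i: "i < nstar" for i
    proof
      fix k assume k: "k \<in> grid m N"
      have "\<bar>Dsum m \<beta> N (E 0) k\<bar> \<le> \<bar>K\<^sub>0\<bar> * \<tau>\<^sup>2" by (rule order_trans[OF abs_le_maxnorm[OF k] E0'])
      hence "\<tau> * \<bar>Dsum m \<beta> N (E 0) k\<bar> \<le> \<tau> * (\<bar>K\<^sub>0\<bar> * \<tau>\<^sup>2)" using \<tau> by (intro mult_left_mono) auto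
      hence "\<bar>\<tau> * Dsum m \<beta> N (E 0) k\<bar> \<le> \<bar>K\<^sub>0\<bar> * \<tau> ^ 3"
        using \<tau> by (simp add: abs_mult power2_eq_square power3_eq_cube mult_ac)
      hence "\<bar>\<tau> * Dsum m \<beta> N (E 0) k + \<eta> i k\<bar> \<le> \<bar>K\<^sub>0\<bar> * \<tau> ^ 3 + C\<eta> * \<tau> ^ 3"
        using \<eta>[OF i k] by (intro order_trans[OF abs_triangle_ineq] add_mono)
      thus "norm (complex_of_real (\<tau> * Dsum m \<beta> N (E 0) k + \<eta> i k)) \<le> (\<bar>K\<^sub>0\<bar> + C\<eta>) * \<tau> ^ 3"
        by (simp only: norm_of_real distrib_right)
    qed
    show "maxnorm m N (\<lambda>k. V n k - U (real n * \<tau>) k) \<le> C' * \<tau>\<^sup>2"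
    proof (rule maxnorm_leI[OF ne])
      fix k assume k: "k \<in> grid m N"
      let ?B = "(\<bar>K\<^sub>0\<bar> + C\<eta>) * \<tau> ^ 3"
      have nn: "n \<le> nstar" "n \<ge> 1" using n by auto
      have "\<bar>E n k - E 0 k\<bar> = norm (complex_of_real (E n k - E 0 k))" by (simp only: norm_of_real)
      also have "complex_of_real (E n k - E 0 k) = (\<Sum>i<n. multiplier m N (\<lambda>p. douglas_symbol {1..m} (eigen_point (mesh_coeff \<tau> \<beta> N) N p) ^ i
            * douglas_inv {1..m} (eigen_point (mesh_coeff \<tau> \<beta> N) N p))
          (\<lambda>k. complex_of_real (\<tau> * Dsum m \<beta> N (E 0) k + \<eta> (n - 1 - i) k)) k)"
        by (rule error_representation[of nstar m N E \<tau> \<beta> \<eta>, OF rec nn(1) k])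
      also have "norm \<dots> \<le> (\<Sum>i<n. Cs * ((real i + 1) * \<tau>) powr (- (1/4)) * ?B)"
      proof (rule sum_norm_le)
        fix i assume "i \<in> {..<n}"
        hence "n - 1 - i < nstar" using nn by auto
        from stab[OF \<tau> w[OF this] k]
        show "norm (multiplier m N (\<lambda>p. douglas_symbol {1..m} (eigen_point (mesh_coeff \<tau> \<beta> N) N p) ^ i * douglas_inv {1..m} (eigen_point (mesh_coeff \<tau> \<beta> N) N p))
            (\<lambda>k. complex_of_real (\<tau> * Dsum m \<beta> N (E 0) k + \<eta> (n - 1 - i) k)) k)
            \<le> Cs * ((real i + 1) * \<tau>) powr (- (1/4)) * ?B" .
      qed
      also have "\<dots> = Cs * ?B * \<tau> powr (- (1/4)) * (\<Sum>i<n. (real i + 1) powr (- (1/4)))"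
        unfolding powr_mult sum_distrib_left by (simp add: mult_ac)
      also have "\<dots> \<le> Cs * ?B * \<tau> powr (- (1/4)) * (2 * real n powr (3/4))"
        using Cs C\<eta> \<tau> by (intro mult_left_mono sum_inverse_fourth_root mult_nonneg_nonneg) auto
      also have "\<dots> = 2 * Cs * (\<bar>K\<^sub>0\<bar> + C\<eta>) * (real n * \<tau>) powr (3/4) * \<tau>\<^sup>2"
      proof -
        have "\<tau> * \<tau> powr (- (1/4)) = \<tau> powr (3/4)" using powr_add[of \<tau> 1 "- (1/4)"] \<tau> by simp
        hence "(real n * \<tau>) powr (3/4) = real n powr (3/4) * (\<tau> * \<tau> powr (- (1/4)))" by (simp only: powr_mult)
        thus ?thesis by (simp add: power2_eq_square power3_eq_cube mult_ac)
      qed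
      also have "\<dots> \<le> 2 * Cs * (\<bar>K\<^sub>0\<bar> + C\<eta>) * T powr (3/4) * \<tau>\<^sup>2"
        using tn[OF nn(1)] Cs C\<eta> \<tau> by (intro mult_right_mono mult_left_mono powr_mono2 mult_nonneg_nonneg) auto
      finally have diff: "\<bar>E n k - E 0 k\<bar> \<le> 2 * Cs * (\<bar>K\<^sub>0\<bar> + C\<eta>) * T powr (3/4) * \<tau>\<^sup>2" .
      have "\<bar>E 0 k\<bar> \<le> \<bar>K\<^sub>0\<bar> * \<tau>\<^sup>2 / (8 * \<beta> 1)" by (rule Dsum_inverse_bound[OF N m \<beta> E0' k])
      hence "\<bar>E n k\<bar> \<le> C' * \<tau>\<^sup>2" using diff unfolding C'_def by (simp add: algebra_simps)
      thus "\<bar>V n k - U (real n * \<tau>) k\<bar> \<le> C' * \<tau>\<^sup>2" unfolding E_def .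
    qed
  qed
qed

end
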